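(* Consider the family of cubic fourfolds $Z(F_{a,b})\subset\mathbb{P}^5$, $(a,b)\in\mathbb{A}^2$, where $$F_{a,b}=x_1^2x_2+x_3^2x_4+x_5^2x_6+x_2^2x_3+x_4^2x_5+x_6^2x_1+ax_1x_3x_5+bx_2x_4x_6.$$ There are three curves in $\mathbb{A}^2$ corresponding to singular cubic fourfolds, and these singular cubic fourfolds have only isolated singularities, of type $A_1$ or $A_2$. Moreover, there is an action of the cyclic group $C_6$ on the parameter space $\mathbb{A}^2$ such that the map $(a,b)\mapsto[F_{a,b}]$ induces an embedding $C_6\backslash\mathbb{A}^2\hookrightarrow\overline{\mathcal{F}}_{F_{21}}$ as a Zariski open subset. As a corollary, $\overline{\mathcal{F}}_{F_{21}}$ is a rational surface.
   Context: Everything is over $\mathbb{C}$. $F_{21}$ is the nonabelian group of order $21$, realized in $\mathrm{SL}(6,\mathbb{C})$ as generated by $g_7=\mathrm{diag}(\zeta,\zeta^5,\zeta^4,\zeta^6,\zeta^2,\zeta^3)$, $\zeta=e^{2\pi i/7}$, and the permutation matrix $g_3:e_i\mapsto e_{i+2}$ (indices mod $6$). $\mathcal{V}_{F_{21}}$ is the space of $F_{21}$-invariant cubic forms in $x_1,\dots,x_6$, spanned by $x_1^2x_2+x_3^2x_4+x_5^2x_6$, $x_2^2x_3+x_4^2x_5+x_6^2x_1$, $x_1x_3x_5$, $x_2x_4x_6$. $\overline{\mathcal{F}}_{F_{21}}$ is the GIT quotient of the semistable locus of $\mathbb{P}\mathcal{V}_{F_{21}}$ by the preimage in $\mathrm{SL}(6,\mathbb{C})$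 of the normalizer $N_{\mathrm{PGL}(6,\mathbb{C})}(F_{21})$. *)

theory Defs
  imports
    "HOL-Analysis.Analysis"
    "HOL-Algebra.Coset"
    "HOL-Algebra.Generated_Groups"
    "HOL-Algebra.Group_Action"
    "HOL-Algebra.Elementary_Groups"
    "HOL-Computational_Algebra.Polynomial_Factorial"
begin

section \<open>Varieties as spaces with functions\<close>

text \<open>
  Complex varieties are treated classically: a set of points with its Zariski topology and, for
  every open set \<open>U\<close>, the regular functions on \<open>U\<close>. A regular function on \<open>U\<close> is represented by
  total functions; values outside \<open>U\<close> are irrelevant.
\<close>

record 'p fspace =
  zariski :: "'p topology"
  regular :: "'p set \<Rightarrow> ('p \<Rightarrow> complex) set"

abbreviation points :: "'p fspace \<Rightarrow> 'p set" where
  "points X \<equiv> topspace (zariski X)"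

text \<open>Only for open \<open>U\<close>.\<close>

definition open_subspace :: "'p fspace \<Rightarrow> 'p set \<Rightarrow> 'p fspace" where
  "open_subspace X U = \<lparr>zariski = subtopology (zariski X) U, regular = regular X\<rparr>"

text \<open>
  The quotient of \<open>X\<close> along a map \<open>q\<close> of sets: quotient topology, and as regular functions those
  whose pullback along \<open>q\<close> is regular (for the quotient by a group, the invariant ones).
\<close>

definition quotient_fspace :: "('p \<Rightarrow> 'q) \<Rightarrow> 'p fspace \<Rightarrow> 'q fspace" where
  "quotient_fspace q X =
     \<lparr>zariski = topology (\<lambda>U. U \<subseteq> q ` points X \<and> openin (zariski X) {x \<in> points X. q x \<in> U}),
      regular = (\<lambda>U. {\<phi>. \<phi> \<circ> q \<in> regular X {x \<in> points X. q x \<in> U}})\<rparr>"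

lemma openin_quotient_fspace:
  "openin (zariski (quotient_fspace q X)) U \<longleftrightarrow>
     U \<subseteq> q ` points X \<and> openin (zariski X) {x \<in> points X. q x \<in> U}"
proof -
  have "istopology (\<lambda>U. U \<subseteq> q ` points X \<and> openin (zariski X) {x \<in> points X. q x \<in> U})"
    unfolding istopology_def
  proof (intro conjI allI impI)
    fix S T
    assume S: "S \<subseteq> q ` points X \<and> openin (zariski X) {x \<in> points X. q x \<in> S}"
      and T: "T \<subseteq> q ` points X \<and> openin (zariski X) {x \<in> points X. q x \<in> T}"
    have "{x \<in> points X. q x \<in> S \<inter> T} = {x \<in> points X. q x \<in> S} \<inter> {x \<in> points X. q x \<in> T}"
      by auto
    with S T show "openin (zariski X) {x \<in> points X. q x \<in> S \<inter> T}"
      by auto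
    from S show "S \<inter> T \<subseteq> q ` points X"
      by auto
  next
    fix K
    assume K: "\<forall>S\<in>K. S \<subseteq> q ` points X \<and> openin (zariski X) {x \<in> points X. q x \<in> S}"
    have "{x \<in> points X. q x \<in> \<Union>K} = (\<Union>S\<in>K. {x \<in> points X. q x \<in> S})"
      by auto
    with K show "openin (zariski X) {x \<in> points X. q x \<in> \<Union>K}"
      by auto
    from K show "\<Union>K \<subseteq> q ` points X"
      by auto
  qed
  then show ?thesis
    by (simp add: quotient_fspace_def)
qed

definition open_immersion :: "'p fspace \<Rightarrow> 'q fspace \<Rightarrow> ('p \<Rightarrow> 'q) \<Rightarrow> bool" where
  "open_immersion X Y f \<longleftrightarrow>
     inj_on f (points X) \<and> continuous_map (zariski X) (zariski Y) f \<and>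
     open_map (zariski X) (zariski Y) f \<and>
     (\<forall>U. openin (zariski X) U \<longrightarrow> (\<forall>\<phi>. \<phi> \<in> regular Y (f ` U) \<longleftrightarrow> \<phi> \<circ> f \<in> regular X U))"

definition isomorphic_fspaces :: "'p fspace \<Rightarrow> 'q fspace \<Rightarrow> bool" where
  "isomorphic_fspaces X Y \<longleftrightarrow> (\<exists>f. open_immersion X Y f \<and> f ` points X = points Y)"

definition irreducible_fspace :: "'p fspace \<Rightarrow> bool" where
  "irreducible_fspace X \<longleftrightarrow> points X \<noteq> {} \<and>
     (\<forall>U V. openin (zariski X) U \<and> openin (zariski X) V \<and> U \<noteq> {} \<and> V \<noteq> {} \<longrightarrow> U \<inter> V \<noteq> {})"

text \<open>Meaningful for irreducible varieties.\<close>

definition birational :: "'p fspace \<Rightarrow> 'q fspace \<Rightarrow> bool" where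
  "birational X Y \<longleftrightarrow>
     (\<exists>U V. openin (zariski X) U \<and> U \<noteq> {} \<and> openin (zariski Y) V \<and> V \<noteq> {} \<and>
        isomorphic_fspaces (open_subspace X U) (open_subspace Y V))"


section \<open>Affine and projective spaces\<close>

text \<open>
  Two kinds of complex vector spaces occur: \<open>complex^'n\<close>, and spaces of functions
  \<open>'x \<Rightarrow> complex\<close> (forms). Both are handled through a set \<open>E\<close> of linear functionals spanning the
  dual: the coordinates, respectively the evaluations at the points of \<open>'x\<close>; \<open>sc\<close> is the
  multiplication by scalars.
\<close>

inductive_set poly_functions :: "('v \<Rightarrow> complex) set \<Rightarrow> ('v \<Rightarrow> complex) set"
  for E :: "('v \<Rightarrow> complex) set" where
  const: "(\<lambda>_. c) \<in> poly_functions E"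
| generator: "e \<in> E \<Longrightarrow> e \<in> poly_functions E"
| add: "f \<in> poly_functions E \<Longrightarrow> g \<in> poly_functions E \<Longrightarrow> (\<lambda>v. f v + g v) \<in> poly_functions E"
| mult: "f \<in> poly_functions E \<Longrightarrow> g \<in> poly_functions E \<Longrightarrow> (\<lambda>v. f v * g v) \<in> poly_functions E"

definition coordinates :: "(complex^'n \<Rightarrow> complex) set" where
  "coordinates = range (\<lambda>i v. v $ i)"

definition evaluations :: "(('x \<Rightarrow> complex) \<Rightarrow> complex) set" where
  "evaluations = range (\<lambda>x F. F x)"

definition scale_function :: "complex \<Rightarrow> ('x \<Rightarrow> complex) \<Rightarrow> 'x \<Rightarrow> complex" where
  "scale_function c F = (\<lambda>x. c * F x)"

definition homogeneous_on ::
    "(complex \<Rightarrow> 'v \<Rightarrow> 'v) \<Rightarrow> 'v set \<Rightarrow> nat \<Rightarrow> ('v \<Rightarrow> complex) \<Rightarrow> bool" where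
  "homogeneous_on sc W d f \<longleftrightarrow> (\<forall>c. \<forall>v\<in>W. f (sc c v) = c ^ d * f v)"

text \<open>The quasi-affine space on a locally closed subset \<open>S\<close>.\<close>

definition affine_fspace :: "('v \<Rightarrow> complex) set \<Rightarrow> 'v set \<Rightarrow> 'v fspace" where
  "affine_fspace E S =
     (let T = topology_generated_by {{v \<in> S. f v \<noteq> 0} | f. f \<in> poly_functions E} in
      \<lparr>zariski = T,
       regular = (\<lambda>U. {\<phi>. \<forall>x\<in>U. \<exists>V g h. openin T V \<and> x \<in> V \<and> V \<subseteq> U \<and>
                         g \<in> poly_functions E \<and> h \<in> poly_functions E \<and>
                         (\<forall>y\<in>V. h y \<noteq> 0 \<and> \<phi> y = g y / h y)})\<rparr>)"

abbreviation affine_plane :: "(complex^2) fspace" where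
  "affine_plane \<equiv> affine_fspace coordinates UNIV"

text \<open>
  The point \<open>[v]\<close> of a projective space is the set of nonzero multiples of \<open>v\<close>; the projective
  space of a vector space is the quotient of \<open>W\<close>, its set of nonzero vectors, by scalars.
\<close>

definition proj_point :: "(complex \<Rightarrow> 'v \<Rightarrow> 'v) \<Rightarrow> 'v \<Rightarrow> 'v set" where
  "proj_point sc v = {sc c v | c. c \<noteq> 0}"

definition proj_fspace ::
    "('v \<Rightarrow> complex) set \<Rightarrow> (complex \<Rightarrow> 'v \<Rightarrow> 'v) \<Rightarrow> 'v set \<Rightarrow> 'v set fspace" where
  "proj_fspace E sc W = quotient_fspace (proj_point sc) (affine_fspace E W)"

definition projective_space :: "(complex^'n) set fspace" where
  "projective_space = proj_fspace coordinates (*s) (UNIV - {0})"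

text \<open>A surface is rational if it is irreducible and birational to the projective plane.\<close>

definition rational_surface :: "'p fspace \<Rightarrow> bool" where
  "rational_surface X \<longleftrightarrow>
     irreducible_fspace X \<and> birational X (projective_space :: (complex^3) set fspace)"

text \<open>
  Polynomials in two variables are elements of \<open>complex poly poly\<close>, the first coordinate being the
  inner variable.
\<close>

definition irreducible_plane_curve :: "(complex^2) set \<Rightarrow> bool" where
  "irreducible_plane_curve C \<longleftrightarrow>
     (\<exists>p :: complex poly poly. irreducible p \<and> C = {v. poly (poly p [:v $ 2:]) (v $ 1) = 0})"


section \<open>GIT quotients\<close>

text \<open>
  \<open>T\<close> is a group of linear transformations of a vector space with set \<open>W\<close> of nonzero vectors.
  The GIT quotient is the good quotient of the semistable locus: its points are the S-equivalence
  classes, two semistable points being S-equivalent if the closures of their orbits in the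
  semistable locus meet.
\<close>

definition semistable_locus :: "('v \<Rightarrow> complex) set \<Rightarrow> (complex \<Rightarrow> 'v \<Rightarrow> 'v) \<Rightarrow> 'v set \<Rightarrow>
    ('v \<Rightarrow> 'v) set \<Rightarrow> 'v set set" where
  "semistable_locus E sc W T =
     {proj_point sc v | v. v \<in> W \<and>
        (\<exists>d f. d > 0 \<and> f \<in> poly_functions E \<and> homogeneous_on sc W d f \<and>
               (\<forall>t\<in>T. \<forall>w\<in>W. f (t w) = f w) \<and> f v \<noteq> 0)}"

definition semistable_fspace :: "('v \<Rightarrow> complex) set \<Rightarrow> (complex \<Rightarrow> 'v \<Rightarrow> 'v) \<Rightarrow> 'v set \<Rightarrow>
    ('v \<Rightarrow> 'v) set \<Rightarrow> 'v set fspace" where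
  "semistable_fspace E sc W T =
     open_subspace (proj_fspace E sc W) (semistable_locus E sc W T)"

definition s_class :: "('v \<Rightarrow> complex) set \<Rightarrow> (complex \<Rightarrow> 'v \<Rightarrow> 'v) \<Rightarrow> 'v set \<Rightarrow>
    ('v \<Rightarrow> 'v) set \<Rightarrow> 'v set \<Rightarrow> 'v set set" where
  "s_class E sc W T P =
     (let X = zariski (semistable_fspace E sc W T) in
      {Q \<in> semistable_locus E sc W T.
         (X closure_of {t ` P | t. t \<in> T}) \<inter> (X closure_of {t ` Q | t. t \<in> T}) \<noteq> {}})"

definition git_quotient :: "('v \<Rightarrow> complex) set \<Rightarrow> (complex \<Rightarrow> 'v \<Rightarrow> 'v) \<Rightarrow> 'v set \<Rightarrow>
    ('v \<Rightarrow> 'v) set \<Rightarrow> 'v set set fspace" where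
  "git_quotient E sc W T = quotient_fspace (s_class E sc W T) (semistable_fspace E sc W T)"


section \<open>The group and its invariant cubic forms\<close>

definition GL6 :: "(complex^6^6) monoid" where
  "GL6 = \<lparr>carrier = {A. invertible A}, mult = (**), one = mat 1\<rparr>"

definition scalars6 :: "(complex^6^6) set" where
  "scalars6 = {mat c | c. c \<noteq> 0}"

definition PGL6 :: "(complex^6^6) set monoid" where
  "PGL6 = GL6 Mod scalars6"

definition to_PGL6 :: "complex^6^6 \<Rightarrow> (complex^6^6) set" where
  "to_PGL6 A = scalars6 #>\<^bsub>GL6\<^esub> A"

definition zeta7 :: complex where
  "zeta7 = exp (2 * complex_of_real pi * \<i> / 7)"

text \<open>
  The index type \<open>6\<close> consists of the residues modulo \<open>6\<close>, and the numeral \<open>6\<close> denotes \<open>0\<close>; so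
  \<open>j + 2\<close> is taken modulo \<open>6\<close>, and \<open>1, \<dots>, 6\<close> are the six indices.
\<close>

definition g7 :: "complex^6^6" where
  "g7 = (\<chi> i j. if i = j then
           (if i = 1 then zeta7 else if i = 2 then zeta7 ^ 5 else if i = 3 then zeta7 ^ 4
            else if i = 4 then zeta7 ^ 6 else if i = 5 then zeta7 ^ 2 else zeta7 ^ 3)
         else 0)"

definition g3 :: "complex^6^6" where
  "g3 = (\<chi> i j. if i = j + 2 then 1 else 0)"

definition F21 :: "(complex^6^6) set" where
  "F21 = generate GL6 {g7, g3}"

definition cubic_forms :: "(complex^6 \<Rightarrow> complex) set" where
  "cubic_forms = {F \<in> poly_functions coordinates. homogeneous_on (*s) UNIV 3 F}"

definition V_F21 :: "(complex^6 \<Rightarrow> complex) set" where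
  "V_F21 = {F \<in> cubic_forms. \<forall>A\<in>F21. \<forall>x. F (A *v x) = F x}"

definition SL6_normalizer :: "(complex^6^6) set" where
  "SL6_normalizer = {A. det A = 1 \<and> to_PGL6 A \<in> normalizer PGL6 (to_PGL6 ` F21)}"

definition form_action :: "complex^6^6 \<Rightarrow> (complex^6 \<Rightarrow> complex) \<Rightarrow> complex^6 \<Rightarrow> complex" where
  "form_action A F = (\<lambda>x. F (matrix_inv A *v x))"

definition F21_moduli :: "(complex^6 \<Rightarrow> complex) set set fspace" where
  "F21_moduli =
     git_quotient evaluations scale_function (V_F21 - {\<lambda>x. 0}) (form_action ` SL6_normalizer)"

definition F21_moduli_class :: "(complex^6 \<Rightarrow> complex) \<Rightarrow> (complex^6 \<Rightarrow> complex) set set" where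
  "F21_moduli_class F =
     s_class evaluations scale_function (V_F21 - {\<lambda>x. 0}) (form_action ` SL6_normalizer)
       (proj_point scale_function F)"


section \<open>Singularities of cubic fourfolds\<close>

definition singular_locus :: "(complex^6 \<Rightarrow> complex) \<Rightarrow> (complex^6) set set" where
  "singular_locus F =
     {proj_point (*s) x | x. x \<noteq> 0 \<and> F x = 0 \<and>
        (\<forall>i. deriv (\<lambda>z. F (x + z *s axis i 1)) 0 = 0)}"

definition isolated_singularity :: "(complex^6 \<Rightarrow> complex) \<Rightarrow> (complex^6) set \<Rightarrow> bool" where
  "isolated_singularity F P \<longleftrightarrow>
     (\<exists>U. openin (zariski projective_space) U \<and> U \<inter> singular_locus F = {P})"

definition holomorphic_on_vec :: "(complex^'n \<Rightarrow> complex) \<Rightarrow> (complex^'n) set \<Rightarrow> bool" where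
  "holomorphic_on_vec f N \<longleftrightarrow>
     (\<forall>y\<in>N. \<exists>D. (f has_derivative D) (at y) \<and> (\<forall>c h. D (c *s h) = c * D h))"

text \<open>
  The hypersurface germ \<open>(Z(F), P)\<close> is of type \<open>A\<^sub>k\<close> if it is analytically isomorphic to
  \<open>y\<^sub>1\<^sup>2 + \<dots> + y\<^sub>4\<^sup>2 + y\<^sub>5^(k+1) = 0\<close>: in suitable local analytic coordinates of the projective
  space centred at \<open>P\<close> the latter equation defines \<open>Z(F)\<close>, up to a unit \<open>u\<close>. The coordinates are
  given by the inverse chart \<open>y \<mapsto> [\<phi> y]\<close>; it is a local biholomorphism because its differential,
  which takes values in the quotient of the ambient vector space by the line spanned by
  \<open>\<phi> 0\<close>, is injective.
\<close>

definition singularity_type_A ::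
    "nat \<Rightarrow> (complex^6 \<Rightarrow> complex) \<Rightarrow> (complex^6) set \<Rightarrow> bool" where
  "singularity_type_A k F P \<longleftrightarrow>
     (\<exists>(N :: (complex^5) set) (\<phi> :: complex^5 \<Rightarrow> complex^6) u D.
        open N \<and> 0 \<in> N \<and>
        (\<forall>i. holomorphic_on_vec (\<lambda>y. \<phi> y $ i) N) \<and> \<phi> 0 \<noteq> 0 \<and> P = proj_point (*s) (\<phi> 0) \<and>
        (\<phi> has_derivative D) (at 0) \<and> (\<forall>h c. D h = c *s \<phi> 0 \<longrightarrow> h = 0) \<and>
        holomorphic_on_vec u N \<and> (\<forall>y\<in>N. u y \<noteq> 0) \<and>
        (\<forall>y\<in>N. F (\<phi> y) =
           u y * ((y $ 1)\<^sup>2 + (y $ 2)\<^sup>2 + (y $ 3)\<^sup>2 + (y $ 4)\<^sup>2 + (y $ 5) ^ (k + 1))))"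

definition cubic_family :: "complex \<Rightarrow> complex \<Rightarrow> complex^6 \<Rightarrow> complex" where
  "cubic_family a b x =
     (x $ 1)\<^sup>2 * x $ 2 + (x $ 3)\<^sup>2 * x $ 4 + (x $ 5)\<^sup>2 * x $ 6
     + (x $ 2)\<^sup>2 * x $ 3 + (x $ 4)\<^sup>2 * x $ 5 + (x $ 6)\<^sup>2 * x $ 1
     + a * x $ 1 * x $ 3 * x $ 5 + b * x $ 2 * x $ 4 * x $ 6"

end

theory Submission
  imports Defs
begin

text \<open>
  The diagonal matrices of order 21 taking \<open>F\<^bsub>a,b\<^esub>\<close> to another member of the family, up to a
  scalar, move every singular point to one of the form \<open>(1, \<rho>, 1, \<rho>, 1, \<rho>)\<close>. This happens exactly when
  \<open>2 \<rho> + \<rho>\<^sup>2 + a = 0\<close> and \<open>1 + 2 \<rho> + b \<rho>\<^sup>2 = 0\<close>, a rational curve in the parameter plane, and rotating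
  \<open>(a, b)\<close> by the cube roots of unity gives the three curves. In coordinates adapted to the cyclic
  symmetry of such a point the Hessian has corank at most one, and completing the square leaves
  \<open>A\<^sub>1\<close> or \<open>A\<^sub>2\<close>.

  The normalizer of \<open>F\<^sub>2\<^sub>1\<close> consists of monomial matrices. On the coefficients \<open>c\<^sub>1, \<dots>, c\<^sub>4\<close> of an
  invariant cubic it acts through a one-dimensional torus, finitely many further diagonal scalings and
  the involution exchanging \<open>(c\<^sub>1, c\<^sub>3)\<close> and \<open>(c\<^sub>2, c\<^sub>4)\<close>. Where \<open>c\<^sub>1 c\<^sub>2 \<noteq> 0\<close> the form is semistable and can
  be normalised to \<open>F\<^bsub>a,b\<^esub>\<close>, the residual ambiguity being the group of order 6 generated by
  \<open>(a, b) \<mapsto> (\<omega> b, \<omega> a)\<close>; explicit invariants of the coefficients separate its orbits.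
  Where \<open>a + b \<noteq> 0\<close> the two invariants \<open>(a + b)\<^sup>3\<close> and \<open>(a + b) a b\<close> are coordinates on the quotient,
  since averaging over the group turns functions of \<open>(a, b)\<close> into functions of these; hence it is rational.
\<close>

subsection \<open>Affine spaces with functions\<close>

text \<open>The full ring of invariants is never computed. On the slice where the first two
  coefficients are 1, the invariants of degree 12 used here, divided by \<open>inv_I\<close>, become
  (a + b)^3, (a + b) a b and (a b)^3; these three already separate the orbits of the group of order
  6. What shapes the argument is S-equivalence: two classes agree when orbit closures meet, so a
  common limit point has to be kept in the locus where \<open>inv_I\<close> is nonzero. It cannot
  leave that locus, because \<open>inv_I\<close>, \<open>inv_J\<close> and \<open>inv_L\<close>
  would vanish on it together, and the one-dimensional torus makes such a form unstable. Thus the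
  locus is a union of classes, and \<open>normal_params\<close> retracts it onto the slice. With s =
  a + b and m = a b the remaining group of order 3 acts with weights 1 and 2, so the quotient of the
  plane is the surface x z = y^3 in s^3, s m, m^3. It is singular at the origin; this is why two
  invariants serve as coordinates only where s is inverted.\<close>

lemma poly_functions_diff:
  assumes "f \<in> poly_functions E" "g \<in> poly_functions E"
  shows "(\<lambda>v. f v - g v) \<in> poly_functions E"
  using poly_functions.add [OF assms(1) poly_functions.mult [OF poly_functions.const [of "-1"] assms(2)]]
  by simp

lemma poly_functions_power:
  "f \<in> poly_functions E \<Longrightarrow> (\<lambda>v. f v ^ n) \<in> poly_functions E"
  by (induction n) (auto intro: poly_functions.const poly_functions.add poly_functions.mult)

lemma coordinate_poly_function: "(\<lambda>v. v $ i) \<in> poly_functions coordinates"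
  by (auto simp: coordinates_def intro: poly_functions.generator)

lemmas poly_function_intros =
  poly_functions.const poly_functions.add poly_functions.mult poly_functions_diff
  poly_functions_power coordinate_poly_function

lemma poly_functions_compose:
  assumes "f \<in> poly_functions E" "\<And>e. e \<in> E \<Longrightarrow> (\<lambda>x. e (m x)) \<in> poly_functions E'"
  shows "(\<lambda>x. f (m x)) \<in> poly_functions E'"
  using assms(1)
  by induction (auto intro: assms(2) poly_functions.const poly_functions.add poly_functions.mult)

text \<open>Multiplying polynomial functions intersects their nonvanishing sets, so these sets form
  a basis and not only a subbasis. This gives a pointwise test for openness, with one function per
  point.\<close>

lemma openin_affine_fspace:
  "openin (zariski (affine_fspace E S)) U \<longleftrightarrow>
     U \<subseteq> S \<and> (\<forall>x\<in>U. \<exists>f\<in>poly_functions E. f x \<noteq> 0 \<and> (\<forall>y\<in>S. f y \<noteq> 0 \<longrightarrow> y \<in> U))"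
    (is "?L \<longleftrightarrow> ?R")
proof
  let ?B = "{{v \<in> S. f v \<noteq> 0} | f. f \<in> poly_functions E}"
  assume ?L
  then have "generate_topology_on ?B U"
    by (simp add: affine_fspace_def openin_topology_generated_by_iff)
  then show ?R
  proof induction
    case (Int a b)
    show ?case
    proof (intro conjI ballI)
      fix x assume "x \<in> a \<inter> b"
      then obtain f g where "f \<in> poly_functions E" "f x \<noteq> 0" "\<forall>y\<in>S. f y \<noteq> 0 \<longrightarrow> y \<in> a"
        "g \<in> poly_functions E" "g x \<noteq> 0" "\<forall>y\<in>S. g y \<noteq> 0 \<longrightarrow> y \<in> b"
        using Int.IH by blast
      then show "\<exists>f\<in>poly_functions E. f x \<noteq> 0 \<and> (\<forall>y\<in>S. f y \<noteq> 0 \<longrightarrow> y \<in> a \<inter> b)"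
        by (intro bexI [of _ "\<lambda>v. f v * g v"]) (auto intro: poly_functions.mult)
    qed (use Int in auto)
  next
    case (UN K)
    show ?case
    proof (intro conjI ballI)
      fix x assume "x \<in> \<Union>K"
      then obtain k where k: "k \<in> K" "x \<in> k" by auto
      with UN obtain f where "f \<in> poly_functions E" "f x \<noteq> 0" "\<forall>y\<in>S. f y \<noteq> 0 \<longrightarrow> y \<in> k"
        by blast
      with k show "\<exists>f\<in>poly_functions E. f x \<noteq> 0 \<and> (\<forall>y\<in>S. f y \<noteq> 0 \<longrightarrow> y \<in> \<Union>K)"
        by (intro bexI [of _ f]) auto
    qed (use UN in auto)
  next
    case (Basis s)
    then show ?case by blast
  qed simp
next
  assume R: ?R
  have "openin (zariski (affine_fspace E S)) {v \<in> S. f v \<noteq> 0}" if "f \<in> poly_functions E" for f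
    using that
    by (auto simp: affine_fspace_def openin_topology_generated_by_iff intro: generate_topology_on.Basis)
  moreover have "U = \<Union>{{v \<in> S. f v \<noteq> 0} | f. f \<in> poly_functions E \<and> {v \<in> S. f v \<noteq> 0} \<subseteq> U}"
    (is "_ = \<Union>?K")
  proof
    show "U \<subseteq> \<Union>?K"
    proof
      fix x assume "x \<in> U"
      with R obtain f where "f \<in> poly_functions E" "f x \<noteq> 0" "\<forall>y\<in>S. f y \<noteq> 0 \<longrightarrow> y \<in> U" "x \<in> S"
        by blast
      then show "x \<in> \<Union>?K"
        by (intro UnionI [of "{v \<in> S. f v \<noteq> 0}"]) auto
    qed
  qed auto
  ultimately show ?L
    by (smt (verit, best) mem_Collect_eq openin_Union)
qed

lemma openin_affine_fspace_subset:
  assumes "openin (zariski (affine_fspace E S)) U"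
  shows "U \<subseteq> S"
  using openin_affine_fspace [THEN iffD1, OF assms] by (rule conjunct1)

lemma openin_affine_fspaceE:
  assumes "openin (zariski (affine_fspace E S)) U" "x \<in> U"
  obtains f where "f \<in> poly_functions E" "f x \<noteq> 0" "\<forall>y\<in>S. f y \<noteq> 0 \<longrightarrow> y \<in> U"
  using openin_affine_fspace [THEN iffD1, OF assms(1)] assms(2) that by (meson)

lemma openin_affine_fspace_basis:
  assumes "f \<in> poly_functions E"
  shows "openin (zariski (affine_fspace E S)) {v \<in> S. f v \<noteq> 0}"
  by (rule openin_affine_fspace [THEN iffD2]) (use assms in auto)

lemma points_affine_fspace [simp]: "points (affine_fspace E S) = S"
proof -
  have "openin (zariski (affine_fspace E S)) S"
    by (auto simp: openin_affine_fspace intro!: bexI [of _ "\<lambda>_. 1"] poly_functions.const)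
  then have "S \<subseteq> points (affine_fspace E S)" by (rule openin_subset)
  moreover have "points (affine_fspace E S) \<subseteq> S"
    by (rule openin_affine_fspace_subset) (rule openin_topspace)
  ultimately show ?thesis by (intro subset_antisym)
qed

lemma regular_affine_fspace:
  "\<phi> \<in> regular (affine_fspace E S) U \<longleftrightarrow>
    (\<forall>x\<in>U. \<exists>V g h. openin (zariski (affine_fspace E S)) V \<and> x \<in> V \<and> V \<subseteq> U \<and>
       g \<in> poly_functions E \<and> h \<in> poly_functions E \<and> (\<forall>y\<in>V. h y \<noteq> 0 \<and> \<phi> y = g y / h y))"
  by (simp add: affine_fspace_def Let_def)

text \<open>The neighbourhood in the definition of regularity is shrunk to the nonvanishing set of a
  single \<open>f\<close>, so that locality can be handled by multiplying functions.\<close>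

lemma regular_affine_fspaceD:
  assumes "\<phi> \<in> regular (affine_fspace E S) U" "x \<in> U"
  obtains f g h where "f \<in> poly_functions E" "g \<in> poly_functions E" "h \<in> poly_functions E"
    "f x \<noteq> 0" "\<And>y. y \<in> S \<Longrightarrow> f y \<noteq> 0 \<Longrightarrow> y \<in> U \<and> h y \<noteq> 0 \<and> \<phi> y = g y / h y"
proof -
  obtain V g h where V: "openin (zariski (affine_fspace E S)) V" "x \<in> V" "V \<subseteq> U"
    and gh: "g \<in> poly_functions E" "h \<in> poly_functions E" "\<forall>y\<in>V. h y \<noteq> 0 \<and> \<phi> y = g y / h y"
    using assms(1) [unfolded regular_affine_fspace, rule_format, OF assms(2)] by blast
  obtain f where "f \<in> poly_functions E" "f x \<noteq> 0" "\<forall>y\<in>S. f y \<noteq> 0 \<longrightarrow> y \<in> V"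
    by (rule openin_affine_fspaceE [OF V(1,2)])
  with V gh show thesis by (intro that [of f g h]) blast+
qed

lemma regular_affine_fspaceI:
  assumes "U \<subseteq> S" and
   "\<And>x. x \<in> U \<Longrightarrow> \<exists>f g h. f \<in> poly_functions E \<and> g \<in> poly_functions E \<and> h \<in> poly_functions E \<and>
    f x \<noteq> 0 \<and> (\<forall>y\<in>S. f y \<noteq> 0 \<longrightarrow> y \<in> U \<and> h y \<noteq> 0 \<and> \<phi> y = g y / h y)"
  shows "\<phi> \<in> regular (affine_fspace E S) U"
  unfolding regular_affine_fspace
proof
  fix x assume x: "x \<in> U"
  then obtain f g h where fgh: "f \<in> poly_functions E" "g \<in> poly_functions E" "h \<in> poly_functions E"
    "f x \<noteq> 0" "\<forall>y\<in>S. f y \<noteq> 0 \<longrightarrow> y \<in> U \<and> h y \<noteq> 0 \<and> \<phi> y = g y / h y"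
    using assms(2) [OF x] by blast
  have "openin (zariski (affine_fspace E S)) {v \<in> S. f v \<noteq> 0}"
    using fgh(1) by (rule openin_affine_fspace_basis)
  then show "\<exists>V g h. openin (zariski (affine_fspace E S)) V \<and> x \<in> V \<and> V \<subseteq> U \<and>
       g \<in> poly_functions E \<and> h \<in> poly_functions E \<and> (\<forall>y\<in>V. h y \<noteq> 0 \<and> \<phi> y = g y / h y)"
    using x fgh assms(1) by (intro exI [of _ "{v \<in> S. f v \<noteq> 0}"] exI [of _ g] exI [of _ h]) auto
qed

text \<open>A morphism on \<open>D\<close> given by fractions whose denominators are powers of one
  function \<open>d\<close>. The exponent may depend on the functional \<open>e\<close>, since
  \<open>E'\<close> can be infinite, as for \<open>evaluations\<close>.\<close>

definition rational_map_on ::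
    "('v \<Rightarrow> complex) set \<Rightarrow> ('w \<Rightarrow> complex) set \<Rightarrow> 'v set \<Rightarrow> ('v \<Rightarrow> 'w) \<Rightarrow> bool" where
  "rational_map_on E E' D m \<longleftrightarrow>
     (\<exists>d\<in>poly_functions E. (\<forall>x\<in>D. d x \<noteq> 0) \<and>
        (\<forall>e\<in>E'. \<exists>k. \<exists>g\<in>poly_functions E. \<forall>x\<in>D. e (m x) * d x ^ k = g x))"

lemma rational_map_on_poly:
  assumes "d \<in> poly_functions E" "\<And>x. x \<in> D \<Longrightarrow> d x \<noteq> 0"
    "\<forall>e\<in>E'. \<exists>k. \<exists>g\<in>poly_functions E. \<forall>x\<in>D. e (m x) * d x ^ k = g x"
    "f \<in> poly_functions E'"
  shows "\<exists>k. \<exists>g\<in>poly_functions E. \<forall>x\<in>D. f (m x) * d x ^ k = g x"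
  using assms(4)
proof induction
  case (const c)
  then show ?case by (intro exI [of _ 0] bexI [of _ "\<lambda>_. c"]) (auto intro: poly_functions.const)
next
  case (generator e)
  then show ?case using assms(3) by blast
next
  case (add f1 f2)
  then obtain k1 k2 g1 g2 where
    "g1 \<in> poly_functions E" "g2 \<in> poly_functions E"
    "\<forall>x\<in>D. f1 (m x) * d x ^ k1 = g1 x" "\<forall>x\<in>D. f2 (m x) * d x ^ k2 = g2 x" by blast
  then show ?case using assms(1)
    by (intro exI [of _ "k1 + k2"] bexI [of _ "\<lambda>x. g1 x * d x ^ k2 + g2 x * d x ^ k1"])
      (auto simp: algebra_simps power_add intro!: poly_functions_power poly_functions.add poly_functions.mult)
next
  case (mult f1 f2)
  then obtain k1 k2 g1 g2 where
    "g1 \<in> poly_functions E" "g2 \<in> poly_functions E"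
    "\<forall>x\<in>D. f1 (m x) * d x ^ k1 = g1 x" "\<forall>x\<in>D. f2 (m x) * d x ^ k2 = g2 x" by blast
  then show ?case using assms(1)
    by (intro exI [of _ "k1 + k2"] bexI [of _ "\<lambda>x. g1 x * g2 x"])
      (auto simp: algebra_simps power_add intro!: poly_functions.mult)
qed

lemma rational_map_onE:
  assumes "rational_map_on E E' D m"
  obtains d where "d \<in> poly_functions E" "\<And>x. x \<in> D \<Longrightarrow> d x \<noteq> 0"
    "\<And>f. f \<in> poly_functions E' \<Longrightarrow> \<exists>k. \<exists>g\<in>poly_functions E. \<forall>x\<in>D. f (m x) * d x ^ k = g x"
  using assms rational_map_on_poly [of _ E D E' m] unfolding rational_map_on_def by metis

text \<open>After clearing denominators the pullback of \<open>f\<close> becomes a polynomial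
  function with the same zeros on \<open>D\<close>. The extra factor \<open>f0\<close> vanishes on
  \<open>S\<close> outside \<open>D\<close> and thereby confines the basic open set to points where
  the map is under control.\<close>

lemma openin_rational_preimage:
  assumes m: "rational_map_on E E' D m" "m ` D \<subseteq> S'"
    and D: "openin (zariski (affine_fspace E S)) D"
    and U: "openin (zariski (affine_fspace E' S')) U"
  shows "openin (zariski (affine_fspace E S)) {x \<in> D. m x \<in> U}"
  unfolding openin_affine_fspace
proof (intro conjI ballI)
  show "{x \<in> D. m x \<in> U} \<subseteq> S" using openin_affine_fspace_subset [OF D] by blast
  fix x assume x: "x \<in> {x \<in> D. m x \<in> U}"
  obtain d where d: "d \<in> poly_functions E" "\<And>x. x \<in> D \<Longrightarrow> d x \<noteq> 0"
    "\<And>f. f \<in> poly_functions E' \<Longrightarrow> \<exists>k. \<exists>g\<in>poly_functions E. \<forall>x\<in>D. f (m x) * d x ^ k = g x"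
    by (rule rational_map_onE [OF m(1)]) blast
  have "m x \<in> U" using x by simp
  then obtain f where f: "f \<in> poly_functions E'" "f (m x) \<noteq> 0" "\<forall>y\<in>S'. f y \<noteq> 0 \<longrightarrow> y \<in> U"
    by (rule openin_affine_fspaceE [OF U])
  have "x \<in> D" using x by simp
  then obtain f0 where f0: "f0 \<in> poly_functions E" "f0 x \<noteq> 0" "\<forall>y\<in>S. f0 y \<noteq> 0 \<longrightarrow> y \<in> D"
    by (rule openin_affine_fspaceE [OF D])
  obtain k g where g: "g \<in> poly_functions E" "\<forall>x\<in>D. f (m x) * d x ^ k = g x"
    using d(3) [OF f(1)] by blast
  show "\<exists>f\<in>poly_functions E. f x \<noteq> 0 \<and> (\<forall>y\<in>S. f y \<noteq> 0 \<longrightarrow> y \<in> {x \<in> D. m x \<in> U})"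
  proof (intro bexI [of _ "\<lambda>y. f0 y * g y"] conjI ballI impI)
    show "f0 x * g x \<noteq> 0"
      using f0 g x f d(2) by (metis (no_types, lifting) mem_Collect_eq mult_eq_0_iff power_not_zero)
    show "y \<in> {x \<in> D. m x \<in> U}" if "y \<in> S" "f0 y * g y \<noteq> 0" for y
    proof -
      have "y \<in> D" using that f0 by auto
      then have "f (m y) \<noteq> 0" using that g(2) by auto
      then show ?thesis using \<open>y \<in> D\<close> f(3) m(2) by auto
    qed
  qed (use f0 g in \<open>simp add: poly_functions.mult\<close>)
qed

lemma regular_rational_pullback:
  assumes m: "rational_map_on E E' D m" "m ` D \<subseteq> S'"
    and D: "openin (zariski (affine_fspace E S)) D"
    and W: "W = {x \<in> D. m x \<in> U}"
    and \<phi>: "\<phi> \<in> regular (affine_fspace E' S') U"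
  shows "\<phi> \<circ> m \<in> regular (affine_fspace E S) W"
  unfolding W
proof (rule regular_affine_fspaceI)
  show "{x \<in> D. m x \<in> U} \<subseteq> S" using openin_affine_fspace_subset [OF D] by blast
  fix x assume x: "x \<in> {x \<in> D. m x \<in> U}"
  obtain d where d: "d \<in> poly_functions E" "\<And>x. x \<in> D \<Longrightarrow> d x \<noteq> 0"
    "\<And>f. f \<in> poly_functions E' \<Longrightarrow> \<exists>k. \<exists>g\<in>poly_functions E. \<forall>x\<in>D. f (m x) * d x ^ k = g x"
    by (rule rational_map_onE [OF m(1)]) blast
  obtain f g h where fgh: "f \<in> poly_functions E'" "g \<in> poly_functions E'" "h \<in> poly_functions E'"
    "f (m x) \<noteq> 0" "\<And>y. y \<in> S' \<Longrightarrow> f y \<noteq> 0 \<Longrightarrow> y \<in> U \<and> h y \<noteq> 0 \<and> \<phi> y = g y / h y"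
    using regular_affine_fspaceD [OF \<phi>, of "m x"] x by blast
  have "x \<in> D" using x by simp
  then obtain f0 where f0: "f0 \<in> poly_functions E" "f0 x \<noteq> 0" "\<forall>y\<in>S. f0 y \<noteq> 0 \<longrightarrow> y \<in> D"
    by (rule openin_affine_fspaceE [OF D])
  obtain k1 f' where f': "f' \<in> poly_functions E" "\<forall>x\<in>D. f (m x) * d x ^ k1 = f' x"
    using d(3) [OF fgh(1)] by blast
  obtain k2 g' where g': "g' \<in> poly_functions E" "\<forall>x\<in>D. g (m x) * d x ^ k2 = g' x"
    using d(3) [OF fgh(2)] by blast
  obtain k3 h' where h': "h' \<in> poly_functions E" "\<forall>x\<in>D. h (m x) * d x ^ k3 = h' x"
    using d(3) [OF fgh(3)] by blast
  show "\<exists>f g h. f \<in> poly_functions E \<and> g \<in> poly_functions E \<and> h \<in> poly_functions E \<and>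
       f x \<noteq> 0 \<and> (\<forall>y\<in>S. f y \<noteq> 0 \<longrightarrow> y \<in> {x \<in> D. m x \<in> U} \<and> h y \<noteq> 0 \<and> (\<phi> \<circ> m) y = g y / h y)"
  proof (intro exI conjI ballI impI)
    show "(\<lambda>y. f0 y * f' y) \<in> poly_functions E" using f0 f' by (simp add: poly_functions.mult)
    \<comment> \<open>Numerator and denominator are cleared by different powers of \<open>d\<close>,
      so each takes the exponent of the other.\<close>
    show "(\<lambda>y. g' y * d y ^ k3) \<in> poly_functions E" "(\<lambda>y. h' y * d y ^ k2) \<in> poly_functions E"
      using g' h' d(1) by (simp_all add: poly_functions.mult poly_functions_power)
    show "f0 x * f' x \<noteq> 0"
      using f0 f' x fgh(4) d(2)
      by (metis (no_types, lifting) mem_Collect_eq mult_eq_0_iff power_not_zero)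
    fix y assume y: "y \<in> S" "f0 y * f' y \<noteq> 0"
    then have yD: "y \<in> D" using f0 by auto
    then have "f (m y) \<noteq> 0" using y f' by auto
    with yD m(2) fgh(5) have U: "m y \<in> U" "h (m y) \<noteq> 0" "\<phi> (m y) = g (m y) / h (m y)" by auto
    with yD show "y \<in> {x \<in> D. m x \<in> U}" by simp
    have dy: "d y \<noteq> 0" using d(2) yD by simp
    then show "h' y * d y ^ k2 \<noteq> 0"
      using U h' yD by (metis mult_eq_0_iff power_not_zero)
    show "(\<phi> \<circ> m) y = g' y * d y ^ k3 / (h' y * d y ^ k2)"
    proof -
      have "g' y = g (m y) * d y ^ k2" "h' y = h (m y) * d y ^ k3"
        using g'(2) h'(2) yD by simp_all
      then show ?thesis using U dy by simp
    qed
  qed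
qed

lemma rational_map_on_polyI:
  assumes "\<And>e. e \<in> E' \<Longrightarrow> (\<lambda>x. e (m x)) \<in> poly_functions E"
  shows "rational_map_on E E' D m"
  unfolding rational_map_on_def
proof (intro bexI [of _ "\<lambda>_. 1"] conjI ballI)
  fix e assume "e \<in> E'"
  then show "\<exists>k. \<exists>g\<in>poly_functions E. \<forall>x\<in>D. e (m x) * 1 ^ k = g x"
    using assms by (intro exI [of _ 0] bexI [of _ "\<lambda>x. e (m x)"]) auto
qed (auto intro: poly_functions.const)

section \<open>Quotients and open subspaces\<close>

lemma points_quotient_fspace [simp]: "points (quotient_fspace q X) = q ` points X"
proof
  have "{x \<in> points X. q x \<in> q ` points X} = points X" by auto
  then have "openin (zariski (quotient_fspace q X)) (q ` points X)"
    by (simp add: openin_quotient_fspace)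
  then show "q ` points X \<subseteq> points (quotient_fspace q X)" by (rule openin_subset)
  show "points (quotient_fspace q X) \<subseteq> q ` points X"
    using openin_topspace [of "zariski (quotient_fspace q X)"] unfolding openin_quotient_fspace by simp
qed

lemma regular_quotient_fspace [simp]:
  "\<phi> \<in> regular (quotient_fspace q X) U \<longleftrightarrow> \<phi> \<circ> q \<in> regular X {x \<in> points X. q x \<in> U}"
  by (simp add: quotient_fspace_def)

lemma regular_open_subspace [simp]: "regular (open_subspace X U) = regular X"
  by (simp add: open_subspace_def)

lemma points_open_subspace [simp]: "points (open_subspace X U) = points X \<inter> U"
  by (simp add: open_subspace_def)

lemma openin_open_subspace:
  assumes "openin (zariski X) U"
  shows "openin (zariski (open_subspace X U)) V \<longleftrightarrow> openin (zariski X) V \<and> V \<subseteq> U"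
  using assms by (auto simp: open_subspace_def openin_open_subtopology)

text \<open>Regular functions are represented by total ones, so two expressions often agree only on
  the open set in question; this lets one replace the other there.\<close>

lemma regular_affine_fspace_cong:
  assumes "\<And>x. x \<in> U \<Longrightarrow> \<phi> x = \<psi> x"
  shows "\<phi> \<in> regular (affine_fspace E S) U \<longleftrightarrow> \<psi> \<in> regular (affine_fspace E S) U"
proof -
  have "\<phi>' \<in> regular (affine_fspace E S) U"
    if "\<psi>' \<in> regular (affine_fspace E S) U" "\<And>x. x \<in> U \<Longrightarrow> \<phi>' x = \<psi>' x" for \<phi>' \<psi>'
    unfolding regular_affine_fspace
  proof
    fix x assume x: "x \<in> U"
    from bspec [OF that(1) [unfolded regular_affine_fspace] x]
    obtain V g h where "openin (zariski (affine_fspace E S)) V" "x \<in> V" "V \<subseteq> U"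
       "g \<in> poly_functions E" "h \<in> poly_functions E" "\<forall>y\<in>V. h y \<noteq> 0 \<and> \<psi>' y = g y / h y"
      by blast
    with that(2) show "\<exists>V g h. openin (zariski (affine_fspace E S)) V \<and> x \<in> V \<and> V \<subseteq> U \<and>
       g \<in> poly_functions E \<and> h \<in> poly_functions E \<and> (\<forall>y\<in>V. h y \<noteq> 0 \<and> \<phi>' y = g y / h y)"
      by (intro exI [of _ V] exI [of _ g] exI [of _ h]) auto
  qed
  with assms show ?thesis by metis
qed

subsection \<open>The singular members of the family\<close>

lemma exhaust_6: "(x :: 6) = 1 \<or> x = 2 \<or> x = 3 \<or> x = 4 \<or> x = 5 \<or> x = 6"
proof (induct x)
  case (of_int z)
  then have "z = 0 \<or> z = 1 \<or> z = 2 \<or> z = 3 \<or> z = 4 \<or> z = 5" by fastforce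
  then show ?case by auto
qed

lemma forall_6: "(\<forall>i::6. P i) \<longleftrightarrow> P 1 \<and> P 2 \<and> P 3 \<and> P 4 \<and> P 5 \<and> P 6"
  by (metis exhaust_6)

lemma UNIV_6: "UNIV = {1, 2, 3, 4, 5, 6::6}"
  using exhaust_6 by auto

lemma prod_6: "prod f (UNIV::6 set) = f 1 * f 2 * f 3 * f 4 * f 5 * f 6"
  unfolding UNIV_6 by (simp add: ac_simps)

section \<open>Points of projective space and isolated singularities\<close>

lemma proj_point_eq_iff:
  assumes "\<And>v. sc 1 v = v" "\<And>c d v. sc c (sc d v) = sc (c * d) v"
  shows "proj_point sc x = proj_point sc y \<longleftrightarrow> (\<exists>c. c \<noteq> 0 \<and> y = sc c x)"
proof
  assume "proj_point sc x = proj_point sc y"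
  moreover have "y \<in> proj_point sc y"
    unfolding proj_point_def by (rule CollectI, rule exI [of _ 1]) (simp add: assms(1))
  ultimately show "\<exists>c. c \<noteq> 0 \<and> y = sc c x"
    unfolding proj_point_def by auto
next
  assume "\<exists>c. c \<noteq> 0 \<and> y = sc c x"
  then obtain c where c: "c \<noteq> 0" "y = sc c x" by auto
  show "proj_point sc x = proj_point sc y"
  proof (intro equalityI subsetI)
    fix z assume "z \<in> proj_point sc x"
    then obtain d where "d \<noteq> 0" "z = sc d x" by (auto simp: proj_point_def)
    then have "z = sc (d / c) y" "d / c \<noteq> 0" using c by (simp_all add: assms(2))
    then show "z \<in> proj_point sc y" unfolding proj_point_def by blast
  next
    fix z assume "z \<in> proj_point sc y"
    then obtain d where "d \<noteq> 0" "z = sc d y" by (auto simp: proj_point_def)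
    then have "z = sc (d * c) x" "d * c \<noteq> 0" using c by (simp_all add: assms(2))
    then show "z \<in> proj_point sc x" unfolding proj_point_def by blast
  qed
qed

lemma proj_point_eq_iff_vec:
  "proj_point (*s) x = proj_point (*s) (y :: complex^'n) \<longleftrightarrow> (\<exists>c. c \<noteq> 0 \<and> y = c *s x)"
  by (rule proj_point_eq_iff) (simp_all add: vector_smult_assoc)

lemma openin_projective_space:
  "openin (zariski (projective_space :: (complex^'n) set fspace)) U \<longleftrightarrow>
     U \<subseteq> proj_point (*s) ` (UNIV - {0}) \<and>
     openin (zariski (affine_fspace coordinates (UNIV - {0}))) {x \<in> UNIV - {0}. proj_point (*s) x \<in> U}"
  unfolding projective_space_def proj_fspace_def openin_quotient_fspace points_affine_fspace ..

lemma points_projective_space: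
  "points (projective_space :: (complex^'n) set fspace) = proj_point (*s) ` (UNIV - {0})"
  unfolding projective_space_def proj_fspace_def by simp

text \<open>Two nonproportional vectors have a nonzero 2 x 2 minor; with \<open>y\<close> fixed it
  is a linear form that vanishes at \<open>y\<close> and not at \<open>x\<close>.\<close>

lemma projective_space_separate_points:
  fixes x y :: "complex^'n"
  assumes "x \<noteq> 0" "y \<noteq> 0" "proj_point (*s) x \<noteq> proj_point (*s) y"
  obtains U where "openin (zariski projective_space) U" "proj_point (*s) x \<in> U" "proj_point (*s) y \<notin> U"
proof -
  have "\<exists>i j. x $ i * y $ j \<noteq> x $ j * y $ i"
  proof (rule ccontr)
    assume *: "\<nexists>i j. x $ i * y $ j \<noteq> x $ j * y $ i"
    obtain j where j: "x $ j \<noteq> 0" using assms(1) by (metis vec_eq_iff zero_index)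
    have y: "y = (y $ j / x $ j) *s x"
      using * j by (auto simp: vec_eq_iff field_simps)
    then have "y $ j / x $ j \<noteq> 0" using assms(2) by (metis vector_smult_lzero)
    with y assms(3) show False using proj_point_eq_iff_vec by blast
  qed
  then obtain i j where ij: "x $ i * y $ j \<noteq> x $ j * y $ i" by blast
  define f where "f = (\<lambda>w :: complex^'n. w $ i * y $ j - w $ j * y $ i)"
  have f: "f \<in> poly_functions coordinates" unfolding f_def by (intro poly_function_intros)
  have f_scale: "f (c *s w) = c * f w" for c w by (simp add: f_def algebra_simps)
  define U where "U = proj_point (*s) ` {w. w \<noteq> 0 \<and> f w \<noteq> 0}"
  have mem: "proj_point (*s) w \<in> U \<longleftrightarrow> f w \<noteq> 0" if w: "w \<noteq> 0" for w
  proof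
    assume "proj_point (*s) w \<in> U"
    then obtain v where "v \<noteq> 0" "f v \<noteq> 0" "proj_point (*s) w = proj_point (*s) v"
      by (auto simp: U_def)
    then obtain c where "c \<noteq> 0" "v = c *s w" using proj_point_eq_iff_vec by blast
    with \<open>f v \<noteq> 0\<close> show "f w \<noteq> 0" by (simp add: f_scale)
  qed (use w in \<open>auto simp: U_def\<close>)
  show thesis
  proof (rule that [of U])
    have "{w \<in> UNIV - {0}. proj_point (*s) w \<in> U} = {w \<in> UNIV - {0}. f w \<noteq> 0}"
      using mem by auto
    then show "openin (zariski projective_space) U"
      unfolding openin_projective_space using openin_affine_fspace_basis [OF f, of "UNIV - {0}"]
      by (auto simp: U_def)
    show "proj_point (*s) x \<in> U" using mem [OF assms(1)] ij by (simp add: f_def)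
    show "proj_point (*s) y \<notin> U" using mem [OF assms(2)] by (simp add: f_def)
  qed
qed

lemma isolated_singularity_of_finite:
  assumes "finite (singular_locus F)" "P \<in> singular_locus F"
  shows "isolated_singularity F P"
proof -
  have sub: "singular_locus F \<subseteq> proj_point (*s) ` (UNIV - {0})"
    by (auto simp: singular_locus_def)
  have "\<exists>U. openin (zariski projective_space) U \<and> P \<in> U \<and> Q \<notin> U" if Q: "Q \<in> singular_locus F - {P}" for Q
  proof -
    have "P \<in> proj_point (*s) ` (UNIV - {0})" "Q \<in> proj_point (*s) ` (UNIV - {0})"
      using Q sub assms(2) by blast+
    then obtain x y where "x \<noteq> 0" "P = proj_point (*s) x" "y \<noteq> 0" "Q = proj_point (*s) y"
      by blast
    moreover have "P \<noteq> Q" using Q by blast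
    ultimately show ?thesis using projective_space_separate_points [of x y] by metis
  qed
  then obtain U where U: "\<And>Q. Q \<in> singular_locus F - {P} \<Longrightarrow>
      openin (zariski projective_space) (U Q) \<and> P \<in> U Q \<and> Q \<notin> U Q" by metis
  \<comment> \<open>The factor \<open>points projective_space\<close> covers the case of a single
    singular point, where the intersection over the empty family is all of
    \<open>UNIV\<close>.\<close>
  define V where "V = points projective_space \<inter> (\<Inter>Q\<in>singular_locus F - {P}. U Q)"
  have "openin (zariski projective_space) V"
  proof (cases "singular_locus F - {P} = {}")
    case True
    show ?thesis unfolding V_def True by simp
  next
    case False
    then have "openin (zariski projective_space) (\<Inter>Q\<in>singular_locus F - {P}. U Q)"
      using U assms(1) by (intro openin_Inter) auto
    then show ?thesis unfolding V_def by blast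
  qed
  moreover have "P \<in> V"
    using U assms(2) sub unfolding V_def points_projective_space by auto
  moreover have "V \<inter> singular_locus F \<subseteq> {P}"
    using U unfolding V_def by blast
  ultimately show ?thesis
    unfolding isolated_singularity_def using assms(2) by blast
qed

section \<open>Critical points of the family and the curves of singular parameters\<close>

lemma deriv_cubic_family:
  "deriv (\<lambda>z. cubic_family a b (x + z *s axis 1 1)) 0 = 2 * x$1 * x$2 + (x$6)^2 + a * x$3 * x$5"
  "deriv (\<lambda>z. cubic_family a b (x + z *s axis 2 1)) 0 = (x$1)^2 + 2 * x$2 * x$3 + b * x$4 * x$6"
  "deriv (\<lambda>z. cubic_family a b (x + z *s axis 3 1)) 0 = 2 * x$3 * x$4 + (x$2)^2 + a * x$1 * x$5"
  "deriv (\<lambda>z. cubic_family a b (x + z *s axis 4 1)) 0 = (x$3)^2 + 2 * x$4 * x$5 + b * x$2 * x$6"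
  "deriv (\<lambda>z. cubic_family a b (x + z *s axis 5 1)) 0 = 2 * x$5 * x$6 + (x$4)^2 + a * x$1 * x$3"
  "deriv (\<lambda>z. cubic_family a b (x + z *s axis 6 1)) 0 = (x$5)^2 + 2 * x$6 * x$1 + b * x$2 * x$4"
  by (rule DERIV_imp_deriv, simp add: cubic_family_def axis_def,
      (rule derivative_eq_intros refl | simp)+)+

definition critical :: "complex \<Rightarrow> complex \<Rightarrow> complex^6 \<Rightarrow> bool" where
  "critical a b x \<longleftrightarrow>
     2 * x$1 * x$2 + (x$6)^2 + a * x$3 * x$5 = 0 \<and> (x$1)^2 + 2 * x$2 * x$3 + b * x$4 * x$6 = 0 \<and>
     2 * x$3 * x$4 + (x$2)^2 + a * x$1 * x$5 = 0 \<and> (x$3)^2 + 2 * x$4 * x$5 + b * x$2 * x$6 = 0 \<and>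
     2 * x$5 * x$6 + (x$4)^2 + a * x$1 * x$3 = 0 \<and> (x$5)^2 + 2 * x$6 * x$1 + b * x$2 * x$4 = 0"

text \<open>Euler's relation for a form of degree 3. It makes the equation of the hypersurface a
  consequence of the six derivative equations, so \<open>critical\<close> can leave it out.\<close>

lemma cubic_family_euler:
  "3 * cubic_family a b x =
     x$1 * (2 * x$1 * x$2 + (x$6)^2 + a * x$3 * x$5) + x$2 * ((x$1)^2 + 2 * x$2 * x$3 + b * x$4 * x$6) +
     x$3 * (2 * x$3 * x$4 + (x$2)^2 + a * x$1 * x$5) + x$4 * ((x$3)^2 + 2 * x$4 * x$5 + b * x$2 * x$6) +
     x$5 * (2 * x$5 * x$6 + (x$4)^2 + a * x$1 * x$3) + x$6 * ((x$5)^2 + 2 * x$6 * x$1 + b * x$2 * x$4)"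
  by (simp add: cubic_family_def power2_eq_square algebra_simps)

lemma singular_locus_cubic_family:
  "singular_locus (cubic_family a b) = {proj_point (*s) x | x. x \<noteq> 0 \<and> critical a b x}"
proof -
  have "critical a b x \<Longrightarrow> cubic_family a b x = 0" for x
    using cubic_family_euler [of a b x] unfolding critical_def by simp
  moreover have "(\<forall>i. deriv (\<lambda>z. cubic_family a b (x + z *s axis i 1)) 0 = 0) \<longleftrightarrow> critical a b x" for x
    unfolding forall_6 deriv_cubic_family critical_def by simp
  ultimately show ?thesis unfolding singular_locus_def by blast
qed

text \<open>Multiplying each derivative by its own variable gives six equations that are linear in
  the eight terms of the cubic. In them every difference of neighbouring square monomials is twice
  the next one around a cycle of six, and 2^6 - 1 = 63 forces these monomials into two families of
  equal values. The equalities are monomial and are solved by a 21st root of unity.\<close>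

lemma critical_solve:
  fixes p1 p2 p3 q1 q2 q3 a b :: complex
  assumes "2 * p1 * q1 + q3^2 + a * p2 * p3 = 0" "p1^2 + 2 * q1 * p2 + b * q2 * q3 = 0"
    "2 * p2 * q2 + q1^2 + a * p1 * p3 = 0" "p2^2 + 2 * q2 * p3 + b * q1 * q3 = 0"
    "2 * p3 * q3 + q2^2 + a * p1 * p2 = 0" "p3^2 + 2 * q3 * p1 + b * q1 * q2 = 0"
    and nz: "\<not> (p1 = 0 \<and> p2 = 0 \<and> p3 = 0 \<and> q1 = 0 \<and> q2 = 0 \<and> q3 = 0)"
  shows "\<exists>\<xi> \<rho>. p1 \<noteq> 0 \<and> \<xi>^21 = 1 \<and> 2 * \<rho> + \<rho>^2 + a * \<xi>^7 = 0 \<and> 1 + 2 * \<rho> + b * \<xi>^7 * \<rho>^2 = 0 \<and>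
     q1 = p1 * (\<rho> * \<xi>^20) \<and> p2 = p1 * \<xi> \<and> q2 = p1 * (\<rho> * \<xi>^18) \<and> p3 = p1 * \<xi>^5 \<and>
     q3 = p1 * (\<rho> * \<xi>^10)"
proof -
  define m1 m2 m3 n1 n2 n3 P Q where defs: "m1 = p1^2 * q1" "m2 = p2^2 * q2" "m3 = p3^2 * q3"
    "n1 = q1^2 * p2" "n2 = q2^2 * p3" "n3 = q3^2 * p1" "P = a * (p1 * p2 * p3)" "Q = b * (q1 * q2 * q3)"
  have "p1 * (2 * p1 * q1 + q3^2 + a * p2 * p3) = 0" "q1 * (p1^2 + 2 * q1 * p2 + b * q2 * q3) = 0"
    "p2 * (2 * p2 * q2 + q1^2 + a * p1 * p3) = 0" "q2 * (p2^2 + 2 * q2 * p3 + b * q1 * q3) = 0"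
    "p3 * (2 * p3 * q3 + q2^2 + a * p1 * p2) = 0" "q3 * (p3^2 + 2 * q3 * p1 + b * q1 * q2) = 0"
    using assms by simp_all
  then have lin: "2 * m1 + n3 + P = 0" "m1 + 2 * n1 + Q = 0" "2 * m2 + n1 + P = 0"
    "m2 + 2 * n2 + Q = 0" "2 * m3 + n2 + P = 0" "m3 + 2 * n3 + Q = 0"
    unfolding defs by (simp_all add: algebra_simps power2_eq_square)
  have "63 * (m1 - m2) = 0" "63 * (m2 - m3) = 0" using lin by algebra+
  then have m: "m2 = m1" "m3 = m1" by auto
  have n: "n2 = n1" "n3 = n1" using lin m by algebra+
  \<comment> \<open>If both families vanish, the derivative in which a variable occurs squared loses
    its other terms, so all variables vanish, the \<open>p\<close> before the
    \<open>q\<close>.\<close>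
  have "m1 \<noteq> 0 \<or> n1 \<noteq> 0"
  proof (rule ccontr)
    assume "\<not> (m1 \<noteq> 0 \<or> n1 \<noteq> 0)"
    then have z: "p1 = 0 \<or> q1 = 0" "p2 = 0 \<or> q2 = 0" "p3 = 0 \<or> q3 = 0"
      "q1 = 0 \<or> p2 = 0" "q2 = 0 \<or> p3 = 0" "q3 = 0 \<or> p1 = 0"
      using m n unfolding defs by auto
    have "p1 = 0" using z assms(2) by auto
    moreover have "p2 = 0" using z assms(4) by auto
    moreover have "p3 = 0" using z assms(6) by auto
    ultimately show False using assms nz by simp
  qed
  then have pq: "p1 \<noteq> 0" "p2 \<noteq> 0" "p3 \<noteq> 0" "q1 \<noteq> 0" "q2 \<noteq> 0" "q3 \<noteq> 0"
    using m n unfolding defs by auto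
  define \<xi> \<tau> s1 s2 s3 where s: "\<xi> = p2 / p1" "\<tau> = p3 / p1" "s1 = q1 / p1" "s2 = q2 / p1" "s3 = q3 / p1"
  have p: "p2 = p1 * \<xi>" "p3 = p1 * \<tau>" "q1 = p1 * s1" "q2 = p1 * s2" "q3 = p1 * s3"
    using pq by (simp_all add: s)
  have nz': "\<xi> \<noteq> 0" "\<tau> \<noteq> 0" "s1 \<noteq> 0" using pq by (simp_all add: s)
  have "p1^3 * (\<xi>^2 * s2) = p1^3 * s1" "p1^3 * (\<tau>^2 * s3) = p1^3 * s1"
    "p1^3 * (s2^2 * \<tau>) = p1^3 * (s1^2 * \<xi>)" "p1^3 * s3^2 = p1^3 * (s1^2 * \<xi>)"
    using m n unfolding defs p by (simp_all add: power2_eq_square power3_eq_cube mult_ac)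
  then have r: "\<xi>^2 * s2 = s1" "\<tau>^2 * s3 = s1" "s1^2 * \<xi> = s2^2 * \<tau>" "s1^2 * \<xi> = s3^2"
    using pq(1) by simp_all
  \<comment> \<open>Eliminating \<open>s2\<close> and \<open>s3\<close> from the monomial equalities
    leaves powers of \<open>\<xi>\<close> only: the exponent 5 for \<open>\<tau>\<close>, and then 4
    * 5 + 1 = 21.\<close>
  have "s1^2 * \<xi>^5 = \<xi>^4 * (s1^2 * \<xi>)" by algebra
  also have "\<dots> = (\<xi>^2 * s2)^2 * \<tau>" unfolding r(3) by algebra
  finally have "s1^2 * \<xi>^5 = s1^2 * \<tau>" unfolding r(1) .
  then have \<tau>: "\<tau> = \<xi>^5" using nz' by simp
  have "s1^2 * (\<tau>^4 * \<xi>) = \<tau>^4 * (s1^2 * \<xi>)" by algebra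
  also have "\<dots> = (\<tau>^2 * s3)^2" unfolding r(4) by algebra
  finally have "s1^2 * (\<tau>^4 * \<xi>) = s1^2 * 1" unfolding r(2) by simp
  then have \<xi>: "\<xi>^21 = 1" using nz' unfolding \<tau> by (simp flip: power_mult power_Suc2)
  \<comment> \<open>With this normalisation the exponents 20, 18 and 10 below stand for -1, -3 and
    -11, as the order of \<open>\<xi>\<close> divides 21.\<close>
  define \<rho> where "\<rho> = s1 * \<xi>"
  have s1: "s1 = \<rho> * \<xi>^20"
    using \<xi> unfolding \<rho>_def by (simp add: mult.assoc flip: power_Suc)
  have "\<xi>^2 * s2 = \<xi>^2 * (\<rho> * \<xi>^18)" unfolding r(1) s1 by (simp add: mult_ac flip: power_add)
  then have s2: "s2 = \<rho> * \<xi>^18" using nz' by simp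
  have "\<xi>^10 * s3 = \<xi>^10 * (\<rho> * \<xi>^10)" using r(2) unfolding s1 \<tau> by (simp add: mult_ac flip: power_add power_mult)
  then have s3: "s3 = \<rho> * \<xi>^10" using nz' by simp
  have "p1^2 * (2 * s1 + s3^2 + a * \<xi> * \<tau>) = 0" "p1^2 * (1 + 2 * s1 * \<xi> + b * s2 * s3) = 0"
    using assms(1,2) unfolding p by (simp_all add: power2_eq_square algebra_simps)
  then have e: "2 * s1 + s3^2 + a * \<xi> * \<tau> = 0" "1 + 2 * s1 * \<xi> + b * s2 * s3 = 0"
    using pq(1) by simp_all
  \<comment> \<open>The two equations agree with the reduced ones only modulo \<xi>^21 - 1, so the
    multiple of that polynomial is written out.\<close>
  have "\<xi> * (2 * s1 + s3^2 + a * \<xi> * \<tau>)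
      = (2 * \<rho> + \<rho>^2 + a * \<xi>^7) + (2 * \<rho> + \<rho>^2) * (\<xi>^21 - 1)"
    unfolding s1 s3 \<tau> by algebra
  moreover have "1 + 2 * s1 * \<xi> + b * s2 * s3
      = (1 + 2 * \<rho> + b * \<xi>^7 * \<rho>^2) + (2 * \<rho> + b * \<rho>^2 * \<xi>^7) * (\<xi>^21 - 1)"
    unfolding s1 s2 s3 by algebra
  ultimately have "2 * \<rho> + \<rho>^2 + a * \<xi>^7 = 0" "1 + 2 * \<rho> + b * \<xi>^7 * \<rho>^2 = 0"
    using e \<xi> by simp_all
  then show ?thesis
    using \<xi> pq(1) p unfolding s1 s2 s3 \<tau>
    by (intro exI [of _ \<xi>] exI [of _ \<rho>] conjI)
qed

definition singular_point :: "complex \<Rightarrow> complex \<Rightarrow> complex^6" where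
  "singular_point \<xi> \<rho> = (\<chi> i. if i = 1 then 1 else if i = 2 then \<rho> * \<xi>^20 else if i = 3 then \<xi>
     else if i = 4 then \<rho> * \<xi>^18 else if i = 5 then \<xi>^5 else \<rho> * \<xi>^10)"

lemma singular_point_nth [simp]:
  "singular_point \<xi> \<rho> $ 1 = 1" "singular_point \<xi> \<rho> $ 2 = \<rho> * \<xi>^20" "singular_point \<xi> \<rho> $ 3 = \<xi>"
  "singular_point \<xi> \<rho> $ 4 = \<rho> * \<xi>^18" "singular_point \<xi> \<rho> $ 5 = \<xi>^5" "singular_point \<xi> \<rho> $ 6 = \<rho> * \<xi>^10"
  by (simp_all add: singular_point_def)

lemma singular_point_nonzero: "singular_point \<xi> \<rho> \<noteq> 0"
  by (metis singular_point_nth(1) zero_index zero_neq_one)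

text \<open>Up to a power of \<open>\<xi>\<close>, each of the six derivatives is one of the two
  hypotheses; the rest is an explicit multiple of \<xi>^21 - 1.\<close>

lemma critical_singular_point:
  assumes \<xi>: "\<xi>^21 = 1" and e1: "2 * \<rho> + \<rho>^2 + a * \<xi>^7 = 0" and e2: "1 + 2 * \<rho> + b * \<xi>^7 * \<rho>^2 = 0"
  shows "critical a b (singular_point \<xi> \<rho>)"
proof -
  have "2 * 1 * (\<rho> * \<xi>^20) + (\<rho> * \<xi>^10)^2 + a * \<xi> * \<xi>^5
      = \<xi>^20 * (2 * \<rho> + \<rho>^2 + a * \<xi>^7) - a * \<xi>^6 * (\<xi>^21 - 1)" by algebra
  also have "\<dots> = 0" using \<xi> e1 e2 by simp
  finally have t1: "2 * 1 * (\<rho> * \<xi>^20) + (\<rho> * \<xi>^10)^2 + a * \<xi> * \<xi>^5 = 0" .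
  have "1 + 2 * (\<rho> * \<xi>^20) * \<xi> + b * (\<rho> * \<xi>^18) * (\<rho> * \<xi>^10)
      = (1 + 2 * \<rho> + b * \<xi>^7 * \<rho>^2) + (2 * \<rho> + b * \<rho>^2 * \<xi>^7) * (\<xi>^21 - 1)" by algebra
  also have "\<dots> = 0" using \<xi> e1 e2 by simp
  finally have t2: "1 + 2 * (\<rho> * \<xi>^20) * \<xi> + b * (\<rho> * \<xi>^18) * (\<rho> * \<xi>^10) = 0" .
  have "2 * \<xi> * (\<rho> * \<xi>^18) + (\<rho> * \<xi>^20)^2 + a * 1 * \<xi>^5
      = \<xi>^19 * (2 * \<rho> + \<rho>^2 + a * \<xi>^7) + (\<rho>^2 * \<xi>^19 - a * \<xi>^5) * (\<xi>^21 - 1)" by algebra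
  also have "\<dots> = 0" using \<xi> e1 e2 by simp
  finally have t3: "2 * \<xi> * (\<rho> * \<xi>^18) + (\<rho> * \<xi>^20)^2 + a * 1 * \<xi>^5 = 0" .
  have "\<xi>^2 + 2 * (\<rho> * \<xi>^18) * \<xi>^5 + b * (\<rho> * \<xi>^20) * (\<rho> * \<xi>^10)
      = \<xi>^2 * (1 + 2 * \<rho> + b * \<xi>^7 * \<rho>^2) + (2 * \<rho> * \<xi>^2 + b * \<rho>^2 * \<xi>^9) * (\<xi>^21 - 1)" by algebra
  also have "\<dots> = 0" using \<xi> e1 e2 by simp
  finally have t4: "\<xi>^2 + 2 * (\<rho> * \<xi>^18) * \<xi>^5 + b * (\<rho> * \<xi>^20) * (\<rho> * \<xi>^10) = 0" .
  have "2 * \<xi>^5 * (\<rho> * \<xi>^10) + (\<rho> * \<xi>^18)^2 + a * 1 * \<xi>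
      = \<xi>^15 * (2 * \<rho> + \<rho>^2 + a * \<xi>^7) + (\<rho>^2 * \<xi>^15 - a * \<xi>) * (\<xi>^21 - 1)" by algebra
  also have "\<dots> = 0" using \<xi> e1 e2 by simp
  finally have t5: "2 * \<xi>^5 * (\<rho> * \<xi>^10) + (\<rho> * \<xi>^18)^2 + a * 1 * \<xi> = 0" .
  have "(\<xi>^5)^2 + 2 * (\<rho> * \<xi>^10) * 1 + b * (\<rho> * \<xi>^20) * (\<rho> * \<xi>^18)
      = \<xi>^10 * (1 + 2 * \<rho> + b * \<xi>^7 * \<rho>^2) + b * \<rho>^2 * \<xi>^17 * (\<xi>^21 - 1)" by algebra
  also have "\<dots> = 0" using \<xi> e1 e2 by simp
  finally have t6: "(\<xi>^5)^2 + 2 * (\<rho> * \<xi>^10) * 1 + b * (\<rho> * \<xi>^20) * (\<rho> * \<xi>^18) = 0" .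
  show ?thesis unfolding critical_def singular_point_nth power_one by (intro conjI t1 t2 t3 t4 t5 t6)
qed

lemma singular_locus_cubic_family_param:
  "singular_locus (cubic_family a b) = {proj_point (*s) (singular_point \<xi> \<rho>) | \<xi> \<rho>.
     \<xi>^21 = 1 \<and> 2 * \<rho> + \<rho>^2 + a * \<xi>^7 = 0 \<and> 1 + 2 * \<rho> + b * \<xi>^7 * \<rho>^2 = 0}" (is "_ = ?R")
proof
  show "?R \<subseteq> singular_locus (cubic_family a b)"
    unfolding singular_locus_cubic_family using critical_singular_point singular_point_nonzero by blast
  show "singular_locus (cubic_family a b) \<subseteq> ?R"
  proof
    fix P assume "P \<in> singular_locus (cubic_family a b)"
    then obtain x where x: "P = proj_point (*s) x" "x \<noteq> 0" "critical a b x"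
      unfolding singular_locus_cubic_family by blast
    have "\<not> (x$1 = 0 \<and> x$3 = 0 \<and> x$5 = 0 \<and> x$2 = 0 \<and> x$4 = 0 \<and> x$6 = 0)"
      using x(2) unfolding vec_eq_iff forall_6 by simp
    from critical_solve [of "x$1" "x$2" "x$6" a "x$3" "x$5" b "x$4", OF _ _ _ _ _ _ this] x(3)
    obtain \<xi> \<rho> where r: "x$1 \<noteq> 0" "\<xi>^21 = 1" "2 * \<rho> + \<rho>^2 + a * \<xi>^7 = 0" "1 + 2 * \<rho> + b * \<xi>^7 * \<rho>^2 = 0"
      "x$2 = x$1 * (\<rho> * \<xi>^20)" "x$3 = x$1 * \<xi>" "x$4 = x$1 * (\<rho> * \<xi>^18)" "x$5 = x$1 * \<xi>^5"
      "x$6 = x$1 * (\<rho> * \<xi>^10)"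
      unfolding critical_def by blast
    have "x = x$1 *s singular_point \<xi> \<rho>"
      unfolding vec_eq_iff forall_6 using r(5-9) by simp
    with r(1) x(1) have "P = proj_point (*s) (singular_point \<xi> \<rho>)"
      using proj_point_eq_iff_vec by blast
    with r show "P \<in> ?R" by blast
  qed
qed

lemma finite_singular_locus: "finite (singular_locus (cubic_family a b))"
proof -
  have fin: "finite {\<rho>. 2 * \<rho> + \<rho>^2 + c = 0}" for c :: complex
    using poly_roots_finite [of "[:c, 2, 1:]"] by (simp add: algebra_simps power2_eq_square)
  have "finite (SIGMA \<xi> : {\<xi>::complex. \<xi>^21 = 1}. {\<rho>. 2 * \<rho> + \<rho>^2 + a * \<xi>^7 = 0})"
    using fin finite_roots_unity [of 21] by (intro finite_SigmaI) auto
  moreover have "singular_locus (cubic_family a b) \<subseteq> (\<lambda>(\<xi>, \<rho>). proj_point (*s) (singular_point \<xi> \<rho>)) `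
      (SIGMA \<xi> : {\<xi>::complex. \<xi>^21 = 1}. {\<rho>. 2 * \<rho> + \<rho>^2 + a * \<xi>^7 = 0})"
    unfolding singular_locus_cubic_family_param by auto
  ultimately show ?thesis by (meson finite_imageI finite_subset)
qed

text \<open>Minus the resultant in \<open>\<rho>\<close> of the two quadratics \<rho>^2 + 2 \<rho> +
  a and b \<rho>^2 + 2 \<rho> + 1.\<close>

definition discriminant :: "complex \<Rightarrow> complex \<Rightarrow> complex" where
  "discriminant a b = 3 - 4 * a - 4 * b - a^2 * b^2 + 6 * a * b"

lemma discriminant_eq_0_iff:
  "discriminant a b = 0 \<longleftrightarrow> (\<exists>\<rho>. 2 * \<rho> + \<rho>^2 + a = 0 \<and> 1 + 2 * \<rho> + b * \<rho>^2 = 0)"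
proof
  assume "\<exists>\<rho>. 2 * \<rho> + \<rho>^2 + a = 0 \<and> 1 + 2 * \<rho> + b * \<rho>^2 = 0"
  then obtain \<rho> where r: "2 * \<rho> + \<rho>^2 + a = 0" "1 + 2 * \<rho> + b * \<rho>^2 = 0" by blast
  show "discriminant a b = 0" unfolding discriminant_def using r by algebra
next
  assume d: "discriminant a b = 0"
  show "\<exists>\<rho>. 2 * \<rho> + \<rho>^2 + a = 0 \<and> 1 + 2 * \<rho> + b * \<rho>^2 = 0"
  proof (cases "b = 1")
    case True
    then have "(a - 1)^2 = 0" using d unfolding discriminant_def by (simp add: algebra_simps power2_eq_square)
    with True show ?thesis by (intro exI [of _ "-1"]) simp
  next
    case False
    \<comment> \<open>\<open>b\<close> times the first equation minus the second loses its quadratic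
      term, and this is its solution. For \<open>b = 1\<close> the linear term disappears as well,
      whence the separate case.\<close>
    define \<rho> where "\<rho> = (1 - a * b) / (2 * (b - 1))"
    have \<rho>: "2 * (b - 1) * \<rho> = 1 - a * b" using False by (simp add: \<rho>_def)
    have "4 * (b - 1)^2 * (2 * \<rho> + \<rho>^2 + a) = 0"
      using \<rho> d unfolding discriminant_def by algebra
    then have 1: "2 * \<rho> + \<rho>^2 + a = 0" using False by simp
    moreover have "1 + 2 * \<rho> + b * \<rho>^2 = 0" using \<rho> 1 by algebra
    ultimately show ?thesis by blast
  qed
qed

text \<open>A singular point with parameter \<open>\<xi>\<close> puts (a, b) on the curve of
  \<kappa> = \<xi>^7. Conversely \<open>\<kappa>\<close> itself can serve as \<open>\<xi>\<close>,
  because \<kappa>^7 = \<kappa> for a cube root of unity.\<close>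

lemma singular_locus_nonempty_iff:
  "singular_locus (cubic_family a b) \<noteq> {} \<longleftrightarrow> (\<exists>\<kappa>. \<kappa>^3 = 1 \<and> discriminant (\<kappa> * a) (\<kappa> * b) = 0)"
proof
  assume "singular_locus (cubic_family a b) \<noteq> {}"
  then obtain \<xi> \<rho> where "\<xi>^21 = 1" "2 * \<rho> + \<rho>^2 + a * \<xi>^7 = 0" "1 + 2 * \<rho> + b * \<xi>^7 * \<rho>^2 = 0"
    unfolding singular_locus_cubic_family_param by blast
  then show "\<exists>\<kappa>. \<kappa>^3 = 1 \<and> discriminant (\<kappa> * a) (\<kappa> * b) = 0"
    unfolding discriminant_eq_0_iff
    by (intro exI [of _ "\<xi>^7"] conjI exI [of _ \<rho>]) (simp_all add: mult_ac flip: power_mult)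
next
  assume "\<exists>\<kappa>. \<kappa>^3 = 1 \<and> discriminant (\<kappa> * a) (\<kappa> * b) = 0"
  then obtain \<kappa> \<rho> where \<kappa>: "\<kappa>^3 = 1" "2 * \<rho> + \<rho>^2 + \<kappa> * a = 0" "1 + 2 * \<rho> + \<kappa> * b * \<rho>^2 = 0"
    unfolding discriminant_eq_0_iff by blast
  have "\<kappa>^7 = \<kappa>" "\<kappa>^21 = 1" using \<kappa>(1) power_mult [of \<kappa> 3 2] power_mult [of \<kappa> 3 7] power_Suc [of \<kappa> 6] by simp_all
  with \<kappa> have "proj_point (*s) (singular_point \<kappa> \<rho>) \<in> singular_locus (cubic_family a b)"
    unfolding singular_locus_cubic_family_param
    by (intro CollectI exI [of _ \<kappa>] exI [of _ \<rho>]) (simp add: mult_ac)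
  then show "singular_locus (cubic_family a b) \<noteq> {}" by blast
qed

definition singular_curve :: "complex \<Rightarrow> (complex^2) set" where
  "singular_curve \<kappa> = {p. discriminant (\<kappa> * p$1) (\<kappa> * p$2) = 0}"

text \<open>The polynomial is quadratic in the second coordinate. A factor free of that coordinate
  divides the outer coefficients, which generate the unit ideal; two linear factors would make the
  discriminant of the quadratic a square, but its degree in the first coordinate is 3.\<close>

lemma irreducible_singular_curve:
  assumes \<kappa>: "\<kappa>^3 = 1"
  shows "irreducible_plane_curve (singular_curve \<kappa>)"
proof -
  have \<kappa>0: "\<kappa> \<noteq> 0" using \<kappa> by auto
  define c0 c1 c2 :: "complex poly" where c: "c0 = [:3, -4 * \<kappa>:]" "c1 = [:-4 * \<kappa>, 6 * \<kappa>^2:]" "c2 = [:0, 0, -(\<kappa>^4):]"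
  define p where "p = [:c0, c1, c2:]"
  have deg: "degree p = 2" using \<kappa>0 by (simp add: p_def c)
  have p0: "p \<noteq> 0" using deg by auto
  have const_factor: "f dvd 1" if fg: "p = f * g" and df: "degree f = 0" for f g
  proof -
    obtain \<alpha> where \<alpha>: "f = [:\<alpha>:]" using df degree_eq_zeroE by blast
    have "coeff p n = \<alpha> * coeff g n" for n by (simp add: fg \<alpha>)
    from this [of 0] this [of 2] have "\<alpha> dvd c0" "\<alpha> dvd c2" by (auto simp: p_def numeral_2_eq_2)
    \<comment> \<open>This combination of \<open>c0\<close> and \<open>c2\<close> is the constant 9:
      the quadratic terms cancel because \<kappa>^5 = \<kappa>^2.\<close>
    then have "\<alpha> dvd c0 * [:3, 4 * \<kappa>:] + c2 * [:-16 * \<kappa>:]" by (intro dvd_add dvd_mult2)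
    also have "c0 * [:3, 4 * \<kappa>:] + c2 * [:-16 * \<kappa>:] = [:9:]"
      using \<kappa> by (simp add: c power2_eq_square power3_eq_cube power4_eq_xxxx algebra_simps)
    finally have "\<alpha> dvd [:9:]" .
    moreover have "[:9::complex:] dvd 1" by (simp add: is_unit_pCons_iff)
    ultimately have "\<alpha> dvd 1" by (rule dvd_trans)
    then show ?thesis unfolding \<alpha> by (simp add: is_unit_const_poly_iff)
  qed
  have "irreducible p"
  proof (rule irreducibleI [OF p0])
    show "\<not> p dvd 1" using deg by (metis degree_1 dvd_imp_degree_le le_zero_eq one_neq_zero zero_neq_numeral)
    fix f g assume fg: "p = f * g"
    have "f \<noteq> 0" "g \<noteq> 0" using p0 fg by auto
    then have "degree f + degree g = 2" using deg fg degree_mult_eq by metis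
    then consider "degree f = 0" | "degree g = 0" | "degree f = 1" "degree g = 1" by linarith
    then show "f dvd 1 \<or> g dvd 1"
    proof cases
      case 1 then show ?thesis using const_factor fg by blast
    next
      case 2 then show ?thesis using const_factor [of g f] fg by (simp add: mult.commute)
    next
      case 3
      obtain f0 f1 where f: "f = [:f0, f1:]" using 3(1) by (metis degree1_coeffs)
      obtain g0 g1 where g: "g = [:g0, g1:]" using 3(2) by (metis degree1_coeffs)
      have e: "c0 = f0 * g0" "c1 = f0 * g1 + f1 * g0" "c2 = f1 * g1"
        using fg by (simp_all add: p_def f g algebra_simps)
      have "(f0 * g1 - f1 * g0)^2 = c1^2 - 4 * c0 * c2"
        unfolding e by (simp add: power2_eq_square algebra_simps)
      also have "\<dots> = [:16 * \<kappa>^2, -48 * \<kappa>^3, 36 * \<kappa>^4 + 12 * \<kappa>^4, -16 * \<kappa>^5:]"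
        by (simp add: c power2_eq_square numeral_poly eval_nat_numeral algebra_simps)
      finally have "degree ((f0 * g1 - f1 * g0)^2) = 3" using \<kappa>0 by simp
      then have "2 * degree (f0 * g1 - f1 * g0) = 3" 
        by (cases "f0 * g1 - f1 * g0 = 0") (simp_all add: degree_mult_eq power2_eq_square)
      then show ?thesis by presburger
    qed
  qed
  moreover have "singular_curve \<kappa> = {v. poly (poly p [:v $ 2:]) (v $ 1) = 0}"
  proof -
    have "poly (poly p [:v $ 2:]) (v $ 1) = discriminant (\<kappa> * v$1) (\<kappa> * v$2)" for v :: "complex^2"
      by (simp add: p_def c discriminant_def algebra_simps eval_nat_numeral)
    then show ?thesis by (simp add: singular_curve_def)
  qed
  ultimately show ?thesis unfolding irreducible_plane_curve_def by blast
qed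

lemma card_singular_curves: "card (singular_curve ` {\<kappa>. \<kappa>^3 = 1}) = 3"
proof -
  have "inj_on singular_curve {\<kappa>. \<kappa>^3 = 1}"
  proof (rule inj_onI)
    fix \<kappa> \<kappa>' :: complex assume k: "\<kappa> \<in> {\<kappa>. \<kappa>^3 = 1}" "\<kappa>' \<in> {\<kappa>. \<kappa>^3 = 1}" "singular_curve \<kappa> = singular_curve \<kappa>'"
    then have "\<kappa> \<noteq> 0" "\<kappa>' \<noteq> 0" by auto
    \<comment> \<open>The curve of \<open>\<kappa>\<close> meets the axis on which the second
      coordinate is 0 only in 3 / (4 \<kappa>), so this point tells the curves apart.\<close>
    define p :: "complex^2" where "p = vector [3 / (4 * \<kappa>), 0]"
    have "p \<in> singular_curve \<kappa>" using \<open>\<kappa> \<noteq> 0\<close> by (simp add: singular_curve_def p_def discriminant_def)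
    then have "p \<in> singular_curve \<kappa>'" using k by simp
    then show "\<kappa> = \<kappa>'" using \<open>\<kappa> \<noteq> 0\<close> by (simp add: singular_curve_def p_def discriminant_def field_simps)
  qed
  then show ?thesis using card_roots_unity_eq [of 3] by (simp add: card_image)
qed

lemma singular_parameters:
  "{p. singular_locus (cubic_family (p $ 1) (p $ 2)) \<noteq> {}} = \<Union> (singular_curve ` {\<kappa>. \<kappa>^3 = 1})"
  unfolding singular_locus_nonempty_iff singular_curve_def by blast

subsection \<open>Singularities of type A\<close>

text \<open>Germs at \<open>0\<close> of holomorphic functions; continuity of the partial derivatives is kept
  because the inverse function theorem of the library requires it.\<close>

definition holo_germ_on ::
    "(complex^'n) set \<Rightarrow> ('n \<Rightarrow> complex^'n \<Rightarrow> complex) \<Rightarrow> (complex^'n \<Rightarrow> complex) \<Rightarrow> bool" where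
  "holo_germ_on N d f \<longleftrightarrow> open N \<and> 0 \<in> N \<and> (\<forall>i. continuous_on N (d i)) \<and>
     (\<forall>y\<in>N. (f has_derivative (\<lambda>h. \<Sum>i\<in>UNIV. d i y * h $ i)) (at y))"

definition holo_germ :: "(complex^'n \<Rightarrow> complex) \<Rightarrow> bool" where
  "holo_germ f \<longleftrightarrow> (\<exists>N d. holo_germ_on N d f)"

lemma holo_germ_onD:
  assumes "holo_germ_on N d f"
  shows "open N" "0 \<in> N" "continuous_on N (d i)"
    "y \<in> N \<Longrightarrow> (f has_derivative (\<lambda>h. \<Sum>i\<in>UNIV. d i y * h $ i)) (at y)" "continuous_on N f"
proof -
  show der: "y \<in> N \<Longrightarrow> (f has_derivative (\<lambda>h. \<Sum>i\<in>UNIV. d i y * h $ i)) (at y)" for y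
    using assms unfolding holo_germ_on_def by (elim conjE bspec)
  show "continuous_on N f"
    by (rule continuous_at_imp_continuous_on) (use der has_derivative_continuous in blast)
qed (use assms in \<open>simp_all add: holo_germ_on_def\<close>)

lemma holo_germI:
  assumes "open N" "0 \<in> N" "\<And>i. continuous_on N (d i)"
    "\<And>y. y \<in> N \<Longrightarrow> (f has_derivative (\<lambda>h. \<Sum>i\<in>UNIV. d i y * h $ i)) (at y)"
  shows "holo_germ f"
  unfolding holo_germ_def holo_germ_on_def using assms by (intro exI [of _ N] exI [of _ d]) simp

lemma holo_germ_const: "holo_germ (\<lambda>_. c)"
  by (rule holo_germI [of UNIV "\<lambda>_ _. 0"]) (auto intro!: derivative_eq_intros)

lemma holo_germ_nth: "holo_germ (\<lambda>y :: complex^'n. y $ j)"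
proof (rule holo_germI [of UNIV "\<lambda>i _. if i = j then 1 else 0"])
  fix y :: "complex^'n"
  have "(\<lambda>h :: complex^'n. \<Sum>i\<in>UNIV. (if i = j then 1 else 0) * h $ i) = (\<lambda>h. h $ j)"
    by (simp add: mult_delta_left)
  then show "((\<lambda>y. y $ j) has_derivative (\<lambda>h. \<Sum>i\<in>UNIV. (if i = j then 1 else 0) * h $ i)) (at y)"
    using bounded_linear_imp_has_derivative [OF bounded_linear_vec_nth] by metis
qed auto

lemma holo_germ_add:
  assumes "holo_germ f" "holo_germ g"
  shows "holo_germ (\<lambda>y. f y + g y)"
proof -
  obtain N d where "holo_germ_on N d f"
    using assms(1) unfolding holo_germ_def by blast
  note N = holo_germ_onD [OF this]
  obtain M e where "holo_germ_on M e g"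
    using assms(2) unfolding holo_germ_def by blast
  note M = holo_germ_onD [OF this]
  show ?thesis
  proof (rule holo_germI [of "N \<inter> M" "\<lambda>i y. d i y + e i y"])
    show "continuous_on (N \<inter> M) (\<lambda>y. d i y + e i y)" for i
      by (intro continuous_on_add continuous_on_subset [OF N(3)] continuous_on_subset [OF M(3)]) auto
    show "((\<lambda>y. f y + g y) has_derivative (\<lambda>h. \<Sum>i\<in>UNIV. (d i y + e i y) * h $ i)) (at y)"
      if "y \<in> N \<inter> M" for y
      using has_derivative_add [OF N(4) [of y] M(4) [of y]] that
      by (simp add: ring_distribs sum.distrib)
  qed (use N M in auto)
qed

lemma holo_germ_mult:
  assumes "holo_germ f" "holo_germ g"
  shows "holo_germ (\<lambda>y. f y * g y)"
proof -
  obtain N d where "holo_germ_on N d f"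
    using assms(1) unfolding holo_germ_def by blast
  note N = holo_germ_onD [OF this]
  obtain M e where "holo_germ_on M e g"
    using assms(2) unfolding holo_germ_def by blast
  note M = holo_germ_onD [OF this]
  show ?thesis
  proof (rule holo_germI [of "N \<inter> M" "\<lambda>i y. f y * e i y + d i y * g y"])
    show "continuous_on (N \<inter> M) (\<lambda>y. f y * e i y + d i y * g y)" for i
      by (intro continuous_on_add continuous_on_mult continuous_on_subset [OF N(3)]
          continuous_on_subset [OF M(3)] continuous_on_subset [OF N(5)] continuous_on_subset [OF M(5)]) auto
    show "((\<lambda>y. f y * g y) has_derivative (\<lambda>h. \<Sum>i\<in>UNIV. (f y * e i y + d i y * g y) * h $ i)) (at y)"
      if "y \<in> N \<inter> M" for y
      using has_derivative_mult [OF N(4) [of y] M(4) [of y]] that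
      by (simp add: ring_distribs sum.distrib sum_distrib_left sum_distrib_right mult_ac)
  qed (use N M in auto)
qed

lemma holo_germ_compose:
  assumes "holo_germ f" "open S" "f 0 \<in> S" "continuous_on S \<psi>'"
    "\<And>z. z \<in> S \<Longrightarrow> (\<psi> has_field_derivative \<psi>' z) (at z)"
  shows "holo_germ (\<lambda>y. \<psi> (f y))"
proof -
  obtain N d where "holo_germ_on N d f"
    using assms(1) unfolding holo_germ_def by blast
  note N = holo_germ_onD [OF this]
  define M where "M = N \<inter> f -` S"
  have M: "open M" unfolding M_def
    using continuous_open_preimage [OF N(5,1) assms(2)] .
  show ?thesis
  proof (rule holo_germI [OF M, of "\<lambda>i y. \<psi>' (f y) * d i y"])
    show "continuous_on M (\<lambda>y. \<psi>' (f y) * d i y)" for i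
      by (intro continuous_on_mult continuous_on_compose2 [OF assms(4)]
          continuous_on_subset [OF N(3)] continuous_on_subset [OF N(5)]) (auto simp: M_def)
    show "((\<lambda>y. \<psi> (f y)) has_derivative (\<lambda>h. \<Sum>i\<in>UNIV. \<psi>' (f y) * d i y * h $ i)) (at y)" if y: "y \<in> M" for y
    proof -
      have "(\<psi> has_derivative (*) (\<psi>' (f y))) (at (f y))"
        using assms(5) y unfolding M_def has_field_derivative_def by blast
      from has_derivative_compose [OF N(4) this] y show ?thesis
        by (simp add: M_def sum_distrib_left mult.assoc)
    qed
  qed (use N assms(3) in \<open>auto simp: M_def\<close>)
qed

text \<open>The value 1 at the origin is off the branch cut of \<open>csqrt\<close>, so the
  principal root is holomorphic near it.\<close>

lemma holo_germ_csqrt: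
  assumes "holo_germ f" "f 0 = 1"
  shows "holo_germ (\<lambda>y. csqrt (f y))"
proof (rule holo_germ_compose [OF assms(1), of "- \<real>\<^sub>\<le>\<^sub>0" "\<lambda>z. 1 / (2 * csqrt z)"])
  show "continuous_on (- \<real>\<^sub>\<le>\<^sub>0) (\<lambda>z. 1 / (2 * csqrt z))"
    by (intro continuous_intros) auto
  show "(csqrt has_field_derivative 1 / (2 * csqrt z)) (at z)" if "z \<in> - \<real>\<^sub>\<le>\<^sub>0" for z
  proof -
    have "z \<notin> \<real>\<^sub>\<le>\<^sub>0" using that by simp
    from has_field_derivative_csqrt [OF this] show ?thesis by (simp only: inverse_eq_divide)
  qed
qed (use assms(2) in auto)

lemma holo_germ_inverse:
  assumes "holo_germ f" "f 0 \<noteq> 0"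
  shows "holo_germ (\<lambda>y. inverse (f y))"
proof (rule holo_germ_compose [OF assms(1), of "- {0}" "\<lambda>z. - (inverse z * inverse z)"])
  show "continuous_on (- {0}) (\<lambda>z :: complex. - (inverse z * inverse z))"
    by (intro continuous_intros) auto
  show "(inverse has_field_derivative - (inverse z * inverse z)) (at z)" if "z \<in> - {0 :: complex}" for z
    using DERIV_inverse [of z] that by (simp add: power2_eq_square)
qed (use assms(2) in auto)

lemma holo_germ_sum: "(\<And>i. i \<in> I \<Longrightarrow> holo_germ (f i)) \<Longrightarrow> holo_germ (\<lambda>y. \<Sum>i\<in>I. f i y)"
  by (induction I rule: infinite_finite_induct) (auto intro: holo_germ_const holo_germ_add)

lemma holo_germ_diff: "holo_germ f \<Longrightarrow> holo_germ g \<Longrightarrow> holo_germ (\<lambda>y. f y - g y)"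
  using holo_germ_add [of f "\<lambda>y. (-1) * g y"] holo_germ_mult [OF holo_germ_const [of "-1"], of g] by simp

lemma holo_germ_tendsto: "holo_germ f \<Longrightarrow> (f \<longlongrightarrow> f 0) (nhds 0)"
proof -
  assume "holo_germ f"
  then obtain N d where "holo_germ_on N d f" unfolding holo_germ_def by blast
  note holo_germ_onD(1,2,5) [OF this]
  then have "isCont f 0" by (simp add: continuous_on_eq_continuous_at)
  then show ?thesis by (simp add: isCont_def tendsto_at_iff_tendsto_nhds)
qed

text \<open>In the product rule the term with the derivative of \<open>a\<close> carries the factor
  \<open>y $ j\<close>, which is 0 at the origin.\<close>

lemma holo_germ_mult_nth_derivative:
  assumes "holo_germ a"
  shows "((\<lambda>y. a y * y $ j) has_derivative (\<lambda>k. a 0 * k $ j)) (at 0)"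
proof -
  obtain N d where "holo_germ_on N d a"
    using assms unfolding holo_germ_def by blast
  note N = holo_germ_onD(2,4) [OF this]
  from has_derivative_mult [OF N(2) [OF N(1)] bounded_linear_imp_has_derivative [OF bounded_linear_vec_nth [of j]]]
  show ?thesis by simp
qed

text \<open>Completing the square one index at a time.\<close>

lemma holo_germ_sum_of_squares:
  fixes h :: "'n::finite \<Rightarrow> 'n \<Rightarrow> complex^'n \<Rightarrow> complex"
  assumes "finite I" "\<And>i j. i \<in> I \<Longrightarrow> j \<in> I \<Longrightarrow> holo_germ (h i j)"
    "\<And>i j y. i \<in> I \<Longrightarrow> j \<in> I \<Longrightarrow> h i j y = h j i y"
    "\<And>i j. i \<in> I \<Longrightarrow> j \<in> I \<Longrightarrow> h i j 0 = (if i = j then 1 else 0)"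
  shows "\<exists>z. (\<forall>i\<in>I. holo_germ (z i) \<and> z i 0 = 0 \<and> (z i has_derivative (\<lambda>k. k $ i)) (at 0)) \<and>
     (\<forall>\<^sub>F y in nhds 0. (\<Sum>i\<in>I. \<Sum>j\<in>I. h i j y * y $ i * y $ j) = (\<Sum>i\<in>I. (z i y)^2))"
  using assms
proof (induction I arbitrary: h)
  case empty
  then show ?case by auto
next
  case (insert k I)
  define s where "s = (\<lambda>y. csqrt (h k k y))"
  have hkk: "holo_germ (h k k)" "h k k 0 = 1" using insert.prems by auto
  have s: "holo_germ s" "s 0 = 1"
    unfolding s_def using holo_germ_csqrt [OF hkk] hkk(2) by auto
  have s': "holo_germ (\<lambda>y. inverse (s y))" by (rule holo_germ_inverse) (use s in auto)
  have hk': "holo_germ (\<lambda>y. inverse (h k k y))" by (rule holo_germ_inverse) (use hkk in auto)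
  \<comment> \<open>The Schur complement of the entry \<open>h k k\<close>. At the origin it is
    still the identity matrix, since the entries \<open>h k i\<close> with
    \<open>i \<noteq> k\<close> vanish there.\<close>
  define h' where "h' = (\<lambda>i j y. h i j y - h k i y * h k j y * inverse (h k k y))"
  \<comment> \<open>The square of this function collects every term that contains
    \<open>y $ k\<close>; the excess it creates among the other coordinates is what
    \<open>h'\<close> subtracts.\<close>
  define zk where "zk = (\<lambda>y. s y * y $ k + (\<Sum>j\<in>I. h k j y * inverse (s y) * y $ j))"
  have "\<exists>z. (\<forall>i\<in>I. holo_germ (z i) \<and> z i 0 = 0 \<and> (z i has_derivative (\<lambda>k. k $ i)) (at 0)) \<and>
     (\<forall>\<^sub>F y in nhds 0. (\<Sum>i\<in>I. \<Sum>j\<in>I. h' i j y * y $ i * y $ j) = (\<Sum>i\<in>I. (z i y)^2))"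
  proof (rule insert.IH)
    show "holo_germ (h' i j)" if "i \<in> I" "j \<in> I" for i j
      unfolding h'_def using that insert.prems(1) hk'
      by (intro holo_germ_diff holo_germ_mult) auto
    show "h' i j y = h' j i y" if "i \<in> I" "j \<in> I" for i j y
      unfolding h'_def using that insert.prems(2) by (simp add: mult_ac)
    show "h' i j 0 = (if i = j then 1 else 0)" if ij: "i \<in> I" "j \<in> I" for i j
    proof -
      have "k \<noteq> i" using ij insert.hyps by auto
      then have "h k i 0 = 0" using ij insert.prems(3) [of k i] by simp
      then show ?thesis unfolding h'_def using ij insert.prems(3) [of i j] by simp
    qed
  qed
  then obtain z where z: "\<forall>i\<in>I. holo_germ (z i) \<and> z i 0 = 0 \<and> (z i has_derivative (\<lambda>k. k $ i)) (at 0)"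
    "\<forall>\<^sub>F y in nhds 0. (\<Sum>i\<in>I. \<Sum>j\<in>I. h' i j y * y $ i * y $ j) = (\<Sum>i\<in>I. (z i y)^2)" by blast
  have zk: "holo_germ zk"
    unfolding zk_def using insert.prems(1) s s'
    by (intro holo_germ_add holo_germ_mult holo_germ_sum holo_germ_nth) auto
  have "zk 0 = 0" by (simp add: zk_def)
  have "((\<lambda>y. s y * y $ k + (\<Sum>j\<in>I. h k j y * inverse (s y) * y $ j)) has_derivative
      (\<lambda>v. s 0 * v $ k + (\<Sum>j\<in>I. h k j 0 * inverse (s 0) * v $ j))) (at 0)"
    using insert.prems(1) s s'
    by (intro has_derivative_add has_derivative_sum
        holo_germ_mult_nth_derivative [of "\<lambda>y. h k _ y * inverse (s y)"] holo_germ_mult_nth_derivative holo_germ_mult) auto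
  moreover have "s 0 * v $ k + (\<Sum>j\<in>I. h k j 0 * inverse (s 0) * v $ j) = v $ k" for v :: "complex^'n"
  proof -
    have "h k j 0 = 0" if j: "j \<in> I" for j
      using insert.prems(3) [of k j] insert.hyps j by auto
    then show ?thesis using s(2) by simp
  qed
  ultimately have zk': "(zk has_derivative (\<lambda>v. v $ k)) (at 0)" unfolding zk_def by simp
  have "\<forall>\<^sub>F y in nhds 0. s y \<noteq> 0"
    using tendsto_imp_eventually_ne [OF holo_germ_tendsto [OF s(1)], of 0] s(2) by simp
  then have ev: "\<forall>\<^sub>F y in nhds 0. (\<Sum>i\<in>insert k I. \<Sum>j\<in>insert k I. h i j y * y $ i * y $ j)
      = (\<Sum>i\<in>insert k I. ((z(k := zk)) i y)^2)"
    using z(2)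
  proof eventually_elim
    case (elim y)
    have hs: "h k k y = s y * s y" by (simp add: s_def flip: power2_eq_square)
    define T where "T = (\<Sum>j\<in>I. h k j y * y $ j)"
    have zkT: "zk y = s y * y $ k + inverse (s y) * T"
      unfolding zk_def T_def by (simp add: sum_distrib_left mult_ac)
    have sym: "(\<Sum>i\<in>I. h i k y * y $ i * y $ k) = T * y $ k"
      unfolding T_def sum_distrib_right by (rule sum.cong) (use insert.prems(2) in auto)
    have T1: "(\<Sum>j\<in>I. h k j y * y $ k * y $ j) = T * y $ k"
      unfolding T_def sum_distrib_right by (rule sum.cong) auto
    have T2: "(\<Sum>i\<in>I. \<Sum>j\<in>I. h k i y * h k j y * inverse (h k k y) * y $ i * y $ j) = T * T * inverse (h k k y)"
      unfolding T_def unfolding sum_product unfolding sum_distrib_right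
      by (intro sum.cong refl) (simp add: mult_ac)
    have "(\<Sum>i\<in>I. \<Sum>j\<in>I. h i j y * y $ i * y $ j) =
       (\<Sum>i\<in>I. \<Sum>j\<in>I. h' i j y * y $ i * y $ j) + T * T * inverse (h k k y)"
      unfolding T2 [symmetric] sum.distrib [symmetric] h'_def
      by (intro sum.cong) (auto simp: algebra_simps)
    then have "(\<Sum>i\<in>insert k I. \<Sum>j\<in>insert k I. h i j y * y $ i * y $ j) =
       h k k y * y $ k * y $ k + 2 * T * y $ k + T * T * inverse (h k k y) + (\<Sum>i\<in>I. (z i y)^2)"
      using insert.hyps elim(2) by (simp add: sum.distrib sym T1)
    also have "h k k y * y $ k * y $ k + 2 * T * y $ k + T * T * inverse (h k k y) = (zk y)^2"
      unfolding zkT hs using elim(1) by (simp add: power2_eq_square field_simps)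
    also have "(zk y)^2 + (\<Sum>i\<in>I. (z i y)^2) = (\<Sum>i\<in>insert k I. ((z(k := zk)) i y)^2)"
    proof -
      have "(\<Sum>i\<in>I. (z i y)^2) = (\<Sum>i\<in>I. ((z(k := zk)) i y)^2)"
        using insert.hyps by (intro sum.cong) auto
      then show ?thesis using insert.hyps by simp
    qed
    finally show ?case .
  qed
  show ?case
    using z(1) zk \<open>zk 0 = 0\<close> zk' ev by (intro exI [of _ "z(k := zk)"]) auto
qed

lemma has_derivative_vec_lambda:
  fixes f :: "'n::finite \<Rightarrow> 'a::real_normed_vector \<Rightarrow> 'b::euclidean_space"
  assumes "\<And>i. (f i has_derivative f' i) (at y)"
  shows "((\<lambda>y. \<chi> i. f i y) has_derivative (\<lambda>h. \<chi> i. f' i h)) (at y)"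
  by (subst has_derivative_componentwise_within)
    (use assms in \<open>auto simp: Basis_vec_def inner_axis intro!: has_derivative_inner_left\<close>)

text \<open>The inverse comes from the real inverse function theorem, which gives only real
  differentiability. Its derivative is the inverse of a complex linear bijection and therefore
  complex linear. The condition \<open>P\<close> is built into the domain so that it survives the
  change of coordinates.\<close>

lemma holomorphic_inverse:
  fixes z :: "'n::finite \<Rightarrow> complex^'n \<Rightarrow> complex"
  assumes z: "\<And>i. holo_germ (z i)" "\<And>i. z i 0 = 0" "\<And>i. (z i has_derivative (\<lambda>k. k $ i)) (at 0)"
    and P: "\<forall>\<^sub>F y in nhds 0. P y"
  obtains N g where "open N" "0 \<in> N" "g 0 = 0" "(g has_derivative id) (at 0)"
    "\<And>y. y \<in> N \<Longrightarrow> P (g y)" "\<And>y i. y \<in> N \<Longrightarrow> z i (g y) = y $ i"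
    "\<And>y. y \<in> N \<Longrightarrow> \<exists>D. (g has_derivative D) (at y) \<and> (\<forall>c h. D (c *s h) = c *s D h)"
proof -
  have "\<forall>i. \<exists>N d. holo_germ_on N d (z i)"
    using z(1) unfolding holo_germ_def by blast
  then obtain N d where "\<And>i. holo_germ_on (N i) (d i) (z i)"
    by metis
  note N = holo_germ_onD [OF this]
  obtain N0 where N0: "open N0" "0 \<in> N0" "\<And>y. y \<in> N0 \<Longrightarrow> P y"
    using P unfolding eventually_nhds by blast
  define U where "U = N0 \<inter> (\<Inter>i. N i)"
  have U: "open U" "0 \<in> U" unfolding U_def using N(1,2) N0 by (auto intro!: open_Int open_INT)
  define f where "f = (\<lambda>y. \<chi> i. z i y)"
  define A where "A = (\<lambda>y h. \<chi> i. \<Sum>j\<in>UNIV. d i j y * h $ j)"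
  have A_bl: "bounded_linear (A y)" for y
    unfolding linear_conv_bounded_linear [symmetric] A_def
    by (rule linearI) (simp_all add: vec_eq_iff ring_distribs sum.distrib scaleR_sum_right)
  define f' where "f' = (\<lambda>y. Blinfun (A y))"
  have f': "blinfun_apply (f' y) = A y" for y
    unfolding f'_def by (rule bounded_linear_Blinfun_apply [OF A_bl])
  have der: "(f has_derivative blinfun_apply (f' y)) (at y)" if "y \<in> U" for y
    unfolding f' f_def A_def
    by (rule has_derivative_vec_lambda) (use that N(4) in \<open>auto simp: U_def\<close>)
  have cont: "continuous_on U f'"
  proof (rule continuous_on_blinfun_componentwise)
    fix v :: "complex^'n"
    have "continuous_on U (d i j)" for i j
      by (rule continuous_on_subset [OF N(3)]) (auto simp: U_def)
    then show "continuous_on U (\<lambda>y. blinfun_apply (f' y) v)"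
      unfolding f' A_def by (intro continuous_intros)
  qed
  have "(f has_derivative (\<lambda>k. \<chi> i. k $ i)) (at 0)"
    unfolding f_def by (rule has_derivative_vec_lambda) (rule z(3))
  then have A0: "A 0 = (\<lambda>k. k)"
    using has_derivative_unique [OF der [OF U(2)]] unfolding f' by simp
  have f0: "f 0 = 0" unfolding f_def using z(2) by (simp add: vec_eq_iff)
  have invf: "id_blinfun o\<^sub>L f' 0 = id_blinfun"
    by (rule blinfun_eqI) (simp add: f' A0)
  obtain U' V g g' where g: "open U'" "U' \<subseteq> U" "0 \<in> U'" "open V" "f 0 \<in> V" "homeomorphism U' V f g"
    "\<And>y. y \<in> V \<Longrightarrow> (g has_derivative (g' y)) (at y)"
    "\<And>y. y \<in> V \<Longrightarrow> g' y = inv_into UNIV (blinfun_apply (f'(g y)))"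
    "\<And>y. y \<in> V \<Longrightarrow> bij (blinfun_apply (f'(g y)))"
    using inverse_function_theorem [OF U(1) der cont U(2) invf] by metis
  have gV: "g y \<in> U'" "f (g y) = y" if "y \<in> V" for y
    using g(6) that unfolding homeomorphism_def by auto
  have g0: "g 0 = 0" using g(3,6) f0 unfolding homeomorphism_def by metis
  show thesis
  proof (rule that [of V g])
    show "open V" "0 \<in> V" "g 0 = 0" using g f0 g0 by auto
    have "g' 0 = id"
      using g(8) [of 0] g(5) unfolding f0 g0 f' A0 by (simp add: inv_id [unfolded id_def] id_def)
    then show "(g has_derivative id) (at 0)" using g(5,7) f0 by metis
    show "P (g y)" if "y \<in> V" for y
      using gV(1) [OF that] g(2) N0(3) unfolding U_def by blast
    show "z i (g y) = y $ i" if "y \<in> V" for y i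
      using gV(2) [OF that] unfolding f_def by (metis vec_lambda_beta)
    show "\<exists>D. (g has_derivative D) (at y) \<and> (\<forall>c h. D (c *s h) = c *s D h)" if y: "y \<in> V" for y
    proof (intro exI conjI allI)
      show "(g has_derivative (g' y)) (at y)" using g(7) y .
      fix c h
      have b: "bij (A (g y))" using g(9) [OF y] unfolding f' .
      have lin: "A (g y) (c *s w) = c *s A (g y) w" for w
        unfolding A_def by (simp add: vec_eq_iff sum_distrib_left mult_ac)
      have "A (g y) (c *s inv_into UNIV (A (g y)) h) = c *s h"
        unfolding lin using b by (simp add: bij_is_surj surj_f_inv_f)
      then show "g' y (c *s h) = c *s g' y h"
        unfolding g(8) [OF y] f' using b by (metis bij_is_inj inv_f_f)
    qed
  qed
qed

text \<open>The chart required by the definition is \<open>x0 + L (g y)\<close>, where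
  \<open>g\<close> inverts the map with components \<open>z i\<close>; in it the equation is in
  normal form, with the constant \<open>e\<close> as unit. The differential condition on the chart
  is the injectivity of \<open>L\<close> modulo the line of \<open>x0\<close>.\<close>

lemma singularity_type_A_criterion:
  fixes z :: "5 \<Rightarrow> complex^5 \<Rightarrow> complex"
  assumes z: "\<And>i. holo_germ (z i)" "\<And>i. z i 0 = 0" "\<And>i. (z i has_derivative (\<lambda>k. k $ i)) (at 0)"
    and L: "bounded_linear L" "\<And>c h. L (c *s h) = c *s L h" "\<And>h c. L h = c *s x0 \<Longrightarrow> h = 0"
    and x0: "x0 \<noteq> 0" and e: "e \<noteq> 0"
    and F: "\<forall>\<^sub>F y in nhds 0. F (x0 + L y) =
      e * ((z 1 y)\<^sup>2 + (z 2 y)\<^sup>2 + (z 3 y)\<^sup>2 + (z 4 y)\<^sup>2 + z 5 y ^ (k + 1))"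
  shows "singularity_type_A k F (proj_point (*s) x0)"
proof -
  obtain N g where g: "open N" "0 \<in> N" "g 0 = 0" "(g has_derivative id) (at 0)"
    "\<And>y. y \<in> N \<Longrightarrow> F (x0 + L (g y)) =
      e * ((z 1 (g y))\<^sup>2 + (z 2 (g y))\<^sup>2 + (z 3 (g y))\<^sup>2 + (z 4 (g y))\<^sup>2 + z 5 (g y) ^ (k + 1))"
    "\<And>y i. y \<in> N \<Longrightarrow> z i (g y) = y $ i"
    "\<And>y. y \<in> N \<Longrightarrow> \<exists>D. (g has_derivative D) (at y) \<and> (\<forall>c h. D (c *s h) = c *s D h)"
    by (rule holomorphic_inverse [OF z F]) blast
  define \<phi> where "\<phi> = (\<lambda>y. x0 + L (g y))"
  have \<phi>0: "\<phi> 0 = x0" unfolding \<phi>_def g(3) using L(1) by (simp add: linear_simps)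
  have der: "(\<phi> has_derivative (\<lambda>h. L (D h))) (at y)" if "(g has_derivative D) (at y)" for D y
    unfolding \<phi>_def using bounded_linear.has_derivative [OF L(1) that]
    by (auto intro!: derivative_eq_intros)
  have "(\<phi> has_derivative L) (at 0)" using der [OF g(4)] by simp
  moreover have "holomorphic_on_vec (\<lambda>y. \<phi> y $ i) N" for i
    unfolding holomorphic_on_vec_def
  proof
    fix y assume "y \<in> N"
    then obtain D where D: "(g has_derivative D) (at y)" "\<forall>c h. D (c *s h) = c *s D h"
      using g(7) by blast
    show "\<exists>D. ((\<lambda>y. \<phi> y $ i) has_derivative D) (at y) \<and> (\<forall>c h. D (c *s h) = c * D h)"
      by (rule exI [of _ "\<lambda>h. L (D h) $ i"])
        (use bounded_linear.has_derivative [OF bounded_linear_vec_nth der [OF D(1)]] D(2) L(2) in simp)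
  qed
  moreover have "holomorphic_on_vec (\<lambda>_. e) N"
    unfolding holomorphic_on_vec_def by (intro ballI exI [of _ "\<lambda>_. 0"]) simp
  moreover have "F (\<phi> y) = e * ((y $ 1)\<^sup>2 + (y $ 2)\<^sup>2 + (y $ 3)\<^sup>2 + (y $ 4)\<^sup>2 + (y $ 5) ^ (k + 1))" if "y \<in> N" for y
    unfolding \<phi>_def g(5) [OF that] g(6) [OF that] ..
  ultimately show ?thesis
    unfolding singularity_type_A_def
    using g(1,2) x0 e L(3) \<phi>0
    by (intro exI [of _ N] exI [of _ \<phi>] exI [of _ "\<lambda>_. e"] exI [of _ L]) auto
qed

section \<open>The discrete Fourier transform of order three and its effect on the cubic\<close>

definition omega3 :: complex where "omega3 = cis (2 * pi / 3)"

lemma omega3_cube: "omega3 ^ 3 = 1"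
proof -
  have "omega3 ^ 3 = cis (real 3 * (2 * pi / 3))" unfolding omega3_def by (rule Complex.DeMoivre)
  also have "real 3 * (2 * pi / 3) = 2 * pi" by simp
  finally show ?thesis by simp
qed

lemma omega3_neq_1: "omega3 \<noteq> 1"
proof
  assume "omega3 = 1"
  then have "sin (2 * pi / 3) = 0" by (simp add: omega3_def complex_eq_iff)
  then show False using sin_gt_zero [of "2 * pi / 3"] by simp
qed

lemma omega3_sum: "omega3 ^ 2 = - 1 - omega3"
proof -
  have "(omega3 - 1) * (omega3 ^ 2 + omega3 + 1) = 0" using omega3_cube by algebra
  then have "omega3 ^ 2 + omega3 + 1 = 0" using omega3_neq_1 by simp
  then show ?thesis by algebra
qed

text \<open>Fourier inversion on the group of order three: weighting the equations by inverse
  characters and adding isolates 3 times one unknown. The remaining terms are multiples of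
  \<open>T\<close>, the vanishing sum of the three roots of unity.\<close>

lemma discrete_fourier_injective:
  fixes w s a b :: complex
  assumes w: "w^2 = - 1 - w"
    and e: "s + a + b = 0" "s + w * a + w^2 * b = 0" "s + w^2 * a + w * b = 0"
  shows "s = 0" "a = 0" "b = 0"
proof -
  define T where "T = 1 + w + w^2"
  have T: "T = 0" using w by (simp add: T_def)
  have "3 * s = (s + a + b) + (s + w * a + w^2 * b) + (s + w^2 * a + w * b) - T * (a + b)"
    unfolding T_def by algebra
  then show "s = 0" unfolding e T by simp
  have "3 * a = (s + a + b) + w^2 * (s + w * a + w^2 * b) + w * (s + w^2 * a + w * b)
      - T * s - 2 * (w - 1) * T * a - (T + w * (w - 1) * T) * b"
    unfolding T_def by algebra
  then show "a = 0" unfolding e T by simp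
  have "3 * b = (s + a + b) + w * (s + w * a + w^2 * b) + w^2 * (s + w^2 * a + w * b)
      - T * s - 2 * (w - 1) * T * b - (T + w * (w - 1) * T) * a"
    unfolding T_def by algebra
  then show "b = 0" unfolding e T by simp
qed

definition linear_in :: "'n::finite set \<Rightarrow> (complex^'n \<Rightarrow> complex) \<Rightarrow> bool" where
  "linear_in I m \<longleftrightarrow> (\<exists>c. \<forall>y. m y = (\<Sum>i\<in>I. c i * y $ i))"

text \<open>The coefficients \<open>h i j\<close> vanish at 0 and may involve coordinates outside
  \<open>I\<close>. Such a function can be added to a nondegenerate quadratic form in the
  coordinates of \<open>I\<close> without changing the form at the origin.\<close>

definition quadratic_in :: "'n::finite set \<Rightarrow> (complex^'n \<Rightarrow> complex) \<Rightarrow> bool" where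
  "quadratic_in I f \<longleftrightarrow> (\<exists>h. (\<forall>i j. holo_germ (h i j) \<and> h i j 0 = 0) \<and>
     (\<forall>y. f y = (\<Sum>i\<in>I. \<Sum>j\<in>I. h i j y * y $ i * y $ j)))"

lemma linear_in_nth: "i \<in> I \<Longrightarrow> linear_in I (\<lambda>y. y $ i)"
  unfolding linear_in_def
  by (rule exI [of _ "\<lambda>j. if j = i then 1 else 0"]) (simp add: mult_delta_left)

lemma linear_in_add:
  assumes "linear_in I m" "linear_in I n"
  shows "linear_in I (\<lambda>y. m y + n y)"
proof -
  obtain c d where "\<forall>y. m y = (\<Sum>i\<in>I. c i * y $ i)" "\<forall>y. n y = (\<Sum>i\<in>I. d i * y $ i)"
    using assms unfolding linear_in_def by blast
  then show ?thesis unfolding linear_in_def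
    by (intro exI [of _ "\<lambda>i. c i + d i"]) (simp add: ring_distribs sum.distrib)
qed

lemma linear_in_cmult:
  assumes "linear_in I m"
  shows "linear_in I (\<lambda>y. c * m y)"
proof -
  obtain d where "\<forall>y. m y = (\<Sum>i\<in>I. d i * y $ i)"
    using assms unfolding linear_in_def by blast
  then show ?thesis unfolding linear_in_def
    by (intro exI [of _ "\<lambda>i. c * d i"]) (simp add: sum_distrib_left mult_ac)
qed

lemma linear_in_diff: "linear_in I m \<Longrightarrow> linear_in I n \<Longrightarrow> linear_in I (\<lambda>y. m y - n y)"
  using linear_in_add [of I m "\<lambda>y. (-1) * n y"] linear_in_cmult [of I n "-1"] by simp

lemma linear_in_holo_germ: "linear_in I m \<Longrightarrow> holo_germ m \<and> m 0 = 0"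
proof -
  assume "linear_in I m"
  then obtain d where "\<forall>y. m y = (\<Sum>i\<in>I. d i * y $ i)"
    unfolding linear_in_def by blast
  then have "m = (\<lambda>y. \<Sum>i\<in>I. d i * y $ i)" by auto
  then show ?thesis
    by (auto intro!: holo_germ_sum holo_germ_mult holo_germ_const holo_germ_nth)
qed

lemma quadratic_in_add:
  assumes "quadratic_in I f" "quadratic_in I g"
  shows "quadratic_in I (\<lambda>y. f y + g y)"
proof -
  obtain h k where "\<forall>i j. holo_germ (h i j) \<and> h i j 0 = 0" "\<forall>i j. holo_germ (k i j) \<and> k i j 0 = 0"
    "\<forall>y. f y = (\<Sum>i\<in>I. \<Sum>j\<in>I. h i j y * y $ i * y $ j)"
    "\<forall>y. g y = (\<Sum>i\<in>I. \<Sum>j\<in>I. k i j y * y $ i * y $ j)"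
    using assms unfolding quadratic_in_def by blast
  then show ?thesis unfolding quadratic_in_def
    by (intro exI [of _ "\<lambda>i j y. h i j y + k i j y"])
      (simp add: holo_germ_add ring_distribs sum.distrib)
qed

lemma quadratic_in_mult:
  assumes "holo_germ l" "l 0 = 0" "linear_in I m" "linear_in I n"
  shows "quadratic_in I (\<lambda>y. l y * m y * n y)"
proof -
  obtain c d where cd: "\<forall>y. m y = (\<Sum>i\<in>I. c i * y $ i)" "\<forall>y. n y = (\<Sum>i\<in>I. d i * y $ i)"
    using assms unfolding linear_in_def by blast
  have "l y * m y * n y = (\<Sum>i\<in>I. \<Sum>j\<in>I. (l y * (c i * d j)) * y $ i * y $ j)" for y
  proof -
    have "l y * m y * n y = l y * (\<Sum>i\<in>I. \<Sum>j\<in>I. (c i * y $ i) * (d j * y $ j))"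
      using cd by (simp add: sum_product mult.assoc)
    also have "\<dots> = (\<Sum>i\<in>I. \<Sum>j\<in>I. (l y * (c i * d j)) * y $ i * y $ j)"
      unfolding sum_distrib_left by (intro sum.cong refl) (simp add: mult_ac)
    finally show ?thesis .
  qed
  then show ?thesis unfolding quadratic_in_def
    using assms(1,2) by (intro exI [of _ "\<lambda>i j y. l y * (c i * d j)"]) (auto intro!: holo_germ_mult holo_germ_const)
qed

text \<open>A Morse lemma with parameters: the remaining coordinates enter only through the
  coefficients. Averaging \<open>h i j\<close> with \<open>h j i\<close> gives a symmetric matrix
  that is the identity at the origin, as the diagonalisation needs.\<close>

lemma sum_of_squares_perturbation:
  fixes f :: "complex^'n::finite \<Rightarrow> complex"
  assumes "quadratic_in I f"
  shows "\<exists>z. (\<forall>i\<in>I. holo_germ (z i) \<and> z i 0 = 0 \<and> (z i has_derivative (\<lambda>k. k $ i)) (at 0)) \<and>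
     (\<forall>\<^sub>F y in nhds 0. (\<Sum>i\<in>I. (y $ i)^2) + f y = (\<Sum>i\<in>I. (z i y)^2))"
proof -
  obtain h where h: "\<forall>i j. holo_germ (h i j) \<and> h i j 0 = 0"
     "\<forall>y. f y = (\<Sum>i\<in>I. \<Sum>j\<in>I. h i j y * y $ i * y $ j)"
    using assms unfolding quadratic_in_def by blast
  define k where "k = (\<lambda>i j y. (if i = j then 1 else 0) + (h i j y + h j i y) * (1/2))"
  have k: "(\<Sum>i\<in>I. \<Sum>j\<in>I. k i j y * y $ i * y $ j) = (\<Sum>i\<in>I. (y $ i)^2) + f y" for y
  proof -
    have "(\<Sum>i\<in>I. \<Sum>j\<in>I. (if i = j then 1 else 0) * y $ i * y $ j) = (\<Sum>i\<in>I. (y $ i)^2)"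
      by (simp add: mult_delta_left power2_eq_square if_distrib [of "\<lambda>x. x * _"] cong: if_cong)
    moreover have "(\<Sum>i\<in>I. \<Sum>j\<in>I. h j i y * y $ i * y $ j) = f y"
      using h(2) by (subst sum.swap) (simp add: mult_ac)
    then have "(\<Sum>i\<in>I. \<Sum>j\<in>I. (h i j y + h j i y) * (1/2) * y $ i * y $ j) = (f y + f y) * (1/2)"
      using h(2) by (simp add: ring_distribs sum.distrib sum_distrib_right [symmetric] sum_divide_distrib [symmetric])
    ultimately show ?thesis
      unfolding k_def by (simp add: ring_distribs sum.distrib)
  qed
  have "\<exists>z. (\<forall>i\<in>I. holo_germ (z i) \<and> z i 0 = 0 \<and> (z i has_derivative (\<lambda>k. k $ i)) (at 0)) \<and>
     (\<forall>\<^sub>F y in nhds 0. (\<Sum>i\<in>I. \<Sum>j\<in>I. k i j y * y $ i * y $ j) = (\<Sum>i\<in>I. (z i y)^2))"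
  proof (rule holo_germ_sum_of_squares)
    show "holo_germ (k i j)" for i j
      unfolding k_def using h(1) by (intro holo_germ_add holo_germ_mult holo_germ_const) auto
  qed (use h(1) in \<open>auto simp: k_def\<close>)
  then show ?thesis unfolding k .
qed

text \<open>Coordinates adapted to the cyclic symmetry of order three: \<open>u\<^sub>j\<close> and \<open>v\<^sub>j\<close> are the components
  in its eigenspaces, \<open>u\<^sub>0 = 1\<close> and \<open>v\<^sub>0 = v\<close>.\<close>

definition fourier :: "complex \<Rightarrow> complex \<Rightarrow> complex \<Rightarrow> complex \<Rightarrow> complex \<Rightarrow> complex \<Rightarrow> complex^6" where
  "fourier u v u1 v1 u2 v2 = (\<chi> i. if i = 1 then u + u1 + u2 else if i = 2 then v + v1 + v2
     else if i = 3 then u + omega3 * u1 + omega3^2 * u2 else if i = 4 then v + omega3 * v1 + omega3^2 * v2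
     else if i = 5 then u + omega3^2 * u1 + omega3 * u2 else v + omega3^2 * v1 + omega3 * v2)"

lemma fourier_nth [simp]:
  "fourier u v u1 v1 u2 v2 $ 1 = u + u1 + u2" "fourier u v u1 v1 u2 v2 $ 2 = v + v1 + v2"
  "fourier u v u1 v1 u2 v2 $ 3 = u + omega3 * u1 + omega3^2 * u2"
  "fourier u v u1 v1 u2 v2 $ 4 = v + omega3 * v1 + omega3^2 * v2"
  "fourier u v u1 v1 u2 v2 $ 5 = u + omega3^2 * u1 + omega3 * u2"
  "fourier u v u1 v1 u2 v2 $ 6 = v + omega3^2 * v1 + omega3 * v2"
  by (simp_all add: fourier_def)

text \<open>Summation over the cyclic rotation keeps the monomials on which the rotation acts
  trivially; all others cancel by 1 + w + w^2 = 0. The factors \<open>w\<close> in the second sum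
  come from the offset by one rotation between the squared factor and the other one.\<close>

lemma fourier_sums:
  fixes w u v u1 v1 u2 v2 :: complex
  assumes w: "w^2 = - 1 - w"
  shows "(u+u1+u2)^2 * (v+v1+v2) + (u+w * u1+w^2 * u2)^2 * (v+w * v1+w^2 * v2) + (u+w^2 * u1+w * u2)^2 * (v+w^2 * v1+w * v2)
     = 3 * (u^2 * v + u1^2 * v1 + u2^2 * v2 + 2 * u * u1 * v2 + 2 * u * u2 * v1 + 2 * u1 * u2 * v)"
    "(v+v1+v2)^2 * (u+w * u1+w^2 * u2) + (v+w * v1+w^2 * v2)^2 * (u+w^2 * u1+w * u2) + (v+w^2 * v1+w * v2)^2 * (u+u1+u2)
     = 3 * (v^2 * u + w * v1^2 * u1 + w^2 * v2^2 * u2 + 2 * v * v1 * w^2 * u2 + 2 * v * v2 * w * u1 + 2 * v1 * v2 * u)"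
    "(u+u1+u2) * (u+w * u1+w^2 * u2) * (u+w^2 * u1+w * u2) = u^3 + u1^3 + u2^3 - 3 * u * u1 * u2"
proof -
  have w2: "w * w = - 1 - w" using w by (simp add: power2_eq_square)
  have w3: "w * (w * x) = - x - w * x" for x
    unfolding mult.assoc [symmetric] w2 by (simp add: left_diff_distrib)
  show "(u+u1+u2)^2 * (v+v1+v2) + (u+w * u1+w^2 * u2)^2 * (v+w * v1+w^2 * v2) + (u+w^2 * u1+w * u2)^2 * (v+w^2 * v1+w * v2)
     = 3 * (u^2 * v + u1^2 * v1 + u2^2 * v2 + 2 * u * u1 * v2 + 2 * u * u2 * v1 + 2 * u1 * u2 * v)"
    by (simp add: power2_eq_square power3_eq_cube algebra_simps w2 w3)
  show "(v+v1+v2)^2 * (u+w * u1+w^2 * u2) + (v+w * v1+w^2 * v2)^2 * (u+w^2 * u1+w * u2) + (v+w^2 * v1+w * v2)^2 * (u+u1+u2)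
     = 3 * (v^2 * u + w * v1^2 * u1 + w^2 * v2^2 * u2 + 2 * v * v1 * w^2 * u2 + 2 * v * v2 * w * u1 + 2 * v1 * v2 * u)"
    by (simp add: power2_eq_square power3_eq_cube algebra_simps w2 w3)
  show "(u+u1+u2) * (u+w * u1+w^2 * u2) * (u+w^2 * u1+w * u2) = u^3 + u1^3 + u2^3 - 3 * u * u1 * u2"
    by (simp add: power2_eq_square power3_eq_cube algebra_simps w2 w3)
qed

lemma cubic_family_fourier:
  "cubic_family a b (fourier u v u1 v1 u2 v2) = (3 * (u^2 * v + v^2 * u) + a * u^3 + b * v^3
     + (u1 * u2 * (6 * v - 3 * a * u) + u1 * v2 * (6 * u + 6 * omega3 * v) + v1 * u2 * (6 * u + 6 * omega3^2 * v) + v1 * v2 * (6 * u - 3 * b * v))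
     + (3 * u1^2 * v1 + 3 * omega3 * v1^2 * u1 + a * u1^3 + b * v1^3)
     + (3 * u2^2 * v2 + 3 * omega3^2 * v2^2 * u2 + a * u2^3 + b * v2^3))"
    (is "_ = ?rhs")
proof -
  let ?w = omega3
  have "cubic_family a b (fourier u v u1 v1 u2 v2) =
    ((u+u1+u2)^2 * (v+v1+v2) + (u+?w * u1+?w^2 * u2)^2 * (v+?w * v1+?w^2 * v2) + (u+?w^2 * u1+?w * u2)^2 * (v+?w^2 * v1+?w * v2))
    + ((v+v1+v2)^2 * (u+?w * u1+?w^2 * u2) + (v+?w * v1+?w^2 * v2)^2 * (u+?w^2 * u1+?w * u2) + (v+?w^2 * v1+?w * v2)^2 * (u+u1+u2))
    + a * ((u+u1+u2) * (u+?w * u1+?w^2 * u2) * (u+?w^2 * u1+?w * u2))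
    + b * ((v+v1+v2) * (v+?w * v1+?w^2 * v2) * (v+?w^2 * v1+?w * v2))"
    unfolding cubic_family_def fourier_nth by (simp only: ac_simps)
  also have "\<dots> = ?rhs"
    unfolding fourier_sums [OF omega3_sum] by algebra
  finally show ?thesis .
qed

definition symmetry :: "complex \<Rightarrow> complex^6 \<Rightarrow> complex^6" where
  "symmetry \<xi> x = (\<chi> i. (if i = 1 then 1 else if i = 2 then \<xi>^20 else if i = 3 then \<xi>
     else if i = 4 then \<xi>^18 else if i = 5 then \<xi>^5 else \<xi>^10) * x $ i)"

lemma symmetry_nth [simp]:
  "symmetry \<xi> x $ 1 = x $ 1" "symmetry \<xi> x $ 2 = \<xi>^20 * x $ 2" "symmetry \<xi> x $ 3 = \<xi> * x $ 3"
  "symmetry \<xi> x $ 4 = \<xi>^18 * x $ 4" "symmetry \<xi> x $ 5 = \<xi>^5 * x $ 5" "symmetry \<xi> x $ 6 = \<xi>^10 * x $ 6"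
  by (simp_all add: symmetry_def)

lemma singular_point_eq: "singular_point \<xi> \<rho> = symmetry \<xi> (fourier 1 \<rho> 0 0 0 0)"
  unfolding vec_eq_iff forall_6 by simp

text \<open>Modulo 21 the six monomials with a square all have weight 20, while both triple products
  have weight 27; the excess 7 is what rotates (a, b).\<close>

lemma cubic_family_symmetry:
  assumes \<xi>: "\<xi>^21 = 1"
  shows "cubic_family a b (symmetry \<xi> x) = \<xi>^20 * cubic_family (a * \<xi>^7) (b * \<xi>^7) x"
proof -
  have "cubic_family a b (symmetry \<xi> x) = \<xi>^20 * cubic_family (a * \<xi>^7) (b * \<xi>^7) x
     + (\<xi>^21 - 1) * (\<xi>^20 * ((x$2)^2 * x$3 + (x$4)^2 * x$5) - a * \<xi>^6 * x$1 * x$3 * x$5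
         + b * (\<xi>^27 * x$2 * x$4 * x$6))"
    unfolding cubic_family_def symmetry_nth by algebra
  then show ?thesis using \<xi> by simp
qed

lemma bounded_linear_vec_polyI:
  fixes L :: "complex^'n \<Rightarrow> complex^'m"
  assumes "\<And>x y. L (x + y) = L x + L y" "\<And>c x. L (c *s x) = c *s L x"
  shows "bounded_linear L"
proof -
  have "L (r *\<^sub>R x) = r *\<^sub>R L x" for r x
    using assms(2) [of "of_real r" x] by (simp add: vec_eq_iff scaleR_conv_of_real vector_scalar_mult_def scaleR_vec_def)
  then have "linear L" using assms(1) by (intro linearI)
  then show ?thesis by (simp add: linear_conv_bounded_linear)
qed

lemma exhaust_5: "(x :: 5) = 1 \<or> x = 2 \<or> x = 3 \<or> x = 4 \<or> x = 5"
proof (induct x)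
  case (of_int z)
  then have "z = 0 \<or> z = 1 \<or> z = 2 \<or> z = 3 \<or> z = 4" by fastforce
  then show ?case by auto
qed

text \<open>In the adapted coordinates the quadratic part of the equation pairs the two nontrivial
  eigenspaces, with determinant \<open>189 \<rho>\<close>; its remaining part is a binary cubic with a double root.\<close>

lemma singularity_type_singular_point:
  assumes \<xi>: "\<xi>^21 = 1" and e1: "2 * \<rho> + \<rho>^2 + a * \<xi>^7 = 0" and e2: "1 + 2 * \<rho> + b * \<xi>^7 * \<rho>^2 = 0"
  shows "singularity_type_A 1 (cubic_family a b) (proj_point (*s) (singular_point \<xi> \<rho>)) \<or>
     singularity_type_A 2 (cubic_family a b) (proj_point (*s) (singular_point \<xi> \<rho>))"
proof -
  define A B where AB: "A = a * \<xi>^7" "B = b * \<xi>^7"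
  let ?w = omega3
  have \<xi>0: "\<xi> \<noteq> 0" using \<xi> by auto
  have \<rho>0: "\<rho> \<noteq> 0" using e2 by auto
  have e: "2 * \<rho> + \<rho>^2 + A = 0" "1 + 2 * \<rho> + B * \<rho>^2 = 0" using e1 e2 by (simp_all add: AB)
  \<comment> \<open>The matrix of the pairing between (u1, v1) and (u2, v2) in the quadratic part at
    v = \<rho>, and its determinant.\<close>
  define b11 b12 b21 b22 \<Delta> where b: "b11 = 6*\<rho> - 3 * A" "b12 = 6 + 6 * ?w*\<rho>" "b21 = 6 + 6 * ?w^2*\<rho>"
    "b22 = 6 - 3 * B*\<rho>" "\<Delta> = b11 * b22 - b12 * b21"
  \<comment> \<open>The factor \<open>\<rho>\<close> is carried along because \<open>B\<close> is
    known only through B \<rho>^2 = -1 - 2 \<rho>.\<close>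
  have "\<rho> * \<Delta> = \<rho> * (189 * \<rho>)"
    unfolding b using e omega3_sum by algebra
  then have \<Delta>: "\<Delta> \<noteq> 0" using \<rho>0 by simp
  \<comment> \<open>Along the trivial eigenspace the equation is 3 (v + v^2) + A + B v^3, with a
    double root at \<open>\<rho>\<close>; \<open>c2\<close> is the coefficient of (v -
    \<rho>)^2.\<close>
  define c2 where "c2 = 3 + 3 * B * \<rho>"
  \<comment> \<open>Scales the fifth coordinate so that its quadratic coefficient becomes 1; the
    value 1 is the default when that coefficient vanishes.\<close>
  define \<sigma> where "\<sigma> = (if c2 = 0 then 1 else inverse (csqrt c2))"
  have \<sigma>0: "\<sigma> \<noteq> 0" by (simp add: \<sigma>_def)
  \<comment> \<open>\<open>u1 * t1 + v1 * t2\<close> is the sum of the squares of the first four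
    coordinates. \<open>u2\<close> and \<open>v2\<close> come from Cramer's rule, such that the
    pairing matrix sends them to \<open>t1\<close> and \<open>t2\<close>.\<close>
  define u1 v1 t1 t2 u2 v2 where uv: "u1 = (\<lambda>y :: complex^5. y$1 + \<i> * y$3)" "v1 = (\<lambda>y :: complex^5. y$2 + \<i> * y$4)"
    "t1 = (\<lambda>y :: complex^5. y$1 - \<i> * y$3)" "t2 = (\<lambda>y :: complex^5. y$2 - \<i> * y$4)"
    "u2 = (\<lambda>y. (b22 / \<Delta>) * t1 y - (b12 / \<Delta>) * t2 y)" "v2 = (\<lambda>y. (b11 / \<Delta>) * t2 y - (b21 / \<Delta>) * t1 y)"
  define L0 where "L0 = (\<lambda>y :: complex^5. fourier 0 (\<sigma> * y$5) (u1 y) (v1 y) (u2 y) (v2 y))"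
  define L where "L = (\<lambda>y. symmetry \<xi> (L0 y))"
  define I :: "5 set" where "I = {1, 2, 3, 4}"
  \<comment> \<open>The terms beyond the squares and the powers of \<open>y $ 5\<close>. Each is
    written as a function vanishing at 0 times two linear ones, the shape that
    \<open>quadratic_in_mult\<close> expects.\<close>
  define p where "p = (\<lambda>y. \<sigma> * y$5 * (6 * u1 y) * u2 y + \<sigma> * y$5 * (6 * ?w * u1 y) * v2 y + \<sigma> * y$5 * (6 * ?w^2 * v1 y) * u2 y
    + \<sigma> * y$5 * ((-3) * B * v1 y) * v2 y
    + u1 y * (3 * u1 y) * v1 y + v1 y * (3 * ?w * v1 y) * u1 y + u1 y * (A * u1 y) * u1 y + v1 y * (B * v1 y) * v1 y
    + u2 y * (3 * u2 y) * v2 y + v2 y * (3 * ?w^2 * v2 y) * u2 y + u2 y * (A * u2 y) * u2 y + v2 y * (B * v2 y) * v2 y)"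
  have du: "\<Delta> * u2 y = b22 * t1 y - b12 * t2 y" "\<Delta> * v2 y = b11 * t2 y - b21 * t1 y" for y
    unfolding uv(5,6) using \<Delta> by (simp_all add: right_diff_distrib)
  have "\<Delta> * (b11 * u2 y + b12 * v2 y) = \<Delta> * t1 y" "\<Delta> * (b21 * u2 y + b22 * v2 y) = \<Delta> * t2 y" for y
    using du [of y] unfolding b(5) by algebra+
  then have t: "b11 * u2 y + b12 * v2 y = t1 y" "b21 * u2 y + b22 * v2 y = t2 y" for y
    using \<Delta> by simp_all
  have split: "cubic_family A B (fourier 1 \<rho> 0 0 0 0 + L0 y) =
     (\<Sum>i\<in>I. (y$i)^2) + p y + ((\<sigma> * y$5)^2 * c2 + B * (\<sigma> * y$5)^3)" for y
  proof -
    let ?s = "\<sigma> * y$5"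
    have E0: "fourier 1 \<rho> 0 0 0 0 + L0 y = fourier 1 (\<rho> + ?s) (u1 y) (v1 y) (u2 y) (v2 y)"
      unfolding vec_eq_iff forall_6 L0_def by simp
    have E1: "3 * ((\<rho> + ?s) + (\<rho> + ?s)^2) + A + B * (\<rho> + ?s)^3 = ?s^2 * c2 + B * ?s^3"
      unfolding c2_def using e by algebra
    have E2: "u1 y * u2 y * (6 * (\<rho> + ?s) - 3 * A) + u1 y * v2 y * (6 + 6 * ?w * (\<rho> + ?s))
       + v1 y * u2 y * (6 + 6 * ?w^2 * (\<rho> + ?s)) + v1 y * v2 y * (6 - 3 * B * (\<rho> + ?s))
       = u1 y * (b11 * u2 y + b12 * v2 y) + v1 y * (b21 * u2 y + b22 * v2 y)
         + (?s * (6 * u1 y) * u2 y + ?s * (6 * ?w * u1 y) * v2 y + ?s * (6 * ?w^2 * v1 y) * u2 y + ?s * ((-3) * B * v1 y) * v2 y)"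
      unfolding b by algebra
    have E3: "u1 y * t1 y + v1 y * t2 y = (\<Sum>i\<in>I. (y$i)^2)"
      unfolding uv I_def by (simp add: power2_eq_square algebra_simps)
    have "cubic_family A B (fourier 1 (\<rho> + ?s) (u1 y) (v1 y) (u2 y) (v2 y)) =
       (3 * ((\<rho> + ?s) + (\<rho> + ?s)^2) + A + B * (\<rho> + ?s)^3) +
       (u1 y * u2 y * (6 * (\<rho> + ?s) - 3 * A) + u1 y * v2 y * (6 + 6 * ?w * (\<rho> + ?s))
         + v1 y * u2 y * (6 + 6 * ?w^2 * (\<rho> + ?s)) + v1 y * v2 y * (6 - 3 * B * (\<rho> + ?s))) +
       (3 * (u1 y)^2 * v1 y + 3 * ?w * (v1 y)^2 * u1 y + A * (u1 y)^3 + B * (v1 y)^3) +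
       (3 * (u2 y)^2 * v2 y + 3 * ?w^2 * (v2 y)^2 * u2 y + A * (u2 y)^3 + B * (v2 y)^3)"
      unfolding cubic_family_fourier by (simp only: power_one mult_1_left mult_1_right)
    also have "\<dots> = (\<Sum>i\<in>I. (y$i)^2) + p y + ((\<sigma> * y$5)^2 * c2 + B * (\<sigma> * y$5)^3)"
      unfolding E1 E2 t E3 [symmetric] p_def
      by (simp add: power2_eq_square power3_eq_cube algebra_simps)
    finally show ?thesis unfolding E0 .
  qed
  have lin: "linear_in I u1" "linear_in I v1" "linear_in I t1" "linear_in I t2"
    unfolding uv I_def by (intro linear_in_add linear_in_diff linear_in_cmult linear_in_nth; simp)+
  then have lin2: "linear_in I u2" "linear_in I v2"
    unfolding uv(5,6) by (intro linear_in_diff linear_in_cmult; simp)+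
  note lins = lin(1,2) lin2
  have "quadratic_in I p"
    unfolding p_def using lins [THEN linear_in_holo_germ]
    by (intro quadratic_in_add quadratic_in_mult linear_in_cmult lins holo_germ_mult holo_germ_const holo_germ_nth) auto
  from sum_of_squares_perturbation [OF this]
  obtain z where z: "\<forall>i\<in>I. holo_germ (z i) \<and> z i 0 = 0 \<and> (z i has_derivative (\<lambda>k. k $ i)) (at 0)"
     "\<forall>\<^sub>F y in nhds 0. (\<Sum>i\<in>I. (y $ i)^2) + p y = (\<Sum>i\<in>I. (z i y)^2)" by blast
  have L0_add: "L0 (x + y) = L0 x + L0 y" and L0_smult: "L0 (c *s x) = c *s L0 x" for x y c
    unfolding L0_def uv vec_eq_iff forall_6 by (simp_all add: algebra_simps)
  have L_add: "L (x + y) = L x + L y" and L_smult: "L (c *s x) = c *s L x" for x y c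
    unfolding L_def L0_add L0_smult by (simp_all add: vec_eq_iff forall_6 algebra_simps)
  \<comment> \<open>The base point lies in the trivial eigenspace with first component 1, whereas
    \<open>L\<close> has first component 0 there; Fourier inversion therefore yields
    \<open>c = 0\<close> and kills all components of \<open>h\<close>.\<close>
  have inj: "h = 0" if "L h = c *s singular_point \<xi> \<rho>" for h c
  proof -
    have eq: "u1 h + u2 h = c" "?w * u1 h + ?w^2 * u2 h = c" "?w^2 * u1 h + ?w * u2 h = c"
       "\<sigma> * h$5 + v1 h + v2 h = c * \<rho>" "\<sigma> * h$5 + ?w * v1 h + ?w^2 * v2 h = c * \<rho>"
       "\<sigma> * h$5 + ?w^2 * v1 h + ?w * v2 h = c * \<rho>"
      using that \<xi>0 unfolding L_def L0_def singular_point_eq vec_eq_iff forall_6 by (simp_all add: mult.left_commute [of c])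
    have "- c + u1 h + u2 h = 0" "- c + ?w * u1 h + ?w^2 * u2 h = 0" "- c + ?w^2 * u1 h + ?w * u2 h = 0"
      using eq(1-3) by (simp_all only: add.assoc) simp_all
    note u = discrete_fourier_injective [OF omega3_sum this]
    have "(\<sigma> * h$5 - c * \<rho>) + v1 h + v2 h = 0" "(\<sigma> * h$5 - c * \<rho>) + ?w * v1 h + ?w^2 * v2 h = 0"
      "(\<sigma> * h$5 - c * \<rho>) + ?w^2 * v1 h + ?w * v2 h = 0"
      using eq(4-6) by (simp_all only: diff_add_eq) simp_all
    note v = discrete_fourier_injective [OF omega3_sum this]
    have 0: "u1 h = 0" "u2 h = 0" "v1 h = 0" "v2 h = 0" "h$5 = 0" using u v \<sigma>0 by simp_all
    have t0: "t1 h = 0" "t2 h = 0" using t [of h] 0 by simp_all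
    have "2 * h$1 = u1 h + t1 h" "2 * h$2 = v1 h + t2 h" "2 * \<i> * h$3 = u1 h - t1 h" "2 * \<i> * h$4 = v1 h - t2 h"
      unfolding uv(1-4) by algebra+
    then have "h$1 = 0" "h$2 = 0" "h$3 = 0" "h$4 = 0" unfolding 0 t0 by simp_all
    then have "h $ i = 0" for i using 0(5) exhaust_5 [of i] by auto
    then show "h = 0" by (simp add: vec_eq_iff)
  qed
  have F: "cubic_family a b (singular_point \<xi> \<rho> + L y) =
      \<xi>^20 * ((\<Sum>i\<in>I. (y$i)^2) + p y + ((\<sigma> * y$5)^2 * c2 + B * (\<sigma> * y$5)^3))" for y
  proof -
    have "singular_point \<xi> \<rho> + L y = symmetry \<xi> (fourier 1 \<rho> 0 0 0 0 + L0 y)"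
      unfolding L_def singular_point_eq by (simp add: vec_eq_iff forall_6 algebra_simps)
    then show ?thesis
      using split [of y] by (simp add: cubic_family_symmetry [OF \<xi>] AB)
  qed
  have crit: "singularity_type_A k (cubic_family a b) (proj_point (*s) (singular_point \<xi> \<rho>))"
    if z5: "holo_germ z5" "z5 0 = 0" "(z5 has_derivative (\<lambda>k. k $ 5)) (at 0)"
      "\<forall>\<^sub>F y in nhds 0. (\<sigma> * y$5)^2 * c2 + B * (\<sigma> * y$5)^3 = z5 y ^ (k + 1)" for k and z5 :: "complex^5 \<Rightarrow> complex"
  proof (rule singularity_type_A_criterion [of "\<lambda>i :: 5. if i = 5 then z5 else z i" L _ "\<xi>^20"])
    have I5: "i \<in> I" if "i \<noteq> 5" for i using exhaust_5 [of i] that by (auto simp: I_def)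
    show "holo_germ (if i = 5 then z5 else z i)" "(if i = 5 then z5 else z i) 0 = 0"
      "((if i = 5 then z5 else z i) has_derivative (\<lambda>k. k $ i)) (at 0)" for i
      using z(1) I5 z5 by auto
    show "bounded_linear L" by (rule bounded_linear_vec_polyI [OF L_add L_smult])
    show "\<forall>\<^sub>F y in nhds 0. cubic_family a b (singular_point \<xi> \<rho> + L y) = \<xi> ^ 20 *
       (((if 1 = (5::5) then z5 else z 1) y)\<^sup>2 + ((if 2 = (5::5) then z5 else z 2) y)\<^sup>2 +
        ((if 3 = (5::5) then z5 else z 3) y)\<^sup>2 + ((if 4 = (5::5) then z5 else z 4) y)\<^sup>2 +
        (if 5 = (5::5) then z5 else z 5) y ^ (k + 1))"
      using z(2) z5(4) by eventually_elim (simp add: F I_def)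
  qed (use L_smult inj singular_point_nonzero \<xi>0 in auto)
  show ?thesis
  proof (cases "c2 = 0")
    case True
    \<comment> \<open>Here \<rho> = -1 and the binary cubic has a triple root, so a pure cube
      remains.\<close>
    then have "B * \<rho> = -1" by (simp add: c2_def; algebra)
    then have "B = 1" using e(2) by algebra
    have "singularity_type_A 2 (cubic_family a b) (proj_point (*s) (singular_point \<xi> \<rho>))"
    proof (rule crit [of "\<lambda>y. y $ 5"])
      show "((\<lambda>y :: complex^5. y $ 5) has_derivative (\<lambda>k. k $ 5)) (at 0)"
        by (rule bounded_linear_imp_has_derivative [OF bounded_linear_vec_nth])
      show "\<forall>\<^sub>F y in nhds 0. (\<sigma> * y$5)^2 * c2 + B * (\<sigma> * y$5)^3 = y $ 5 ^ (2 + 1)"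
        using True \<open>B = 1\<close> by (simp add: \<sigma>_def)
    qed (simp_all add: holo_germ_nth)
    then show ?thesis ..
  next
    case False
    then have \<sigma>2: "\<sigma>^2 * c2 = 1" by (simp add: \<sigma>_def power_inverse)
    \<comment> \<open>The factor 1 + B \<sigma>^3 y5 left beside the square of y5 is 1 at the
      origin, so its root is holomorphic and absorbs the cubic term.\<close>
    define r where "r = (\<lambda>y :: complex^5. csqrt (1 + B * \<sigma>^3 * y$5))"
    have r: "holo_germ r" unfolding r_def
      by (rule holo_germ_csqrt) (auto intro!: holo_germ_add holo_germ_mult holo_germ_const holo_germ_nth)
    have "singularity_type_A 1 (cubic_family a b) (proj_point (*s) (singular_point \<xi> \<rho>))"
    proof (rule crit [of "\<lambda>y. r y * y $ 5"])
      show "((\<lambda>y. r y * y $ 5) has_derivative (\<lambda>k. k $ 5)) (at 0)"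
        using holo_germ_mult_nth_derivative [OF r, of 5] by (simp add: r_def)
      show "\<forall>\<^sub>F y in nhds 0. (\<sigma> * y$5)^2 * c2 + B * (\<sigma> * y$5)^3 = (r y * y $ 5) ^ (1 + 1)"
      proof (rule always_eventually, rule allI)
        fix y :: "complex^5"
        have "(\<sigma> * y$5)^2 * c2 + B * (\<sigma> * y$5)^3 = (\<sigma>^2 * c2 + B * \<sigma>^3 * y$5) * (y$5)^2" by algebra
        then show "(\<sigma> * y$5)^2 * c2 + B * (\<sigma> * y$5)^3 = (r y * y $ 5) ^ (1 + 1)"
          unfolding \<sigma>2 r_def by (simp add: power_mult_distrib flip: power2_eq_square)
      qed
    qed (auto intro!: holo_germ_mult r holo_germ_nth)
    then show ?thesis ..
  qed
qed

theorem singularities_cubic_family: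
  assumes "P \<in> singular_locus (cubic_family a b)"
  shows "isolated_singularity (cubic_family a b) P \<and>
    (singularity_type_A 1 (cubic_family a b) P \<or> singularity_type_A 2 (cubic_family a b) P)"
  using isolated_singularity_of_finite [OF finite_singular_locus assms] assms
    singularity_type_singular_point
  unfolding singular_locus_cubic_family_param by blast

subsection \<open>Monomial matrices\<close>

text \<open>A diagonal matrix times a cyclic shift of the basis. Restricting the permutations to
  shifts turns products into index arithmetic modulo 6.\<close>

definition mono_mat :: "6 \<Rightarrow> (6 \<Rightarrow> complex) \<Rightarrow> complex^6^6" where
  "mono_mat k d = (\<chi> r c. if r = c + k then d r else 0)"

lemma mono_mat_mult_vec [simp]: "(mono_mat k d *v x) $ r = d r * x $ (r - k)"
proof -
  have "(mono_mat k d *v x) $ r = (\<Sum>c\<in>UNIV. if c = r - k then d r * x $ c else 0)"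
    unfolding matrix_vector_mult_def mono_mat_def
    by (simp add: algebra_simps) (intro sum.cong refl, auto)
  then show ?thesis by simp
qed

lemma mono_mat_mult: "mono_mat k d ** mono_mat l e = mono_mat (k + l) (\<lambda>r. d r * e (r - k))"
  by (simp add: matrix_eq vec_eq_iff diff_diff_eq mult.assoc flip: matrix_vector_mul_assoc)

lemma mat_eq_mono_mat: "mat c = mono_mat 0 (\<lambda>_. c)"
  by (simp add: mat_def mono_mat_def vec_eq_iff)

lemma mono_mat_eqD:
  assumes "mono_mat k d = mono_mat l e" "\<And>r. d r \<noteq> 0"
  shows "k = l" "d r = e r"
proof -
  have *: "d r = (if r = r - k + l then e r else 0)" for r
    using arg_cong [OF assms(1), of "\<lambda>M. M $ r $ (r - k)"] by (simp add: mono_mat_def)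
  then have "r = r - k + l" for r using assms(2) [of r] by metis
  then show "k = l" by (metis add.commute add_diff_cancel_left' diff_add_cancel)
  show "d r = e r" using * [of r] assms(2) [of r] by metis
qed

lemma mono_mat_inverse:
  assumes "\<And>r. d r \<noteq> 0"
  shows "mono_mat k d ** mono_mat (- k) (\<lambda>r. 1 / d (r + k)) = mat 1"
    "mono_mat (- k) (\<lambda>r. 1 / d (r + k)) ** mono_mat k d = mat 1"
  using assms by (simp_all add: mono_mat_mult mat_eq_mono_mat)

lemma invertible_mono_mat: "(\<And>r. d r \<noteq> 0) \<Longrightarrow> invertible (mono_mat k d)"
  unfolding invertible_def using mono_mat_inverse [of d k] by blast

lemma matrix_inv_unique:
  fixes A B :: "complex^'n^'n"
  assumes "A ** B = mat 1" "B ** A = mat 1"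
  shows "matrix_inv A = B"
proof -
  have "A ** matrix_inv A = mat 1 \<and> matrix_inv A ** A = mat 1"
    unfolding matrix_inv_def by (rule someI [of _ B]) (use assms in blast)
  then have "B ** (A ** matrix_inv A) = B" by simp
  then show ?thesis unfolding matrix_mul_assoc assms(2) by simp
qed

lemma matrix_inv_works:
  fixes A :: "complex^'n^'n"
  assumes "invertible A"
  shows "A ** matrix_inv A = mat 1" "matrix_inv A ** A = mat 1"
proof -
  obtain B where "A ** B = mat 1" "B ** A = mat 1" using assms unfolding invertible_def by blast
  then show "A ** matrix_inv A = mat 1" "matrix_inv A ** A = mat 1"
    using matrix_inv_unique by blast+
qed

lemma invertible_matrix_inv: "invertible A \<Longrightarrow> invertible (matrix_inv A :: complex^'n^'n)"
  using matrix_inv_works [of A] by (subst invertible_def) blast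

lemma invertible_mat_scalar: "c \<noteq> 0 \<Longrightarrow> invertible (mat c :: complex^6^6)"
  unfolding mat_eq_mono_mat by (rule invertible_mono_mat)

lemma scalar_mult_mono_mat: "mat c ** mono_mat k d = mono_mat k (\<lambda>r. c * d r)"
  by (simp add: mat_eq_mono_mat mono_mat_mult)

lemma mat_scalar_commute: "mat c ** A = A ** (mat c :: complex^6^6)"
  by (simp add: vec_eq_iff matrix_matrix_mult_def mat_def mult_delta_left mult_delta_right mult.commute)

text \<open>The shift matrix is orthogonal, so its determinant squares to 1; passing to squares
  avoids the sign of the permutation.\<close>

lemma det_mono_mat_square: "(det (mono_mat k d))^2 = (prod d UNIV)^2"
proof -
  have tr: "transpose (mono_mat k (\<lambda>_. 1)) = mono_mat (- k) (\<lambda>_. 1)"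
    by (simp add: transpose_def mono_mat_def vec_eq_iff)
  have "mono_mat k (\<lambda>_. 1) ** transpose (mono_mat k (\<lambda>_. 1)) = mat 1"
    unfolding tr by (simp add: mono_mat_mult mat_eq_mono_mat)
  from arg_cong [OF this, of det] have 1: "(det (mono_mat k (\<lambda>_. 1)))^2 = 1"
    by (simp add: det_mul power2_eq_square)
  have "det (mono_mat 0 d) = (\<Prod>i\<in>UNIV. mono_mat 0 d $ i $ i)"
    by (rule det_diagonal) (simp add: mono_mat_def)
  then have 2: "det (mono_mat 0 d) = prod d UNIV" by (simp add: mono_mat_def)
  have "mono_mat k d = mono_mat 0 d ** mono_mat k (\<lambda>_. 1)" by (simp add: mono_mat_mult)
  then show ?thesis by (simp add: det_mul power_mult_distrib 1 2)
qed

section \<open>Weights modulo seven\<close>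

lemma residues_6:
  "(0::6) = 6" "(7::6) = 1" "(8::6) = 2" "(9::6) = 3" "(10::6) = 4" "(11::6) = 5" "(12::6) = 6"
  "(-1::6) = 5" "(-2::6) = 4" "(-3::6) = 3" "(-4::6) = 2" "(-5::6) = 1" "(-6::6) = 6"
  by (simp_all add: eq_neg_iff_add_eq_0 minus_equation_iff)

text \<open>These exponents of \<open>g7\<close> are the powers 5^(r - 1) modulo 7, taken between 1
  and 6. As 5 is a primitive root, a shift of the index is a multiplication of exponents, and every
  nonzero residue occurs once.\<close>

definition wt :: "6 \<Rightarrow> nat" where
  "wt r = (if r = 1 then 1 else if r = 2 then 5 else if r = 3 then 4 else if r = 4 then 6
     else if r = 5 then 2 else 3)"

lemma wt_simps [simp]: "wt 1 = 1" "wt 2 = 5" "wt 3 = 4" "wt 4 = 6" "wt 5 = 2" "wt 6 = 3"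
  by (simp_all add: wt_def)


lemma wt_pos: "0 < wt r" "wt r < 7"
  using exhaust_6 [of r] by auto

lemma wt_inj: "wt r = wt s \<Longrightarrow> r = s"
  using exhaust_6 [of r] exhaust_6 [of s] by auto

lemma wt_surj: "0 < n \<Longrightarrow> n < 7 \<Longrightarrow> \<exists>r. wt r = n"
proof -
  assume "0 < n" "n < 7"
  then consider "n = 1" | "n = 2" | "n = 3" | "n = 4" | "n = 5" | "n = 6" by linarith
  then show ?thesis by cases (metis wt_simps)+
qed

lemma wt_shift: "wt (r + k) mod 7 = wt r * wt (1 + k) mod 7"
proof -
  have "\<forall>r k. wt (r + k) mod 7 = wt r * wt (1 + k) mod 7"
    unfolding forall_6 by (simp add: residues_6)
  then show ?thesis by blast
qed

lemma zeta7_power_7: "zeta7 ^ 7 = 1"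
proof -
  have "zeta7 ^ 7 = exp (2 * complex_of_real pi * \<i>)"
    unfolding zeta7_def exp_of_nat_mult [symmetric] by (rule arg_cong [of _ _ exp]) simp
  also have "\<dots> = 1" by (rule exp_two_pi_i)
  finally show ?thesis .
qed

lemma zeta7_nonzero [simp]: "zeta7 \<noteq> 0"
  by (simp add: zeta7_def)

lemma zeta7_power_mod: "zeta7 ^ (n mod 7) = zeta7 ^ n"
proof -
  have "zeta7 ^ n = zeta7 ^ (7 * (n div 7) + n mod 7)" by simp
  also have "\<dots> = zeta7 ^ (n mod 7)" unfolding power_add power_mult zeta7_power_7 by simp
  finally show ?thesis ..
qed

lemma zeta7_power_cong: "m mod 7 = n mod 7 \<Longrightarrow> zeta7 ^ m = zeta7 ^ n"
  by (metis zeta7_power_mod)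

lemma zeta7_power_eq_iff: "zeta7 ^ m = zeta7 ^ n \<longleftrightarrow> m mod 7 = n mod 7"
proof
  assume *: "zeta7 ^ m = zeta7 ^ n"
  have "zeta7 ^ k = exp (2 * complex_of_real pi * \<i> * complex_of_nat k / 7)" for k
    unfolding zeta7_def by (simp add: mult_ac flip: exp_of_nat_mult)
  then have "inj_on (\<lambda>k. zeta7 ^ k) {..<7}"
    using bij_betw_roots_unity [of 7] by (simp add: bij_betw_def)
  moreover have "zeta7 ^ (m mod 7) = zeta7 ^ (n mod 7)" using * by (simp add: zeta7_power_mod)
  ultimately show "m mod 7 = n mod 7" by (auto dest!: inj_onD)
qed (rule zeta7_power_cong)

lemma g7_eq: "g7 = mono_mat 0 (\<lambda>r. zeta7 ^ wt r)"
proof -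
  have "wt r = (if r = 1 then 1 else if r = 2 then 5 else if r = 3 then 4
            else if r = 4 then 6 else if r = 5 then 2 else 3)" for r
    using exhaust_6 [of r] by auto
  then show ?thesis by (simp add: g7_def mono_mat_def vec_eq_iff)
qed

lemma g3_eq: "g3 = mono_mat 2 (\<lambda>_. 1)"
  by (simp add: g3_def mono_mat_def)

subsection \<open>The groups\<close>

lemma GL6_simps [simp]:
  "carrier GL6 = {A. invertible A}" "x \<otimes>\<^bsub>GL6\<^esub> y = x ** y" "\<one>\<^bsub>GL6\<^esub> = mat 1"
  by (simp_all add: GL6_def)

lemma group_GL6: "group GL6"
proof (rule groupI)
  show "\<exists>y\<in>carrier GL6. y \<otimes>\<^bsub>GL6\<^esub> x = \<one>\<^bsub>GL6\<^esub>" if "x \<in> carrier GL6" for x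
  proof
    show "matrix_inv x \<otimes>\<^bsub>GL6\<^esub> x = \<one>\<^bsub>GL6\<^esub>" using that matrix_inv_works by simp
    show "matrix_inv x \<in> carrier GL6" using that invertible_matrix_inv by simp
  qed
qed (use invertible_mat_scalar [of 1] in \<open>auto simp: invertible_mult matrix_mul_assoc\<close>)

lemma GL6_inv: "invertible A \<Longrightarrow> inv\<^bsub>GL6\<^esub> A = matrix_inv A"
  by (rule group.inv_equality [OF group_GL6])
    (use matrix_inv_works invertible_matrix_inv in auto)

text \<open>For even \<open>k\<close> this is a power of \<open>g7\<close> times a power of
  \<open>g3\<close>. The exponent \<open>i\<close> is any natural number, so inverses are written
  with positive powers and no reduction modulo 7 is imposed.\<close>

definition F21_elem :: "nat \<Rightarrow> 6 \<Rightarrow> complex^6^6" where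
  "F21_elem i k = mono_mat k (\<lambda>r. zeta7 ^ (i * wt r))"

lemma even_residues_closed:
  "k \<in> {2, 4, 6::6} \<Longrightarrow> l \<in> {2, 4, 6} \<Longrightarrow> k + l \<in> {2, 4, 6}"
  "k \<in> {2, 4, 6::6} \<Longrightarrow> - k \<in> {2, 4, 6}"
  by (auto simp: residues_6)

lemma F21_elem_mult: "F21_elem i k ** F21_elem j l = F21_elem (i + j * wt (1 - k)) (k + l)"
proof -
  have "zeta7 ^ (i * wt r) * zeta7 ^ (j * wt (r - k)) = zeta7 ^ ((i + j * wt (1 - k)) * wt r)" for r
  proof -
    have "wt (r - k) mod 7 = wt r * wt (1 - k) mod 7" using wt_shift [of r "- k"] by simp
    then have "(i * wt r + j * wt (r - k)) mod 7 = (i * wt r + j * (wt r * wt (1 - k))) mod 7"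
      by (intro mod_add_cong mod_mult_cong refl)
    then show ?thesis unfolding power_add [symmetric]
      by (intro zeta7_power_cong) (simp add: algebra_simps)
  qed
  then show ?thesis by (simp add: F21_elem_def mono_mat_mult)
qed

lemma invertible_F21_elem: "invertible (F21_elem i k)"
  unfolding F21_elem_def by (rule invertible_mono_mat) simp

lemma g7_F21_elem: "g7 = F21_elem 1 6"
  by (simp add: g7_eq F21_elem_def residues_6)

lemma g3_F21_elem: "g3 = F21_elem 0 2"
  by (simp add: g3_eq F21_elem_def)

lemma F21_elem_0_6: "F21_elem 0 6 = mat 1"
  by (simp add: F21_elem_def mat_eq_mono_mat residues_6)

lemma F21_eq: "F21 = {F21_elem i k | i k. k \<in> {2, 4, 6}}"
proof
  show "F21 \<subseteq> {F21_elem i k | i k. k \<in> {2, 4, 6}}"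
  proof
    fix h assume "h \<in> F21"
    then have "h \<in> generate GL6 {g7, g3}" by (simp add: F21_def)
    then show "h \<in> {F21_elem i k | i k. k \<in> {2, 4, 6}}"
    proof induction
      case one
      show ?case by (rule CollectI, rule exI [of _ 0], rule exI [of _ 6]) (simp add: F21_elem_0_6)
    next
      case (incl h)
      then show ?case using g7_F21_elem g3_F21_elem by blast
    next
      case (inv h)
      have "g7 ** F21_elem 6 6 = mat 1" "F21_elem 6 6 ** g7 = mat 1"
        unfolding g7_F21_elem F21_elem_mult
        by (simp_all add: F21_elem_def residues_6 mat_eq_mono_mat power_mult zeta7_power_7)
      then have "inv\<^bsub>GL6\<^esub> g7 = F21_elem 6 6"
        using GL6_inv matrix_inv_unique invertible_F21_elem g7_F21_elem by metis
      moreover have "g3 ** F21_elem 0 4 = mat 1" "F21_elem 0 4 ** g3 = mat 1"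
        unfolding g3_F21_elem F21_elem_mult by (simp_all add: F21_elem_0_6)
      then have "inv\<^bsub>GL6\<^esub> g3 = F21_elem 0 4"
        using GL6_inv matrix_inv_unique invertible_F21_elem g3_F21_elem by metis
      ultimately show ?case using inv by blast
    next
      case (eng h1 h2)
      then obtain i k j l where "h1 = F21_elem i k" "h2 = F21_elem j l" "k \<in> {2, 4, 6}" "l \<in> {2, 4, 6}"
        by blast
      then show ?case using even_residues_closed(1) [of k l] F21_elem_mult [of i k j l] by auto
    qed
  qed
next
  have mult: "A ** B \<in> F21" if "A \<in> F21" "B \<in> F21" for A B
    using that generate.eng [of A GL6 "{g7, g3}" B] by (simp add: F21_def)
  have gens: "g7 \<in> F21" "g3 \<in> F21" unfolding F21_def by (auto intro: generate.incl)
  have one: "mat 1 \<in> F21" unfolding F21_def using generate.one [of GL6] by simp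
  have i: "F21_elem i 6 \<in> F21" for i
  proof (induction i)
    case 0
    then show ?case using one F21_elem_0_6 by simp
  next
    case (Suc i)
    have "F21_elem (Suc i) 6 = g7 ** F21_elem i 6"
      unfolding g7_F21_elem F21_elem_mult by (simp add: residues_6)
    then show ?case using mult [OF gens(1) Suc.IH] by simp
  qed
  have "F21_elem i 2 = F21_elem i 6 ** g3" "F21_elem i 4 = F21_elem i 6 ** g3 ** g3" for i
    unfolding g3_F21_elem F21_elem_mult by (simp_all add: residues_6)
  then have "F21_elem i 2 \<in> F21" "F21_elem i 4 \<in> F21" for i using mult i gens(2) by metis+
  with i show "{F21_elem i k | i k. k \<in> {2, 4, 6}} \<subseteq> F21" by auto
qed

lemma scalars6_normal: "scalars6 \<lhd> GL6"
proof -
  interpret group GL6 by (rule group_GL6)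
  have sub: "subgroup scalars6 GL6"
  proof (rule subgroupI)
    show "inv\<^bsub>GL6\<^esub> a \<in> scalars6" if a: "a \<in> scalars6" for a
    proof -
      obtain c where c: "c \<noteq> 0" "a = mat c" using a unfolding scalars6_def by blast
      have "matrix_inv (mat c) = (mat (1 / c) :: complex^6^6)"
        by (rule matrix_inv_unique) (use c(1) in \<open>simp_all add: mat_eq_mono_mat mono_mat_mult\<close>)
      then have "inv\<^bsub>GL6\<^esub> a = mat (1 / c)" using c GL6_inv [OF invertible_mat_scalar] by simp
      then show ?thesis unfolding scalars6_def using c(1) by (intro CollectI exI [of _ "1 / c"]) simp
    qed
    show "a \<otimes>\<^bsub>GL6\<^esub> b \<in> scalars6" if ab: "a \<in> scalars6" "b \<in> scalars6" for a b
    proof -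
      obtain c d where "c \<noteq> 0" "a = mat c" "d \<noteq> 0" "b = mat d" using ab unfolding scalars6_def by blast
      then show ?thesis unfolding scalars6_def
        by (intro CollectI exI [of _ "c * d"]) (simp add: mat_eq_mono_mat mono_mat_mult)
    qed
  qed (auto simp: scalars6_def invertible_mat_scalar intro: exI [of _ 1])
  show ?thesis unfolding normal_inv_iff
  proof (intro conjI ballI sub)
    fix x h assume "x \<in> carrier GL6" "h \<in> scalars6"
    then obtain c where "c \<noteq> 0" "h = mat c" "invertible x" unfolding scalars6_def by auto
    then have "x ** h ** matrix_inv x = h"
      by (metis mat_scalar_commute matrix_inv_works(1) matrix_mul_assoc matrix_mul_rid)
    then show "x \<otimes>\<^bsub>GL6\<^esub> h \<otimes>\<^bsub>GL6\<^esub> inv\<^bsub>GL6\<^esub> x \<in> scalars6"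
      using \<open>h \<in> scalars6\<close> \<open>invertible x\<close> by (simp add: GL6_inv)
  qed
qed

section \<open>The projective linear group and the normalizer\<close>

lemma group_hom_to_PGL6: "group_hom GL6 PGL6 to_PGL6"
proof -
  have "to_PGL6 = (\<lambda>a. scalars6 #>\<^bsub>GL6\<^esub> a)" by (simp add: to_PGL6_def fun_eq_iff)
  then show ?thesis
    unfolding group_hom_def group_hom_axioms_def PGL6_def
    using group_GL6 normal.factorgroup_is_group [OF scalars6_normal] normal.r_coset_hom_Mod [OF scalars6_normal]
    by simp
qed

lemma to_PGL6_eq_iff:
  "to_PGL6 A = to_PGL6 B \<longleftrightarrow> (\<exists>c. c \<noteq> 0 \<and> A = mat c ** B)"
proof
  have eq: "to_PGL6 A = {mat c ** A | c. c \<noteq> 0}" for A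
    unfolding to_PGL6_def r_coset_def scalars6_def by auto
  have "A \<in> to_PGL6 A" unfolding eq by (intro CollectI exI [of _ 1]) simp
  then show "to_PGL6 A = to_PGL6 B \<Longrightarrow> \<exists>c. c \<noteq> 0 \<and> A = mat c ** B" unfolding eq by auto
  assume "\<exists>c. c \<noteq> 0 \<and> A = mat c ** B"
  then obtain c where c: "c \<noteq> 0" "A = mat c ** B" by auto
  have "mat d ** A = mat (d * c) ** B" "mat d ** B = mat (d / c) ** A" for d
    using c by (simp_all add: matrix_mul_assoc mat_eq_mono_mat mono_mat_mult)
  moreover have "d * c \<noteq> 0" "d / c \<noteq> 0" if "d \<noteq> 0" for d using that c(1) by simp_all
  ultimately show "to_PGL6 A = to_PGL6 B" unfolding eq by blast
qed


lemma image_to_PGL6_subset: "to_PGL6 ` F21 \<subseteq> carrier PGL6"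
proof -
  interpret group_hom GL6 PGL6 to_PGL6 by (rule group_hom_to_PGL6)
  show ?thesis using invertible_F21_elem unfolding F21_eq by (auto simp del: GL6_simps(2,3))
qed

lemma to_PGL6_normalizer_iff:
  assumes "invertible A"
  shows "to_PGL6 A \<in> normalizer PGL6 (to_PGL6 ` F21) \<longleftrightarrow>
    (\<lambda>g. to_PGL6 (A ** g ** matrix_inv A)) ` F21 = to_PGL6 ` F21"
proof -
  interpret h: group_hom GL6 PGL6 to_PGL6 by (rule group_hom_to_PGL6)
  have inv: "g \<in> F21 \<Longrightarrow> invertible g" for g using invertible_F21_elem unfolding F21_eq by auto
  have A: "to_PGL6 A \<in> carrier PGL6" using h.hom_closed [of A] assms by simp
  have "to_PGL6 A <#\<^bsub>PGL6\<^esub> (to_PGL6 ` F21) #>\<^bsub>PGL6\<^esub> inv\<^bsub>PGL6\<^esub> to_PGL6 A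
      = (\<lambda>g. to_PGL6 A \<otimes>\<^bsub>PGL6\<^esub> to_PGL6 g \<otimes>\<^bsub>PGL6\<^esub> inv\<^bsub>PGL6\<^esub> to_PGL6 A) ` F21"
    unfolding l_coset_def r_coset_def by auto
  also have "\<dots> = (\<lambda>g. to_PGL6 (A ** g ** matrix_inv A)) ` F21"
  proof (rule image_cong [OF refl])
    fix g assume "g \<in> F21"
    then have "invertible g" by (rule inv)
    then show "to_PGL6 A \<otimes>\<^bsub>PGL6\<^esub> to_PGL6 g \<otimes>\<^bsub>PGL6\<^esub> inv\<^bsub>PGL6\<^esub> to_PGL6 A = to_PGL6 (A ** g ** matrix_inv A)"
      using h.hom_mult [of A g] h.hom_mult [of "A ** g" "matrix_inv A"] h.hom_inv [of A] assms
      by (simp add: invertible_mult invertible_matrix_inv GL6_inv)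
  qed
  finally show ?thesis
    using A image_to_PGL6_subset unfolding normalizer_def stabilizer_def by simp
qed

lemma SL6_normalizer_mult:
  assumes "A \<in> SL6_normalizer" "B \<in> SL6_normalizer"
  shows "A ** B \<in> SL6_normalizer"
proof -
  interpret h: group_hom GL6 PGL6 to_PGL6 by (rule group_hom_to_PGL6)
  have inv: "invertible A" "invertible B"
    using assms by (auto simp: SL6_normalizer_def invertible_det_nz)
  have "subgroup (normalizer PGL6 (to_PGL6 ` F21)) PGL6"
    by (rule h.H.normalizer_imp_subgroup [OF image_to_PGL6_subset])
  then have "to_PGL6 A \<otimes>\<^bsub>PGL6\<^esub> to_PGL6 B \<in> normalizer PGL6 (to_PGL6 ` F21)"
    using assms by (intro subgroup.m_closed) (auto simp: SL6_normalizer_def)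
  then show ?thesis
    using assms h.hom_mult [of A B] inv by (simp add: SL6_normalizer_def det_mul)
qed

lemma SL6_normalizer_inv:
  assumes "A \<in> SL6_normalizer"
  shows "matrix_inv A \<in> SL6_normalizer"
proof -
  interpret h: group_hom GL6 PGL6 to_PGL6 by (rule group_hom_to_PGL6)
  have inv: "invertible A"
    using assms by (auto simp: SL6_normalizer_def invertible_det_nz)
  have "subgroup (normalizer PGL6 (to_PGL6 ` F21)) PGL6"
    by (rule h.H.normalizer_imp_subgroup [OF image_to_PGL6_subset])
  then have "inv\<^bsub>PGL6\<^esub> to_PGL6 A \<in> normalizer PGL6 (to_PGL6 ` F21)"
    using assms by (intro subgroup.m_inv_closed) (auto simp: SL6_normalizer_def)
  moreover have "inv\<^bsub>PGL6\<^esub> to_PGL6 A = to_PGL6 (matrix_inv A)"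
    using h.hom_inv [of A] inv by (simp add: GL6_inv)
  moreover have "det A * det (matrix_inv A) = 1"
    using matrix_inv_works(1) [OF inv] by (metis det_I det_mul)
  ultimately show ?thesis using assms by (simp add: SL6_normalizer_def)
qed

lemma SL6_normalizer_conjugate:
  assumes "A \<in> SL6_normalizer" "g \<in> F21"
  shows "\<exists>c h. c \<noteq> 0 \<and> h \<in> F21 \<and> A ** g = mat c ** h ** A"
proof -
  have inv: "invertible A"
    using assms by (auto simp: SL6_normalizer_def invertible_det_nz)
  have "to_PGL6 (A ** g ** matrix_inv A) \<in> to_PGL6 ` F21"
    using assms to_PGL6_normalizer_iff [OF inv] by (auto simp: SL6_normalizer_def)
  then obtain h where h: "h \<in> F21" "to_PGL6 (A ** g ** matrix_inv A) = to_PGL6 h" by blast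
  then obtain c where c: "c \<noteq> 0" "A ** g ** matrix_inv A = mat c ** h"
    using to_PGL6_eq_iff by blast
  have "A ** g = (A ** g ** matrix_inv A) ** A"
    using matrix_inv_works(2) [OF inv] by (simp flip: matrix_mul_assoc)
  with c h show ?thesis by auto
qed

text \<open>The normalizer asks for equality with the conjugate, not only for inclusion, hence the
  two conditions in opposite directions.\<close>

lemma SL6_normalizerI:
  assumes "det A = 1"
    and "\<And>g. g \<in> F21 \<Longrightarrow> \<exists>c h. c \<noteq> 0 \<and> h \<in> F21 \<and> A ** g = mat c ** h ** A"
    and "\<And>h. h \<in> F21 \<Longrightarrow> \<exists>c g. c \<noteq> 0 \<and> g \<in> F21 \<and> A ** g = mat c ** h ** A"
  shows "A \<in> SL6_normalizer"
proof -
  have inv: "invertible A" using assms(1) by (simp add: invertible_det_nz)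
  have conj: "to_PGL6 (A ** g ** matrix_inv A) = to_PGL6 h" if c: "c \<noteq> 0" "A ** g = mat c ** h ** A" for c g h
  proof -
    have "A ** g ** matrix_inv A = mat c ** h"
      using c(2) matrix_inv_works(1) [OF inv] by (simp flip: matrix_mul_assoc)
    then show ?thesis using c(1) to_PGL6_eq_iff by blast
  qed
  have "(\<lambda>g. to_PGL6 (A ** g ** matrix_inv A)) ` F21 = to_PGL6 ` F21"
  proof (intro equalityI subsetI)
    fix y assume "y \<in> (\<lambda>g. to_PGL6 (A ** g ** matrix_inv A)) ` F21"
    then obtain g where "g \<in> F21" "y = to_PGL6 (A ** g ** matrix_inv A)" by blast
    then show "y \<in> to_PGL6 ` F21" using assms(2) [of g] conj by blast
  next
    fix y assume "y \<in> to_PGL6 ` F21"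
    then obtain h where h: "h \<in> F21" "y = to_PGL6 h" by blast
    then obtain c g where "c \<noteq> 0" "g \<in> F21" "A ** g = mat c ** h ** A" using assms(3) by blast
    then show "y \<in> (\<lambda>g. to_PGL6 (A ** g ** matrix_inv A)) ` F21"
      using conj h by (intro image_eqI [of _ _ g]) auto
  qed
  then show ?thesis
    using assms(1) to_PGL6_normalizer_iff [OF inv] by (simp add: SL6_normalizer_def)
qed

lemma mono_mat_mult_nth: "(mono_mat k d ** A) $ r $ s = d r * A $ (r - k) $ s"
proof -
  have "(mono_mat k d ** A) $ r $ s = (\<Sum>j\<in>UNIV. if j = r - k then d r * A $ j $ s else 0)"
    unfolding matrix_matrix_mult_def mono_mat_def
    by (simp add: algebra_simps) (intro sum.cong refl, auto)
  then show ?thesis by simp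
qed

lemma mult_mono_mat_nth: "(A ** mono_mat k d) $ r $ s = A $ r $ (s + k) * d (s + k)"
  by (simp add: matrix_matrix_mult_def mono_mat_def mult_delta_right)

text \<open>Conjugation by the shift multiplies the exponent of \<open>g7\<close> by a unit modulo
  7, so the conjugates fill the whole group. The hypothesis on \<open>d\<close> makes the diagonal
  part commute with the even shifts up to a scalar.\<close>

lemma mono_mat_in_normalizer:
  assumes det: "det (mono_mat k d) = 1"
    and d: "\<And>l. l \<in> {2, 4, 6} \<Longrightarrow> \<exists>c. c \<noteq> 0 \<and> (\<forall>r. d r = c * d (r - l))"
  shows "mono_mat k d \<in> SL6_normalizer"
proof -
  have conj: "\<exists>c. c \<noteq> 0 \<and> mono_mat k d ** F21_elem i l = mat c ** F21_elem j l ** mono_mat k d"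
    if l: "l \<in> {2, 4, 6}" and ij: "j mod 7 = i * wt (1 - k) mod 7" for i j l
  proof -
    obtain c where c: "c \<noteq> 0" "\<And>r. d r = c * d (r - l)" using d [OF l] by metis
    have "zeta7 ^ (i * wt (r - k)) = zeta7 ^ (j * wt r)" for r
    proof (rule zeta7_power_cong)
      have "wt (r - k) mod 7 = wt r * wt (1 - k) mod 7" using wt_shift [of r "- k"] by simp
      then have "i * wt (r - k) mod 7 = i * (wt r * wt (1 - k)) mod 7"
        by (intro mod_mult_cong refl)
      also have "\<dots> = (i * wt (1 - k)) * wt r mod 7" by (simp add: mult_ac)
      also have "\<dots> = j * wt r mod 7" using ij by (intro mod_mult_cong refl) simp
      finally show "i * wt (r - k) mod 7 = j * wt r mod 7" .
    qed
    then have "d r * zeta7 ^ (i * wt (r - k)) = c * zeta7 ^ (j * wt r) * d (r - l)" for r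
      using c(2) [of r] by simp
    then have "mono_mat k d ** F21_elem i l = mat c ** F21_elem j l ** mono_mat k d"
      unfolding F21_elem_def scalar_mult_mono_mat mono_mat_mult add.commute [of k l] by presburger
    with c(1) show ?thesis by blast
  qed
  show ?thesis
  proof (rule SL6_normalizerI [OF det])
    fix g assume "g \<in> F21"
    then obtain i l where g: "g = F21_elem i l" "l \<in> {2, 4, 6}" unfolding F21_eq by blast
    then show "\<exists>c h. c \<noteq> 0 \<and> h \<in> F21 \<and> mono_mat k d ** g = mat c ** h ** mono_mat k d"
      using conj [OF g(2), of "i * wt (1 - k)" i] unfolding F21_eq by blast
  next
    fix h assume "h \<in> F21"
    then obtain j l where h: "h = F21_elem j l" "l \<in> {2, 4, 6}" unfolding F21_eq by blast
    have "wt (1 + k) * wt (1 - k) mod 7 = 1"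
      using wt_shift [of "1 + k" "- k"] by simp
    then have "j * (wt (1 + k) * wt (1 - k)) mod 7 = j * 1 mod 7"
      by (intro mod_mult_cong refl) simp
    then have "j mod 7 = (j * wt (1 + k)) * wt (1 - k) mod 7" by (simp add: mult_ac)
    then show "\<exists>c g. c \<noteq> 0 \<and> g \<in> F21 \<and> mono_mat k d ** g = mat c ** h ** mono_mat k d"
      using conj [OF h(2)] h unfolding F21_eq by blast
  qed
qed

lemma more_residues_6: "(13::6) = 1" "(14::6) = 2" "(15::6) = 3" "(26::6) = 2"
  by simp_all

text \<open>For \<open>i\<close> prime to 7 the map taking v to m + i v has exactly one zero modulo
  7; being at no nonzero residue, it is at v = 0.\<close>

lemma multiplier_lemma:
  fixes m i :: nat
  assumes "\<And>v. v \<in> {1..6} \<Longrightarrow> (m + i * v) mod 7 \<noteq> 0" "i mod 7 \<noteq> 0"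
  shows "m mod 7 = 0"
proof -
  have "(m mod 7 + (i mod 7) * v) mod 7 \<noteq> 0" if "v \<in> {1..6}" for v
    using assms(1) [OF that] by (metis mod_add_left_eq mod_add_right_eq mod_mult_left_eq)
  then have *: "(m mod 7 + (i mod 7) * 1) mod 7 \<noteq> 0" "(m mod 7 + (i mod 7) * 2) mod 7 \<noteq> 0"
    "(m mod 7 + (i mod 7) * 3) mod 7 \<noteq> 0" "(m mod 7 + (i mod 7) * 4) mod 7 \<noteq> 0"
    "(m mod 7 + (i mod 7) * 5) mod 7 \<noteq> 0" "(m mod 7 + (i mod 7) * 6) mod 7 \<noteq> 0" by force+
  have "m mod 7 \<in> {0..<7}" "i mod 7 \<in> {1..<7}" using assms(2) by auto
  then have "m mod 7 \<in> {0,1,2,3,4,5,6}" "i mod 7 \<in> {1,2,3,4,5,6}" by auto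
  then show ?thesis using * by (elim insertE emptyE) simp_all
qed

text \<open>The hypothesis holds when \<open>A\<close> intertwines two diagonal matrices; it relates
  the exponents at nonzero entries by an affine map modulo 7. As no row of \<open>A\<close> is zero,
  this map sends nonzero residues to nonzero ones and has no constant term; and a multiplication of
  exponents is a shift of indices.\<close>

lemma zeta7_relation_monomial:
  fixes A :: "complex^6^6"
  assumes det: "det A \<noteq> 0" and entry: "\<And>r s. A $ r $ s \<noteq> 0 \<Longrightarrow> zeta7 ^ wt s = c * zeta7 ^ (i * wt r)"
  shows "\<exists>n. \<forall>r s. A $ r $ s \<noteq> 0 \<longrightarrow> s = r + n"
proof -
  have row: "\<exists>s. A $ r $ s \<noteq> 0" for r
  proof (rule ccontr)
    assume "\<nexists>s. A $ r $ s \<noteq> 0"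
    then have "row r A = 0" by (simp add: row_def vec_eq_iff)
    then show False using det det_zero_row(2) by blast
  qed
  have col: "\<exists>r. A $ r $ s \<noteq> 0" for s
  proof (rule ccontr)
    assume "\<nexists>r. A $ r $ s \<noteq> 0"
    then have "column s A = 0" by (simp add: column_def vec_eq_iff)
    then show False using det det_zero_column(2) by blast
  qed
  obtain r1 where r1: "A $ r1 $ 1 \<noteq> 0" using col by blast
  \<comment> \<open>The factor 6 takes the place of -1 modulo 7: \<open>c\<close> is the power of
    \<open>zeta7\<close> with exponent \<open>1 - i * wt r1\<close>.\<close>
  define m where "m = 1 + i * wt r1 * 6"
  have "zeta7 ^ m = zeta7 ^ 1 * zeta7 ^ (i * wt r1 * 6)" by (simp add: m_def)
  also have "zeta7 ^ 1 = c * zeta7 ^ (i * wt r1)" using entry [OF r1] by simp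
  also have "c * zeta7 ^ (i * wt r1) * zeta7 ^ (i * wt r1 * 6) = c * zeta7 ^ (7 * (i * wt r1))"
    by (simp add: mult.assoc flip: power_add)
  also have "\<dots> = c" unfolding power_mult zeta7_power_7 by simp
  finally have c: "c = zeta7 ^ m" ..
  have entry': "wt s = (m + i * wt r) mod 7" if "A $ r $ s \<noteq> 0" for r s
    using entry [OF that] wt_pos [of s] unfolding c power_add [symmetric] zeta7_power_eq_iff by simp
  have "(m + i * v) mod 7 \<noteq> 0" if v: "v \<in> {1..6}" for v
  proof -
    obtain r where "wt r = v" using wt_surj [of v] v by auto
    then show ?thesis using row [of r] entry' [of r] wt_pos by (metis less_numeral_extra(3))
  qed
  \<comment> \<open>Otherwise columns 1 and 2, both nonzero, would carry the same exponent.\<close>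
  moreover have "i mod 7 \<noteq> 0"
  proof
    assume "i mod 7 = 0"
    then have "(m + i * wt r) mod 7 = m mod 7" for r by (simp add: mod_simps flip: mod_add_right_eq mod_mult_left_eq)
    then have "wt 1 = wt 2" using col [of 1] col [of 2] entry' by metis
    then show False by simp
  qed
  ultimately have m0: "m mod 7 = 0" by (rule multiplier_lemma)
  have entry'': "wt s = i * wt r mod 7" if "A $ r $ s \<noteq> 0" for r s
    using entry' [OF that] m0 by (metis add_0 mod_add_left_eq)
  obtain n where n: "A $ 1 $ (1 + n) \<noteq> 0" using row [of 1] by (metis add_diff_cancel_left' diff_add_cancel add.commute)
  have "s = r + n" if rs: "A $ r $ s \<noteq> 0" for r s
  proof -
    have "wt (r + n) mod 7 = wt r * wt (1 + n) mod 7" by (rule wt_shift)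
    also have "\<dots> = wt r * (i * wt 1 mod 7) mod 7" using entry'' [OF n] by simp
    also have "\<dots> = i * wt r mod 7" by (simp add: mod_simps mult.commute)
    finally have "wt s = wt (r + n)" using entry'' [OF rs] wt_pos [of "r + n"] by simp
    then show ?thesis by (rule wt_inj)
  qed
  then show ?thesis by blast
qed

text \<open>An element of order three of the image of \<open>F21\<close> is not conjugate to the image of \<open>g7\<close>, since
  its cube is scalar; so conjugation maps \<open>g7\<close> to a multiple of a power of \<open>g7\<close> and permutes its
  eigenspaces.\<close>

lemma SL6_normalizer_monomial:
  assumes A: "A \<in> SL6_normalizer"
  obtains k d c i where "A = mono_mat k d" "\<And>r. d r \<noteq> 0" "(prod d UNIV)^2 = 1"
    "\<And>r. d r = c * zeta7 ^ (i * wt r) * d (r - 2)"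
proof -
  have detA: "det A = 1" using A by (simp add: SL6_normalizer_def)
  have gens: "g7 \<in> F21" "g3 \<in> F21" unfolding F21_def by (auto intro: generate.incl)
  obtain c h where "c \<noteq> 0" "h \<in> F21" and ch: "A ** g7 = mat c ** h ** A"
    using SL6_normalizer_conjugate [OF A gens(1)] by blast
  then obtain i k where k: "k \<in> {2, 4, 6}" and h: "h = F21_elem i k" unfolding F21_eq by blast
  define H where "H = mono_mat k (\<lambda>r. c * zeta7 ^ (i * wt r))"
  have AH: "A ** g7 = H ** A" unfolding ch h H_def F21_elem_def scalar_mult_mono_mat ..
  have k6: "k = 6"
  proof (rule ccontr)
    assume "k \<noteq> 6"
    then have k': "k = 2 \<or> k = 4" using k by auto
    have "A ** (g7 ** g7 ** g7) = H ** H ** H ** A"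
      by (metis AH matrix_mul_assoc)
    moreover have "H ** H ** H = mat (c^3)"
    proof -
      have "zeta7 ^ (i * wt r) * zeta7 ^ (i * wt (r - k)) * zeta7 ^ (i * wt (r - (k + k))) = 1" for r
      proof -
        \<comment> \<open>The exponents along the two orbits of the shift by 2 are 1, 4, 2 and 5, 6,
          3, with sums 7 and 14.\<close>
        have "(wt r + wt (r - k) + wt (r - (k + k))) mod 7 = 0"
          using exhaust_6 [of r] k' by (auto simp: residues_6 more_residues_6)
        then have "7 dvd i * (wt r + wt (r - k) + wt (r - (k + k)))" by (simp add: mod_eq_0_iff_dvd)
        then have "zeta7 ^ (i * (wt r + wt (r - k) + wt (r - (k + k)))) = zeta7 ^ 0"
          by (intro zeta7_power_cong) (simp add: mod_eq_0_iff_dvd)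
        then show ?thesis by (simp add: distrib_left flip: power_add)
      qed
      then have "c * zeta7 ^ (i * wt r) * (c * zeta7 ^ (i * wt (r - k))) * (c * zeta7 ^ (i * wt (r - (k + k)))) = c^3" for r
        by (metis (no_types, lifting) mult.assoc mult.left_commute mult.right_neutral power3_eq_cube)
      moreover have "k + k + k = 0" using k' by (auto simp: residues_6)
      ultimately show ?thesis unfolding H_def mono_mat_mult mat_eq_mono_mat by simp
    qed
    ultimately have "A ** (g7 ** g7 ** g7) = A ** mat (c^3)" by (simp add: mat_scalar_commute)
    then have "matrix_inv A ** (A ** (g7 ** g7 ** g7)) = matrix_inv A ** (A ** mat (c^3))" by simp
    then have "g7 ** g7 ** g7 = mat (c^3)"
      unfolding matrix_mul_assoc using matrix_inv_works(2) [of A] detA by (simp add: invertible_det_nz)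
    then have *: "mono_mat 0 (\<lambda>r. zeta7 ^ wt r * zeta7 ^ wt r * zeta7 ^ wt r) = mono_mat 0 (\<lambda>_. c^3)"
      by (simp add: g7_eq mono_mat_mult mat_eq_mono_mat)
    have "zeta7 ^ wt r * zeta7 ^ wt r * zeta7 ^ wt r = c^3" for r
      using mono_mat_eqD(2) [OF *] by simp
    \<comment> \<open>Exponents 3 and 15 differ modulo 7, so the cube of \<open>g7\<close> is not
      scalar.\<close>
    from this [of 1] this [of 2] have "zeta7 ^ 1 * zeta7 ^ 1 * zeta7 ^ 1 = zeta7 ^ 5 * zeta7 ^ 5 * zeta7 ^ 5"
      unfolding wt_simps by (rule trans [OF _ sym])
    then show False unfolding power_add [symmetric] zeta7_power_eq_iff by simp
  qed
  have entry: "zeta7 ^ wt s = c * zeta7 ^ (i * wt r)" if "A $ r $ s \<noteq> 0" for r s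
  proof -
    have "(A ** g7) $ r $ s = A $ r $ s * zeta7 ^ wt s"
      unfolding g7_eq mult_mono_mat_nth by simp
    moreover have "H = mono_mat 0 (\<lambda>r. c * zeta7 ^ (i * wt r))"
      unfolding H_def k6 by (simp add: residues_6)
    then have "(H ** A) $ r $ s = c * zeta7 ^ (i * wt r) * A $ r $ s"
      by (simp add: mono_mat_mult_nth)
    ultimately show ?thesis using AH that by simp
  qed
  obtain n where n: "\<And>r s. A $ r $ s \<noteq> 0 \<Longrightarrow> s = r + n"
    using zeta7_relation_monomial [of A c i] entry detA by auto
  define d where "d = (\<lambda>r. A $ r $ (r + n))"
  have Ad: "A = mono_mat (- n) d"
  proof -
    have "A $ r $ s = (if r = s + - n then d r else 0)" for r s
    proof -
      have "r = s + - n \<longleftrightarrow> r + n = s" by (simp add: eq_diff_eq)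
      then show ?thesis using n [of r s] unfolding d_def by metis
    qed
    then show ?thesis by (simp add: mono_mat_def vec_eq_iff)
  qed
  have "(prod d UNIV)^2 = 1" using det_mono_mat_square [of "- n" d] Ad detA by simp
  moreover from this have d0: "d r \<noteq> 0" for r by (metis finite prod_zero UNIV_I zero_neq_one zero_power2)
  \<comment> \<open>The conjugate of \<open>g3\<close> has to shift by the same amount, so
    \<open>l = 2\<close>; comparing entries then gives the recursion for \<open>d\<close> in the
    conclusion.\<close>
  obtain c' h' where "c' \<noteq> 0" "h' \<in> F21" and ch': "A ** g3 = mat c' ** h' ** A"
    using SL6_normalizer_conjugate [OF A gens(2)] by blast
  then obtain j l where h': "h' = F21_elem j l" unfolding F21_eq by blast
  have *: "mono_mat (- n + 2) (\<lambda>r. d r * 1) = mono_mat (l + - n) (\<lambda>r. c' * zeta7 ^ (j * wt r) * d (r - l))"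
    using ch' unfolding h' F21_elem_def Ad g3_eq scalar_mult_mono_mat mono_mat_mult .
  have "l = 2" using mono_mat_eqD(1) [OF *] d0 by simp
  moreover have "d r = c' * zeta7 ^ (j * wt r) * d (r - l)" for r using mono_mat_eqD(2) [OF *, of r] d0 by simp
  ultimately show thesis using that [of "- n" d c' j] Ad d0 \<open>(prod d UNIV)^2 = 1\<close> by blast
qed


subsection \<open>The action on the invariant cubic forms\<close>

definition form :: "complex^4 \<Rightarrow> complex^6 \<Rightarrow> complex" where
  "form c x = c$1 * ((x$1)^2 * x$2 + (x$3)^2 * x$4 + (x$5)^2 * x$6)
     + c$2 * ((x$2)^2 * x$3 + (x$4)^2 * x$5 + (x$6)^2 * x$1)
     + c$3 * (x$1 * x$3 * x$5) + c$4 * (x$2 * x$4 * x$6)"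

definition vec4 :: "complex \<Rightarrow> complex \<Rightarrow> complex \<Rightarrow> complex \<Rightarrow> complex^4" where
  "vec4 a b c d = (\<chi> i. if i = 1 then a else if i = 2 then b else if i = 3 then c else d)"

lemma vec4_nth [simp]: "vec4 a b c d $ 1 = a" "vec4 a b c d $ 2 = b" "vec4 a b c d $ 3 = c" "vec4 a b c d $ 4 = d"
  by (simp_all add: vec4_def)

lemma vec4_eta: "vec4 (c$1) (c$2) (c$3) (c$4) = c"
  by (simp add: vec_eq_iff forall_4)

text \<open>Relations between the factors by which a normalizing monomial matrix scales the four
  coefficients; the invariance of \<open>inv_I\<close>, \<open>inv_J\<close>, \<open>inv_K\<close>
  and \<open>inv_L\<close> rests on them.\<close>

definition torus_relations :: "complex \<Rightarrow> complex \<Rightarrow> complex \<Rightarrow> complex \<Rightarrow> bool" where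
  "torus_relations \<alpha> \<beta> \<gamma> \<delta> \<longleftrightarrow>
     \<alpha>^3 * \<delta> = 1 \<and> \<beta>^3 * \<gamma> = 1 \<and> (\<gamma> * \<delta>)^2 = 1 \<and> (\<alpha> * \<beta>)^3 = \<gamma> * \<delta>"

text \<open>The recursion expresses the odd entries through \<open>d1\<close> and the even ones
  through \<open>d2\<close>; closing the odd cycle gives c^3 = 1. With z^7 = 1 the determinant
  condition becomes z d1^6 d2^6 = 1, and the relations follow by comparing monomials.\<close>

lemma normalizer_relations:
  fixes d1 d2 d3 d4 d5 d6 c z :: complex
  assumes z: "z^7 = 1" and nz: "d1 \<noteq> 0" "d2 \<noteq> 0"
    and d: "d3 = c * z^4 * d1" "d5 = c * z^2 * d3" "d1 = c * z * d5" "d4 = c * z^6 * d2" "d6 = c * z^3 * d4"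
    and det: "(d1 * d2 * d3 * d4 * d5 * d6)^2 = 1"
  shows "d3^2 * d4 = d1^2 * d2" "d5^2 * d6 = d1^2 * d2" "d4^2 * d5 = d2^2 * d3" "d6^2 * d1 = d2^2 * d3"
    "torus_relations (d1^2 * d2) (d2^2 * d3) (d1 * d3 * d5) (d2 * d4 * d6)"
proof -
  have d5: "d5 = c^2 * z^6 * d1" using d(1,2) by algebra
  have d6: "d6 = c^2 * z^2 * d2"
  proof -
    have "d6 = c^2 * (z^7 * z^2) * d2" unfolding d(5) unfolding d(4) by algebra
    then show ?thesis unfolding z by simp
  qed
  have "d1 * 1 = d1 * (c^3 * z^7)" using d(3) d5 by algebra
  then have c3: "c^3 = 1" using nz(1) unfolding z by (simp only: mult_cancel_left) simp
  note r = d(1,4) d5 d6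
  have "d3^2 * d4 = c^3 * (z^7)^2 * (d1^2 * d2)" "d5^2 * d6 = (c^3)^2 * (z^7)^2 * (d1^2 * d2)"
    "d4^2 * d5 = c^3 * (z^7)^2 * (d2^2 * (c * z^4 * d1))" "d6^2 * d1 = c^3 * (d2^2 * (c * z^4 * d1))"
    unfolding r by algebra+
  then show "d3^2 * d4 = d1^2 * d2" "d5^2 * d6 = d1^2 * d2" "d4^2 * d5 = d2^2 * d3" "d6^2 * d1 = d2^2 * d3"
    unfolding z c3 r(1) by simp_all
  have g: "d1 * d3 * d5 = z^3 * d1^3" "d2 * d4 * d6 = z * d2^3"
  proof -
    have "d1 * d3 * d5 = c^3 * z^7 * (z^3 * d1^3)" "d2 * d4 * d6 = c^3 * z^7 * (z * d2^3)"
      unfolding r by algebra+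
    then show "d1 * d3 * d5 = z^3 * d1^3" "d2 * d4 * d6 = z * d2^3" unfolding z c3 by simp_all
  qed
  have "d1 * d2 * d3 * d4 * d5 * d6 = (d1 * d3 * d5) * (d2 * d4 * d6)" by algebra
  then have det2: "(z^4 * d1^3 * d2^3)^2 = 1" using det unfolding g by algebra
  then have det3: "z * d1^6 * d2^6 = 1"
  proof -
    have "(z^4 * d1^3 * d2^3)^2 = z^7 * (z * d1^6 * d2^6)" by algebra
    then show ?thesis using det2 unfolding z by simp
  qed
  have e1: "(d1^2 * d2)^3 * (z * d2^3) = z * d1^6 * d2^6" by algebra
  have e2: "(d2^2 * d3)^3 * (z^3 * d1^3) = c^3 * (z^7)^2 * (z * d1^6 * d2^6)" unfolding d(1) by algebra
  have e4: "(d1^2 * d2 * (d2^2 * d3))^3 = c^3 * z^7 * (z * d1^6 * d2^6) * (z^4 * d1^3 * d2^3)" unfolding d(1) by algebra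
  have e5: "z^3 * d1^3 * (z * d2^3) = z^4 * d1^3 * d2^3" by algebra
  show "torus_relations (d1^2 * d2) (d2^2 * d3) (d1 * d3 * d5) (d2 * d4 * d6)"
    unfolding torus_relations_def g e1 e2 e4 e5 det2 det3 z c3 by simp
qed

text \<open>The hypotheses say that the three monomials of each cyclic sum are scaled alike. An even
  shift permutes them, an odd one exchanges the two sums and the two products.\<close>

lemma form_mono_mat:
  assumes "(d 3)^2 * d 4 = (d 1)^2 * d 2" "(d 5)^2 * d 6 = (d 1)^2 * d 2"
    "(d 4)^2 * d 5 = (d 2)^2 * d 3" "(d 6)^2 * d 1 = (d 2)^2 * d 3"
  shows "(\<forall>c. (\<lambda>x. form c (mono_mat k d *v x)) =
       form (vec4 ((d 1)^2 * d 2 * c$1) ((d 2)^2 * d 3 * c$2) (d 1 * d 3 * d 5 * c$3) (d 2 * d 4 * d 6 * c$4))) \<or>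
    (\<forall>c. (\<lambda>x. form c (mono_mat k d *v x)) =
       form (vec4 ((d 2)^2 * d 3 * c$2) ((d 1)^2 * d 2 * c$1) (d 2 * d 4 * d 6 * c$4) (d 1 * d 3 * d 5 * c$3)))"
proof -
  define y where "y = (\<lambda>x :: complex^6. \<chi> r. x $ (r - k))"
  have "form c (mono_mat k d *v x) =
     c$1 * ((d 1)^2 * d 2 * (y x$1)^2 * y x$2 + (d 3)^2 * d 4 * (y x$3)^2 * y x$4 + (d 5)^2 * d 6 * (y x$5)^2 * y x$6)
     + c$2 * ((d 2)^2 * d 3 * (y x$2)^2 * y x$3 + (d 4)^2 * d 5 * (y x$4)^2 * y x$5 + (d 6)^2 * d 1 * (y x$6)^2 * y x$1)
     + c$3 * (d 1 * d 3 * d 5 * y x$1 * y x$3 * y x$5) + c$4 * (d 2 * d 4 * d 6 * y x$2 * y x$4 * y x$6)" for c x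
    unfolding form_def y_def by (simp add: power_mult_distrib mult_ac)
  then have *: "form c (mono_mat k d *v x) =
      form (vec4 ((d 1)^2 * d 2 * c$1) ((d 2)^2 * d 3 * c$2) (d 1 * d 3 * d 5 * c$3) (d 2 * d 4 * d 6 * c$4)) (y x)" for c x
    unfolding assms form_def by (simp add: algebra_simps)
  have "(\<forall>c x. form c (y x) = form c x) \<or> (\<forall>c x. form c (y x) = form (vec4 (c$2) (c$1) (c$4) (c$3)) x)"
    using exhaust_6 [of k]
    by (elim disjE) (simp_all add: form_def y_def residues_6 more_residues_6 algebra_simps)
  then show ?thesis unfolding fun_eq_iff * by (elim disjE) simp_all
qed

lemma form_action_normalizer:
  assumes "A \<in> SL6_normalizer"
  obtains \<alpha> \<beta> \<gamma> \<delta> where "torus_relations \<alpha> \<beta> \<gamma> \<delta>"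
    "(\<forall>c. form_action A (form c) = form (vec4 (\<alpha> * c$1) (\<beta> * c$2) (\<gamma> * c$3) (\<delta> * c$4))) \<or>
     (\<forall>c. form_action A (form c) = form (vec4 (\<beta> * c$2) (\<alpha> * c$1) (\<delta> * c$4) (\<gamma> * c$3)))"
proof -
  obtain k d c i where B: "matrix_inv A = mono_mat k d" "\<And>r. d r \<noteq> 0" "(prod d UNIV)^2 = 1"
    "\<And>r. d r = c * zeta7 ^ (i * wt r) * d (r - 2)"
    using SL6_normalizer_monomial [OF SL6_normalizer_inv [OF assms]] by metis
  define z where "z = zeta7 ^ i"
  have z7: "z^7 = 1" unfolding z_def by (metis mult.commute power_mult power_one zeta7_power_7)
  have zz: "zeta7 ^ (i * n) = z ^ n" for n by (simp add: z_def power_mult)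
  have idx: "(1::6) - 2 = 5" "(3::6) - 2 = 1" "(5::6) - 2 = 3" "(4::6) - 2 = 2" "(6::6) - 2 = 4"
    by (simp_all add: residues_6)
  have d: "d 3 = c * z^4 * d 1" "d 5 = c * z^2 * d 3" "d 1 = c * z * d 5" "d 4 = c * z^6 * d 2" "d 6 = c * z^3 * d 4"
    using B(4) [of 3] B(4) [of 5] B(4) [of 1] B(4) [of 4] B(4) [of 6] unfolding wt_simps zz idx by simp_all
  have "(d 1 * d 2 * d 3 * d 4 * d 5 * d 6)^2 = 1" using B(3) unfolding prod_6 .
  note rel = normalizer_relations [OF z7 B(2) B(2) d this]
  show thesis
    using that [OF rel(5)] form_mono_mat [OF rel(1-4), of k] unfolding form_action_def B(1) by blast
qed

lemma det_mono_mat_0: "det (mono_mat 0 d) = prod d UNIV"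
proof -
  have "det (mono_mat 0 d) = (\<Prod>i\<in>UNIV. mono_mat 0 d $ i $ i)"
    by (rule det_diagonal) (simp add: mono_mat_def)
  then show ?thesis by (simp add: mono_mat_def)
qed

text \<open>\<open>form_action\<close> substitutes the inverse matrix; to realise a prescribed
  substitution \<open>B\<close> the group element has to be its inverse.\<close>

lemma normalizer_action_of_inverse:
  assumes "B \<in> SL6_normalizer"
  obtains A where "A \<in> SL6_normalizer" "\<And>F. form_action A F = (\<lambda>x. F (B *v x))"
proof -
  have "invertible B" using assms by (auto simp: SL6_normalizer_def invertible_det_nz)
  then have "matrix_inv (matrix_inv B) = B"
    using matrix_inv_works matrix_inv_unique by blast
  then show thesis
    using that [OF SL6_normalizer_inv [OF assms]] by (simp add: form_action_def)
qed

text \<open>The witness is diag(s, 1/s, s, 1/s, s, 1/s) up to inversion; it has determinant 1 and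
  commutes with the even shifts.\<close>

lemma normalizer_torus:
  assumes s: "s \<noteq> 0"
  obtains A where "A \<in> SL6_normalizer"
    "\<And>c. form_action A (form c) = form (vec4 (s * c$1) (c$2 / s) (s^3 * c$3) (c$4 / s^3))"
proof -
  define d :: "6 \<Rightarrow> complex" where "d = (\<lambda>r. if r \<in> {1, 3, 5} then s else 1 / s)"
  have d: "d 1 = s" "d 3 = s" "d 5 = s" "d 2 = 1 / s" "d 4 = 1 / s" "d 6 = 1 / s"
    by (simp_all add: d_def)
  have d0: "d r = 1 * d (r - l)" if "l \<in> {2, 4, 6}" for r l
    using that exhaust_6 [of r] by (auto simp: residues_6 more_residues_6 d)
  have "det (mono_mat 0 d) = 1"
    unfolding det_mono_mat_0 prod_6 d using s by (simp add: field_simps)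
  moreover have "\<exists>c. c \<noteq> 0 \<and> (\<forall>r. d r = c * d (r - l))" if "l \<in> {2, 4, 6}" for l
    using d0 [OF that] by (intro exI [of _ 1]) simp
  ultimately have B: "mono_mat 0 d \<in> SL6_normalizer" by (rule mono_mat_in_normalizer)
  obtain A where A: "A \<in> SL6_normalizer" "\<And>F. form_action A F = (\<lambda>x. F (mono_mat 0 d *v x))"
    using normalizer_action_of_inverse [OF B] by metis
  show thesis
  proof (rule that [OF A(1)])
    show "form_action A (form c) = form (vec4 (s * c$1) (c$2 / s) (s^3 * c$3) (c$4 / s^3))" for c
      unfolding A(2) using s by (simp add: fun_eq_iff form_def d field_simps power2_eq_square power3_eq_cube)
  qed
qed

text \<open>The witness diag(1, 1, w, w, w^2, w^2) with w = \<open>omega3\<close>, up to inversion,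
  commutes with \<open>g3\<close> only up to a cube root of unity, so it normalizes the group merely
  in the projective sense.\<close>

lemma normalizer_diagonal:
  obtains A where "A \<in> SL6_normalizer"
    "\<And>c. form_action A (form c) = form (vec4 (c$1) (omega3 * c$2) (c$3) (c$4))"
proof -
  let ?w = omega3
  have w3: "?w * (?w * ?w) = 1" using omega3_cube by (simp add: power3_eq_cube mult.assoc)
  have w3': "?w * (?w * (?w * x)) = x" for x using w3 by (metis mult.assoc mult_1)
  have w0: "?w \<noteq> 0" using w3 by auto
  define d :: "6 \<Rightarrow> complex" where
    "d = (\<lambda>r. if r \<in> {1, 2} then 1 else if r \<in> {3, 4} then ?w else ?w * ?w)"
  have d: "d 1 = 1" "d 2 = 1" "d 3 = ?w" "d 4 = ?w" "d 5 = ?w * ?w" "d 6 = ?w * ?w"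
    by (simp_all add: d_def)
  have d2: "\<forall>r. d r = ?w * d (r - 2)" "\<forall>r. d r = (?w * ?w) * d (r - 4)" "\<forall>r. d r = 1 * d (r - 6)"
    unfolding forall_6 by (simp_all add: residues_6 more_residues_6 d w3 mult.assoc)
  have "det (mono_mat 0 d) = 1"
    unfolding det_mono_mat_0 prod_6 d by (simp add: w3 w3' mult.assoc)
  moreover have "\<exists>c. c \<noteq> 0 \<and> (\<forall>r. d r = c * d (r - l))" if l: "l \<in> {2, 4, 6}" for l
  proof -
    consider "l = 2" | "l = 4" | "l = 6" using l by blast
    then show ?thesis
    proof cases
      case 1 then show ?thesis using d2(1) w0 by blast
    next
      case 2
      have "?w * ?w \<noteq> 0" using w0 by simp
      then show ?thesis unfolding 2 using d2(2) by blast
    next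
      case 3 then show ?thesis using d2(3) one_neq_zero by blast
    qed
  qed
  ultimately have B: "mono_mat 0 d \<in> SL6_normalizer" by (rule mono_mat_in_normalizer)
  obtain A where A: "A \<in> SL6_normalizer" "\<And>F. form_action A F = (\<lambda>x. F (mono_mat 0 d *v x))"
    using normalizer_action_of_inverse [OF B] by metis
  show thesis
  proof (rule that [OF A(1)])
    show "form_action A (form c) = form (vec4 (c$1) (?w * c$2) (c$3) (c$4))" for c
      unfolding A(2) by (simp add: fun_eq_iff form_def d power2_eq_square algebra_simps w3 w3')
  qed
qed

text \<open>The shift by one index exchanges odd and even variables; a sixth root \<open>e0\<close>
  corrects its determinant to 1, and the cube of \<open>e0\<close> appears as the scalar
  \<open>e\<close>.\<close>

lemma normalizer_swap:
  obtains A e where "A \<in> SL6_normalizer" "e \<noteq> 0"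
    "\<And>c. form_action A (form c) = form (e *s vec4 (c$2) (c$1) (c$4) (c$3))"
proof -
  have det1: "det (mono_mat 1 (\<lambda>_. 1)) \<noteq> 0"
    using invertible_mono_mat [of "\<lambda>_. 1" 1] by (simp add: invertible_det_nz)
  obtain e0 where "1 / det (mono_mat 1 (\<lambda>_. 1)) = e0^6"
    by (rule exists_complex_root [of 6 "1 / det (mono_mat 1 (\<lambda>_. 1))"]) simp
  then have e0: "e0^6 * det (mono_mat 1 (\<lambda>_. 1)) = 1" using det1 by (simp add: field_simps)
  then have e00: "e0 \<noteq> 0" by auto
  have "mono_mat 1 (\<lambda>_. e0) = mono_mat 0 (\<lambda>_. e0) ** mono_mat 1 (\<lambda>_. 1)" by (simp add: mono_mat_mult)
  then have "det (mono_mat 1 (\<lambda>_. e0)) = e0^6 * det (mono_mat 1 (\<lambda>_. 1))"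
    by (simp only: det_mul det_mono_mat_0 prod_6) (simp add: eval_nat_numeral mult.assoc)
  then have "det (mono_mat 1 (\<lambda>_. e0)) = 1" unfolding e0 .
  then have B: "mono_mat 1 (\<lambda>_. e0) \<in> SL6_normalizer"
    by (rule mono_mat_in_normalizer) (rule exI [of _ 1], simp)
  obtain A where A: "A \<in> SL6_normalizer" "\<And>F. form_action A F = (\<lambda>x. F (mono_mat 1 (\<lambda>_. e0) *v x))"
    using normalizer_action_of_inverse [OF B] by metis
  show thesis
  proof (rule that [OF A(1), of "e0^3"])
    show "form_action A (form c) = form (e0^3 *s vec4 (c$2) (c$1) (c$4) (c$3))" for c
      unfolding A(2) by (simp add: fun_eq_iff form_def residues_6 power2_eq_square power3_eq_cube algebra_simps)
  qed (use e00 in simp)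
qed

subsection \<open>The space of invariant cubic forms\<close>

text \<open>Forms are generated by multiplication with a coordinate on the left, so that a form of
  positive degree splits off one coordinate by induction. The clause \<open>zero\<close> lets the
  zero form have every degree.\<close>

inductive homogeneous_form :: "nat \<Rightarrow> (complex^'n \<Rightarrow> complex) \<Rightarrow> bool" where
  const: "homogeneous_form 0 (\<lambda>_. c)"
| zero: "homogeneous_form n (\<lambda>_. 0)"
| coord: "homogeneous_form n f \<Longrightarrow> homogeneous_form (Suc n) (\<lambda>x. x $ i * f x)"
| add: "homogeneous_form n f \<Longrightarrow> homogeneous_form n g \<Longrightarrow> homogeneous_form n (\<lambda>x. f x + g x)"

lemma homogeneous_form_cmult: "homogeneous_form n f \<Longrightarrow> homogeneous_form n (\<lambda>x. c * f x)"
proof (induction rule: homogeneous_form.induct)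
  case (coord n f i)
  then show ?case using homogeneous_form.coord [OF coord.IH, of i] by (simp add: mult.left_commute)
next
  case (add n f g)
  then show ?case using homogeneous_form.add [OF add.IH] by (simp add: distrib_left)
qed (auto intro: homogeneous_form.const homogeneous_form.zero)

lemma homogeneous_form_mult:
  assumes "homogeneous_form m f" "homogeneous_form n g"
  shows "homogeneous_form (m + n) (\<lambda>x. f x * g x)"
  using assms
proof (induction rule: homogeneous_form.induct)
  case (const c)
  then show ?case by (simp add: homogeneous_form_cmult)
next
  case (coord m f i)
  then show ?case using homogeneous_form.coord [OF coord.IH [OF coord.prems], of i] by (simp add: mult.assoc)
next
  case (add m f h)
  then show ?case using homogeneous_form.add [OF add.IH(1,2)] by (simp add: distrib_right)
qed (simp add: homogeneous_form.zero)

lemma homogeneous_form_Suc: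
  assumes "homogeneous_form (Suc n) f"
  shows "\<exists>g. (\<forall>i. homogeneous_form n (g i)) \<and> f = (\<lambda>x. \<Sum>i\<in>UNIV. x $ i * g i x)"
  using assms
proof (induction "Suc n" f rule: homogeneous_form.induct)
  case zero
  then show ?case by (intro exI [of _ "\<lambda>_ _. 0"]) (simp add: homogeneous_form.zero)
next
  case (coord f i)
  then show ?case
    by (intro exI [of _ "\<lambda>j. if j = i then f else (\<lambda>_. 0)"])
      (auto simp: homogeneous_form.zero fun_eq_iff if_distrib [of "\<lambda>h. h _"] mult_delta_right cong: if_cong)
next
  case (add f g)
  then obtain f' g' where "\<forall>i. homogeneous_form n (f' i)" "f = (\<lambda>x. \<Sum>i\<in>UNIV. x $ i * f' i x)"
    "\<forall>i. homogeneous_form n (g' i)" "g = (\<lambda>x. \<Sum>i\<in>UNIV. x $ i * g' i x)" by blast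
  then show ?case
    by (intro exI [of _ "\<lambda>i x. f' i x + g' i x"]) (simp add: homogeneous_form.add distrib_left sum.distrib)
qed

lemma homogeneous_form_0: "homogeneous_form 0 f \<Longrightarrow> \<exists>c. f = (\<lambda>_. c)"
  by (induction "0 :: nat" f rule: homogeneous_form.induct) auto

lemma homogeneous_form_3:
  assumes "homogeneous_form 3 f"
  shows "\<exists>c. f = (\<lambda>x. \<Sum>i\<in>UNIV. \<Sum>j\<in>UNIV. \<Sum>k\<in>UNIV. c i j k * (x $ i * x $ j * x $ k))"
proof -
  obtain g where g: "\<forall>i. homogeneous_form 2 (g i)" "f = (\<lambda>x. \<Sum>i\<in>UNIV. x $ i * g i x)"
    using homogeneous_form_Suc [of 2 f] assms by auto
  have "\<forall>i. \<exists>h. (\<forall>j. homogeneous_form 1 (h j)) \<and> g i = (\<lambda>x. \<Sum>j\<in>UNIV. x $ j * h j x)"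
    using homogeneous_form_Suc [of 1] g(1) by (auto simp: numeral_2_eq_2)
  then obtain h where h: "\<forall>i j. homogeneous_form 1 (h i j)" "\<forall>i. g i = (\<lambda>x. \<Sum>j\<in>UNIV. x $ j * h i j x)"
    by metis
  have "\<forall>i j. \<exists>l. (\<forall>k. homogeneous_form 0 (l k)) \<and> h i j = (\<lambda>x. \<Sum>k\<in>UNIV. x $ k * l k x)"
    using homogeneous_form_Suc [of 0] h(1) by auto
  then obtain l where l: "\<forall>i j k. homogeneous_form 0 (l i j k)" "\<forall>i j. h i j = (\<lambda>x. \<Sum>k\<in>UNIV. x $ k * l i j k x)"
    by metis
  have "\<forall>i j k. \<exists>c. l i j k = (\<lambda>_. c)" using l(1) homogeneous_form_0 by blast
  then obtain c where c: "\<forall>i j k. l i j k = (\<lambda>_. c i j k)" by metis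
  show ?thesis
    by (rule exI [of _ c]) (simp add: g(2) h(2) l(2) c sum_distrib_left mult_ac)
qed

text \<open>The Taylor expansion at the origin up to order 3, tested along the lines through the
  origin; the remainder on each line is divisible by t^4.\<close>

definition has_jet :: "(complex^'n \<Rightarrow> complex) \<Rightarrow> (nat \<Rightarrow> complex^'n \<Rightarrow> complex) \<Rightarrow> bool" where
  "has_jet f j \<longleftrightarrow> (\<forall>n<4. homogeneous_form n (j n)) \<and>
     (\<forall>x. \<exists>p. \<forall>t. f (t *s x) = j 0 x + t * j 1 x + t^2 * j 2 x + t^3 * j 3 x + t^4 * poly p t)"

lemma poly_function_has_jet:
  assumes "f \<in> poly_functions coordinates"
  shows "\<exists>j. has_jet f j"
  using assms
proof induction
  case (const c)
  have "has_jet (\<lambda>_. c) (\<lambda>n. if n = 0 then (\<lambda>_. c) else (\<lambda>_. 0))"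
    unfolding has_jet_def by (auto intro: homogeneous_form.intros exI [of _ 0])
  then show ?case by blast
next
  case (generator e)
  then obtain i where e: "e = (\<lambda>v. v $ i)" unfolding coordinates_def by blast
  have "homogeneous_form 1 (\<lambda>v. v $ i)"
    using homogeneous_form.coord [OF homogeneous_form.const [of 1], of i] by simp
  then have "has_jet e (\<lambda>n. if n = 1 then (\<lambda>v. v $ i) else (\<lambda>_. 0))"
    unfolding has_jet_def e by (auto intro: homogeneous_form.intros exI [of _ 0])
  then show ?case by blast
next
  case (add f g)
  then obtain j k where "has_jet f j" "has_jet g k" by blast
  then have "has_jet (\<lambda>v. f v + g v) (\<lambda>n x. j n x + k n x)"
    unfolding has_jet_def
  proof (elim conjE, intro conjI allI impI)
    fix x
    assume "\<forall>x. \<exists>p. \<forall>t. f (t *s x) = j 0 x + t * j 1 x + t^2 * j 2 x + t^3 * j 3 x + t^4 * poly p t"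
      "\<forall>x. \<exists>p. \<forall>t. g (t *s x) = k 0 x + t * k 1 x + t^2 * k 2 x + t^3 * k 3 x + t^4 * poly p t"
    then obtain p q where "\<forall>t. f (t *s x) = j 0 x + t * j 1 x + t^2 * j 2 x + t^3 * j 3 x + t^4 * poly p t"
      "\<forall>t. g (t *s x) = k 0 x + t * k 1 x + t^2 * k 2 x + t^3 * k 3 x + t^4 * poly q t" by blast
    then show "\<exists>p. \<forall>t. f (t *s x) + g (t *s x) = j 0 x + k 0 x + t * (j 1 x + k 1 x) + t^2 * (j 2 x + k 2 x)
        + t^3 * (j 3 x + k 3 x) + t^4 * poly p t"
      by (intro exI [of _ "p + q"]) (simp add: algebra_simps)
  qed (auto intro: homogeneous_form.add)
  then show ?case by blast
next
  case (mult f g)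
  then obtain j k where jk: "has_jet f j" "has_jet g k" by blast
  define l where "l = (\<lambda>n x. if n = 0 then j 0 x * k 0 x else if n = 1 then j 0 x * k 1 x + j 1 x * k 0 x
    else if n = (2::nat) then j 0 x * k 2 x + j 1 x * k 1 x + j 2 x * k 0 x
    else j 0 x * k 3 x + j 1 x * k 2 x + j 2 x * k 1 x + j 3 x * k 0 x)"
  have hj: "homogeneous_form 0 (j 0)" "homogeneous_form 1 (j 1)" "homogeneous_form 2 (j 2)" "homogeneous_form 3 (j 3)"
    and hk: "homogeneous_form 0 (k 0)" "homogeneous_form 1 (k 1)" "homogeneous_form 2 (k 2)" "homogeneous_form 3 (k 3)"
    using jk unfolding has_jet_def by auto
  note m = homogeneous_form_mult [OF hj(1)] homogeneous_form_mult [OF hj(2)] homogeneous_form_mult [OF hj(3)]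
    homogeneous_form_mult [OF hj(4)]
  have "homogeneous_form 0 (l 0)" unfolding l_def using m(1) [OF hk(1)] by simp
  moreover have "homogeneous_form 1 (l 1)" unfolding l_def
    using homogeneous_form.add [OF m(1) [OF hk(2)], of "\<lambda>x. j 1 x * k 0 x"] m(2) [OF hk(1)] by simp
  moreover have "homogeneous_form 2 (l 2)" unfolding l_def
    using homogeneous_form.add [OF homogeneous_form.add [OF m(1) [OF hk(3)], of "\<lambda>x. j 1 x * k 1 x"], of "\<lambda>x. j 2 x * k 0 x"]
      m(2) [OF hk(2)] m(3) [OF hk(1)] by (simp add: numeral_2_eq_2)
  moreover have "homogeneous_form 3 (l 3)" unfolding l_def
    using homogeneous_form.add [OF homogeneous_form.add [OF homogeneous_form.add [OF m(1) [OF hk(4)],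
        of "\<lambda>x. j 1 x * k 2 x"], of "\<lambda>x. j 2 x * k 1 x"], of "\<lambda>x. j 3 x * k 0 x"]
      m(2) [OF hk(3)] m(3) [OF hk(2)] m(4) [OF hk(1)] by (simp add: numeral_2_eq_2 numeral_3_eq_3)
  ultimately have "\<forall>n<4. homogeneous_form n (l n)"
    by (auto simp: less_Suc_eq eval_nat_numeral)
  moreover have "\<exists>p. \<forall>t. f (t *s x) * g (t *s x) = l 0 x + t * l 1 x + t^2 * l 2 x + t^3 * l 3 x + t^4 * poly p t" for x
  proof -
    obtain p q where p: "\<forall>t. f (t *s x) = j 0 x + t * j 1 x + t^2 * j 2 x + t^3 * j 3 x + t^4 * poly p t"
      and q: "\<forall>t. g (t *s x) = k 0 x + t * k 1 x + t^2 * k 2 x + t^3 * k 3 x + t^4 * poly q t"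
      using jk unfolding has_jet_def by blast
    define J K where "J = [:j 0 x, j 1 x, j 2 x, j 3 x:]" and "K = [:k 0 x, k 1 x, k 2 x, k 3 x:]"
    \<comment> \<open>The first polynomial holds the coefficients of t^4, t^5 and t^6 in
      \<open>J * K\<close>; the other summands come from the remainders.\<close>
    define r where "r = [:j 1 x * k 3 x + j 2 x * k 2 x + j 3 x * k 1 x, j 2 x * k 3 x + j 3 x * k 2 x, j 3 x * k 3 x:]
       + J * q + K * p + monom 1 4 * p * q"
    have "f (t *s x) * g (t *s x) = l 0 x + t * l 1 x + t^2 * l 2 x + t^3 * l 3 x + t^4 * poly r t" for t
      unfolding p [rule_format] q [rule_format] r_def J_def K_def l_def
      by (simp add: poly_monom) algebra
    then show ?thesis by blast
  qed
  ultimately have "has_jet (\<lambda>v. f v * g v) l" unfolding has_jet_def by blast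
  then show ?case by blast
qed

text \<open>Along the line of x the function is F(x) t^3, so comparing coefficients identifies it
  with the third component of its jet. Homogeneity of a function thereby becomes an expansion in
  monomials.\<close>

lemma cubic_form_expand:
  assumes "F \<in> cubic_forms"
  shows "\<exists>c. F = (\<lambda>x. \<Sum>i\<in>UNIV. \<Sum>j\<in>UNIV. \<Sum>k\<in>UNIV. c i j k * (x $ i * x $ j * x $ k))"
proof -
  have F: "F \<in> poly_functions coordinates" "\<And>c v. F (c *s v) = c^3 * F v"
    using assms by (auto simp: cubic_forms_def homogeneous_on_def)
  obtain j where j: "has_jet F j" using poly_function_has_jet [OF F(1)] by blast
  have "F x = j 3 x" for x
  proof -
    obtain p where p: "\<forall>t. F (t *s x) = j 0 x + t * j 1 x + t^2 * j 2 x + t^3 * j 3 x + t^4 * poly p t"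
      using j unfolding has_jet_def by blast
    have "poly [:0, 0, 0, F x:] t = poly ([:j 0 x, j 1 x, j 2 x, j 3 x:] + monom 1 4 * p) t" for t
      using p [rule_format, of t] unfolding F(2)
      by (simp add: poly_monom algebra_simps power2_eq_square power3_eq_cube)
    then have "[:0, 0, 0, F x:] = [:j 0 x, j 1 x, j 2 x, j 3 x:] + monom 1 4 * p"
      by (simp add: poly_eq_poly_eq_iff [symmetric] fun_eq_iff)
    from arg_cong [OF this, of "\<lambda>q. coeff q 3"] show ?thesis
      by (simp add: coeff_monom_mult numeral_3_eq_3)
  qed
  then have "F = j 3" by auto
  then show ?thesis using homogeneous_form_3 [of F] j unfolding has_jet_def by simp
qed


lemma form_add: "form (c + d) x = form c x + form d x"
  by (simp add: form_def algebra_simps)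

lemma form_scale: "form (a *s c) x = a * form c x"
  by (simp add: form_def algebra_simps)

lemma form_zero: "form 0 = (\<lambda>_. 0)"
  by (simp add: fun_eq_iff form_def)

lemma sum_in_range_form:
  assumes "\<And>i. i \<in> I \<Longrightarrow> f i \<in> range form"
  shows "(\<lambda>x. \<Sum>i\<in>I. f i x) \<in> range form"
proof -
  have "\<forall>i\<in>I. \<exists>c. f i = form c" using assms by blast
  then obtain c where c: "\<And>i. i \<in> I \<Longrightarrow> f i = form (c i)" by metis
  have "(\<Sum>i\<in>I. f i x) = form (\<Sum>i\<in>I. c i) x" for x
  proof -
    have "(\<Sum>i\<in>I. f i x) = (\<Sum>i\<in>I. form (c i) x)" using c by (intro sum.cong) auto
    also have "\<dots> = form (\<Sum>i\<in>I. c i) x"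
      by (induction I rule: infinite_finite_induct) (simp_all add: form_zero form_add)
    finally show ?thesis .
  qed
  then show ?thesis by auto
qed

lemma scale_in_range_form: "f \<in> range form \<Longrightarrow> (\<lambda>x. a * f x) \<in> range form"
  by (auto simp flip: form_scale)

lemma F21_elem_mult_vec: "(F21_elem i k *v x) $ r = zeta7 ^ (i * wt r) * x $ (r - k)"
  by (simp add: F21_elem_def)

lemma sum_zeta7_powers: "(\<Sum>i<7. zeta7 ^ (i * n)) = (if n mod 7 = 0 then 7 else 0)"
proof (cases "n mod 7 = 0")
  case True
  then have "zeta7 ^ (i * n) = zeta7 ^ 0" for i
    by (intro zeta7_power_cong) (simp add: mod_eq_0_iff_dvd)
  then show ?thesis using True by simp
next
  case False
  then have "zeta7 ^ n \<noteq> zeta7 ^ 0" unfolding zeta7_power_eq_iff by simp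
  then have n: "zeta7 ^ n \<noteq> 1" by simp
  have "(\<Sum>i<7. zeta7 ^ (i * n)) = (\<Sum>i<7. (zeta7 ^ n) ^ i)"
    by (simp add: mult.commute flip: power_mult)
  also have "\<dots> = ((zeta7 ^ n) ^ 7 - 1) / (zeta7 ^ n - 1)" by (rule geometric_sum [OF n])
  also have "(zeta7 ^ n) ^ 7 = 1" by (metis mult.commute power_mult power_one zeta7_power_7)
  finally show ?thesis using False by simp
qed

text \<open>A triple of weights with sum 7 or 14 is a monomial of one of the four basis forms. The
  two products of three distinct variables are fixed by \<open>g3\<close> and are counted three
  times, hence the coefficient 3.\<close>

lemma monomial_orbit_sum:
  assumes "(wt a + wt b + wt c) mod 7 = 0"
  shows "(\<lambda>x. x$(a-2)*x$(b-2)*x$(c-2) + x$(a-4)*x$(b-4)*x$(c-4) + x$(a-6)*x$(b-6)*x$(c-6)) \<in>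
    {form (vec4 1 0 0 0), form (vec4 0 1 0 0), form (vec4 0 0 3 0), form (vec4 0 0 0 3)}"
proof -
  have "\<forall>a b c. (wt a + wt b + wt c) mod 7 = 0 \<longrightarrow>
   (\<forall>x. x$(a-2)*x$(b-2)*x$(c-2) + x$(a-4)*x$(b-4)*x$(c-4) + x$(a-6)*x$(b-6)*x$(c-6) = form (vec4 1 0 0 0) x) \<or>
   (\<forall>x. x$(a-2)*x$(b-2)*x$(c-2) + x$(a-4)*x$(b-4)*x$(c-4) + x$(a-6)*x$(b-6)*x$(c-6) = form (vec4 0 1 0 0) x) \<or>
   (\<forall>x. x$(a-2)*x$(b-2)*x$(c-2) + x$(a-4)*x$(b-4)*x$(c-4) + x$(a-6)*x$(b-6)*x$(c-6) = form (vec4 0 0 3 0) x) \<or>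
   (\<forall>x. x$(a-2)*x$(b-2)*x$(c-2) + x$(a-4)*x$(b-4)*x$(c-4) + x$(a-6)*x$(b-6)*x$(c-6) = form (vec4 0 0 0 3) x)"
    unfolding forall_6
    by (simp add: residues_6 more_residues_6 form_def power2_eq_square mult_ac add_ac)
  then show ?thesis using assms by (auto simp: fun_eq_iff)
qed

text \<open>The Reynolds operator of the group of order 21: summing over powers of \<open>g7\<close>
  keeps the monomials of weight 0 modulo 7, and summing over the even shifts turns them into orbit
  sums.\<close>

lemma invariant_in_range_form:
  assumes F: "F \<in> cubic_forms" and inv: "\<And>A x. A \<in> F21 \<Longrightarrow> F (A *v x) = F x"
  shows "F \<in> range form"
proof -
  obtain c where c: "F = (\<lambda>x. \<Sum>a\<in>UNIV. \<Sum>b\<in>UNIV. \<Sum>d\<in>UNIV. c a b d * (x $ a * x $ b * x $ d))"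
    using cubic_form_expand [OF F] by blast
  define S where "S = (\<lambda>a b d (x :: complex^6). x$(a-2)*x$(b-2)*x$(d-2) + x$(a-4)*x$(b-4)*x$(d-4) + x$(a-6)*x$(b-6)*x$(d-6))"
  define R where "R = (\<lambda>a b d. if (wt a + wt b + wt d) mod 7 = 0 then 7 * c a b d else 0)"
  have mono: "(\<Sum>i<7. \<Sum>k\<in>{2,4,6}. (F21_elem i k *v x) $ a * (F21_elem i k *v x) $ b * (F21_elem i k *v x) $ d)
     = (if (wt a + wt b + wt d) mod 7 = 0 then 7 else 0) * S a b d x" for a b d x
  proof -
    have "(\<Sum>k\<in>{2,4,6}. (F21_elem i k *v x) $ a * (F21_elem i k *v x) $ b * (F21_elem i k *v x) $ d)
       = zeta7 ^ (i * (wt a + wt b + wt d)) * S a b d x" for i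
      unfolding S_def F21_elem_mult_vec by (simp add: power_add distrib_left algebra_simps)
    then show ?thesis by (simp only: sum_distrib_right [symmetric] sum_zeta7_powers)
  qed
  have "21 * F x = (\<Sum>a\<in>UNIV. \<Sum>b\<in>UNIV. \<Sum>d\<in>UNIV. R a b d * S a b d x)" for x
  proof -
    have "F (F21_elem i k *v x) = F x" if "k \<in> {2,4,6}" for i k
      using that by (intro inv) (auto simp: F21_eq)
    then have "(\<Sum>i<7::nat. \<Sum>k\<in>{2,4,6::6}. F (F21_elem i k *v x)) = (\<Sum>i<7::nat. \<Sum>k\<in>{2,4,6::6}. F x)"
      by (intro sum.cong refl) auto
    also have "\<dots> = 21 * F x" by simp
    finally have "21 * F x = (\<Sum>i<7::nat. \<Sum>k\<in>{2,4,6::6}. F (F21_elem i k *v x))" ..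
    also have "\<dots> = (\<Sum>i<7::nat. \<Sum>k\<in>{2,4,6::6}. \<Sum>a\<in>UNIV. \<Sum>b\<in>UNIV. \<Sum>d\<in>UNIV. c a b d *
        ((F21_elem i k *v x) $ a * (F21_elem i k *v x) $ b * (F21_elem i k *v x) $ d))"
      unfolding c ..
    also have "\<dots> = (\<Sum>i<7::nat. \<Sum>a\<in>UNIV. \<Sum>b\<in>UNIV. \<Sum>d\<in>UNIV. \<Sum>k\<in>{2,4,6::6}. c a b d *
        ((F21_elem i k *v x) $ a * (F21_elem i k *v x) $ b * (F21_elem i k *v x) $ d))"
      by (simp only: sum.swap [of _ _ "{2,4,6::6}"])
    also have "\<dots> = (\<Sum>a\<in>UNIV. \<Sum>b\<in>UNIV. \<Sum>d\<in>UNIV. \<Sum>i<7::nat. \<Sum>k\<in>{2,4,6::6}. c a b d *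
        ((F21_elem i k *v x) $ a * (F21_elem i k *v x) $ b * (F21_elem i k *v x) $ d))"
      by (simp only: sum.swap [of _ _ "{..<7::nat}"])
    also have "\<dots> = (\<Sum>a\<in>UNIV. \<Sum>b\<in>UNIV. \<Sum>d\<in>UNIV. R a b d * S a b d x)"
      unfolding sum_distrib_left [symmetric] mono by (intro sum.cong refl) (simp add: R_def)
    finally show ?thesis .
  qed
  moreover have "F x = (1/21) * (21 * F x)" for x by simp
  ultimately have "F x = (1/21) * (\<Sum>a\<in>UNIV. \<Sum>b\<in>UNIV. \<Sum>d\<in>UNIV. R a b d * S a b d x)" for x
    by (simp only:)
  then have F_eq: "F = (\<lambda>x. (1/21) * (\<Sum>a\<in>UNIV. \<Sum>b\<in>UNIV. \<Sum>d\<in>UNIV. R a b d * S a b d x))" by blast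
  have RS: "(\<lambda>x. R a b d * S a b d x) \<in> range form" for a b d
  proof (cases "(wt a + wt b + wt d) mod 7 = 0")
    case True
    from monomial_orbit_sum [OF this] have "S a b d \<in> range form" unfolding S_def by auto
    then show ?thesis by (rule scale_in_range_form)
  next
    case False
    then show ?thesis by (simp add: R_def flip: form_zero)
  qed
  show ?thesis
    unfolding F_eq by (intro scale_in_range_form sum_in_range_form RS)
qed

lemma form_in_V_F21: "form c \<in> V_F21"
proof -
  have "form c \<in> poly_functions coordinates"
    unfolding form_def by (intro poly_function_intros)
  then have cubic: "form c \<in> cubic_forms"
    by (simp add: cubic_forms_def homogeneous_on_def form_def algebra_simps power2_eq_square power3_eq_cube)
  have z: "zeta7 * zeta7 ^ 6 = 1" "zeta7 ^ 7 = 1" "zeta7 ^ 14 = 1"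
    using zeta7_power_7 zeta7_power_cong [of 14 0] by (simp_all flip: power_Suc)
  have gens: "form c (g *v x) = form c x" if "g \<in> {g7, g3}" for g x
  proof -
    have "form c (g3 *v x) = form c x"
      unfolding form_def g3_eq by (simp add: residues_6 more_residues_6 algebra_simps)
    moreover have g: "(g7 *v x) $ 1 = zeta7 * x$1" "(g7 *v x) $ 2 = zeta7^5 * x$2" "(g7 *v x) $ 3 = zeta7^4 * x$3"
      "(g7 *v x) $ 4 = zeta7^6 * x$4" "(g7 *v x) $ 5 = zeta7^2 * x$5" "(g7 *v x) $ 6 = zeta7^3 * x$6"
      by (simp_all add: g7_eq)
    have "form c (g7 *v x) = c$1 * (zeta7^7 * (x$1)^2 * x$2 + (zeta7^7)^2 * (x$3)^2 * x$4 + zeta7^7 * (x$5)^2 * x$6)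
     + c$2 * ((zeta7^7)^2 * (x$2)^2 * x$3 + (zeta7^7)^2 * (x$4)^2 * x$5 + zeta7^7 * (x$6)^2 * x$1)
     + c$3 * (zeta7^7 * x$1 * x$3 * x$5) + c$4 * ((zeta7^7)^2 * x$2 * x$4 * x$6)"
      unfolding form_def g by algebra
    then have "form c (g7 *v x) = form c x" unfolding z form_def by simp
    ultimately show ?thesis using that by blast
  qed
  have "form c (A *v x) = form c x" if "A \<in> F21" for A x
    using that unfolding F21_def
  proof (induction arbitrary: x rule: generate.induct)
    case (inv h)
    have "invertible g7" "invertible g3"
      unfolding g7_F21_elem g3_F21_elem by (rule invertible_F21_elem)+
    with inv have h: "invertible h" by blast
    have "form c (h *v (inv\<^bsub>GL6\<^esub> h *v x)) = form c x"
      unfolding GL6_inv [OF h] matrix_vector_mul_assoc matrix_inv_works(1) [OF h] by simp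
    then show ?case using gens inv by simp
  qed (auto simp: gens simp flip: matrix_vector_mul_assoc)
  then show ?thesis using cubic by (simp add: V_F21_def)
qed

lemma V_F21_eq: "V_F21 = range form"
  using invariant_in_range_form form_in_V_F21 by (auto simp: V_F21_def)

subsection \<open>The moduli space in terms of the coefficients\<close>

text \<open>Points at which one of the four basis forms is 1 and the others are 0. The coefficients
  of a form are therefore evaluations, hence polynomial functions of the form.\<close>

definition coeff_point :: "4 \<Rightarrow> complex^6" where
  "coeff_point i = (if i = 1 then axis 1 1 + axis 2 1 else if i = 2 then axis 2 1 + axis 3 1
     else if i = 3 then axis 1 1 + axis 3 1 + axis 5 1 else axis 2 1 + axis 4 1 + axis 6 1)"

definition form_coeffs :: "(complex^6 \<Rightarrow> complex) \<Rightarrow> complex^4" where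
  "form_coeffs F = (\<chi> i. F (coeff_point i))"

lemma form_coeffs_form [simp]: "form_coeffs (form c) = c"
  by (simp add: vec_eq_iff forall_4 form_coeffs_def coeff_point_def form_def axis_def)

lemma form_eq_iff [simp]: "form c = form d \<longleftrightarrow> c = d"
  by (metis form_coeffs_form)

lemma scale_form: "scale_function a (form c) = form (a *s c)"
  by (simp add: scale_function_def form_scale fun_eq_iff)

abbreviation nonzero_forms :: "(complex^6 \<Rightarrow> complex) set" where
  "nonzero_forms \<equiv> V_F21 - {\<lambda>x. 0}"

lemma nonzero_forms_eq: "nonzero_forms = form ` (UNIV - {0})"
  unfolding V_F21_eq form_zero [symmetric] by auto

lemma form_poly_evaluations: "e \<in> evaluations \<Longrightarrow> (\<lambda>c. e (form c)) \<in> poly_functions coordinates"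
  unfolding evaluations_def by (auto simp: form_def intro!: poly_function_intros)

lemma form_coeffs_poly: "e \<in> coordinates \<Longrightarrow> (\<lambda>F. e (form_coeffs F)) \<in> poly_functions evaluations"
  unfolding coordinates_def
  by (auto simp: form_coeffs_def evaluations_def intro!: poly_functions.generator)

abbreviation coefficient_space :: "(complex^4) fspace" where
  "coefficient_space \<equiv> affine_fspace coordinates (UNIV - {0})"

abbreviation form_space :: "(complex^6 \<Rightarrow> complex) fspace" where
  "form_space \<equiv> affine_fspace evaluations nonzero_forms"

lemma openin_whole: "openin (zariski (affine_fspace E S)) S"
  using openin_topspace [of "zariski (affine_fspace E S)"] by simp

lemma rational_map_on_form: "rational_map_on coordinates evaluations (UNIV - {0}) form"
  by (rule rational_map_on_polyI) (rule form_poly_evaluations)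

lemma rational_map_on_form_coeffs: "rational_map_on evaluations coordinates nonzero_forms form_coeffs"
  by (rule rational_map_on_polyI) (rule form_coeffs_poly)

lemma form_image: "form ` (UNIV - {0}) \<subseteq> nonzero_forms"
  by (simp add: nonzero_forms_eq)

lemma form_coeffs_image: "form_coeffs ` nonzero_forms \<subseteq> UNIV - {0}"
  by (auto simp: nonzero_forms_eq)

text \<open>\<open>form\<close> and \<open>form_coeffs\<close> are inverse to each other and
  polynomial in both directions, so open sets of forms can be computed in coefficients.\<close>

lemma openin_form_space:
  "openin (zariski form_space) Z \<longleftrightarrow>
     Z \<subseteq> nonzero_forms \<and> openin (zariski coefficient_space) {c \<in> UNIV - {0}. form c \<in> Z}"
proof
  assume Z: "openin (zariski form_space) Z"
  show "Z \<subseteq> nonzero_forms \<and> openin (zariski coefficient_space) {c \<in> UNIV - {0}. form c \<in> Z}"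
  proof
    show "Z \<subseteq> nonzero_forms" by (rule openin_affine_fspace_subset [OF Z])
    show "openin (zariski coefficient_space) {c \<in> UNIV - {0}. form c \<in> Z}"
      by (rule openin_rational_preimage [OF rational_map_on_form form_image openin_whole Z])
  qed
next
  assume Z: "Z \<subseteq> nonzero_forms \<and> openin (zariski coefficient_space) {c \<in> UNIV - {0}. form c \<in> Z}"
  have "openin (zariski form_space) {F \<in> nonzero_forms. form_coeffs F \<in> {c \<in> UNIV - {0}. form c \<in> Z}}"
    by (rule openin_rational_preimage [OF rational_map_on_form_coeffs form_coeffs_image openin_whole conjunct2 [OF Z]])
  also have "{F \<in> nonzero_forms. form_coeffs F \<in> {c \<in> UNIV - {0}. form c \<in> Z}} = Z"
    using Z unfolding nonzero_forms_eq by auto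
  finally show "openin (zariski form_space) Z" .
qed

lemma regular_form_space:
  assumes Z: "Z \<subseteq> nonzero_forms"
  shows "\<phi> \<in> regular form_space Z \<longleftrightarrow>
    (\<phi> \<circ> form) \<in> regular coefficient_space {c \<in> UNIV - {0}. form c \<in> Z}"
proof
  assume "\<phi> \<in> regular form_space Z"
  from regular_rational_pullback [OF rational_map_on_form form_image openin_whole refl this]
  show "(\<phi> \<circ> form) \<in> regular coefficient_space {c \<in> UNIV - {0}. form c \<in> Z}" .
next
  assume "(\<phi> \<circ> form) \<in> regular coefficient_space {c \<in> UNIV - {0}. form c \<in> Z}"
  from regular_rational_pullback [OF rational_map_on_form_coeffs form_coeffs_image openin_whole refl this]
  have "(\<phi> \<circ> form) \<circ> form_coeffs \<in> regular form_space {F \<in> nonzero_forms. form_coeffs F \<in> {c \<in> UNIV - {0}. form c \<in> Z}}" .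
  moreover have "{F \<in> nonzero_forms. form_coeffs F \<in> {c \<in> UNIV - {0}. form c \<in> Z}} = Z"
    using Z unfolding nonzero_forms_eq by auto
  ultimately have "(\<phi> \<circ> form) \<circ> form_coeffs \<in> regular form_space Z" by simp
  moreover have "((\<phi> \<circ> form) \<circ> form_coeffs) F = \<phi> F" if "F \<in> Z" for F
    using that Z unfolding nonzero_forms_eq by auto
  ultimately show "\<phi> \<in> regular form_space Z"
    using regular_affine_fspace_cong by blast
qed

abbreviation form_point :: "complex^4 \<Rightarrow> (complex^6 \<Rightarrow> complex) set" where
  "form_point c \<equiv> proj_point scale_function (form c)"

lemma form_point_eq_iff: "form_point c = form_point d \<longleftrightarrow> (\<exists>a. a \<noteq> 0 \<and> d = a *s c)"
proof -
  have "form_point c = form_point d \<longleftrightarrow> (\<exists>a. a \<noteq> 0 \<and> form d = scale_function a (form c))"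
    by (rule proj_point_eq_iff) (simp_all add: scale_function_def mult.assoc)
  then show ?thesis by (simp add: scale_form)
qed

abbreviation normalizer_maps where "normalizer_maps \<equiv> form_action ` SL6_normalizer"

abbreviation locus where
  "locus \<equiv> semistable_locus evaluations scale_function nonzero_forms normalizer_maps"

abbreviation form_class where
  "form_class \<equiv> s_class evaluations scale_function nonzero_forms normalizer_maps"

section \<open>Semistability and the quotient in terms of coefficient vectors\<close>

definition invariant_form :: "nat \<Rightarrow> ((complex^6 \<Rightarrow> complex) \<Rightarrow> complex) \<Rightarrow> bool" where
  "invariant_form d f \<longleftrightarrow> f \<in> poly_functions evaluations \<and> homogeneous_on scale_function nonzero_forms d f \<and>
     (\<forall>t\<in>normalizer_maps. \<forall>w\<in>nonzero_forms. f (t w) = f w)"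

definition semistable :: "(complex^4) set" where
  "semistable = {c. c \<noteq> 0 \<and> form_point c \<in> locus}"

definition moduli_point :: "complex^4 \<Rightarrow> (complex^6 \<Rightarrow> complex) set set" where
  "moduli_point c = F21_moduli_class (form c)"

lemma moduli_point_eq: "moduli_point c = form_class (form_point c)"
  by (simp add: moduli_point_def F21_moduli_class_def)

lemma invariant_form_scale:
  assumes "invariant_form d f" "c \<noteq> 0"
  shows "f (form (a *s c)) = a ^ d * f (form c)"
proof -
  have "form c \<in> nonzero_forms" using assms(2) by (auto simp: nonzero_forms_eq)
  then show ?thesis
    using assms(1) unfolding invariant_form_def homogeneous_on_def scale_form [symmetric] by blast
qed

lemma semistable_iff:
  assumes "c \<noteq> 0"
  shows "c \<in> semistable \<longleftrightarrow> (\<exists>d f. d > 0 \<and> invariant_form d f \<and> f (form c) \<noteq> 0)"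
proof
  assume "c \<in> semistable"
  then have "form_point c \<in> locus" by (simp add: semistable_def)
  then obtain v d f where v: "form_point c = proj_point scale_function v" "v \<in> nonzero_forms"
    and f: "d > 0" "invariant_form d f" "f v \<noteq> 0"
    unfolding semistable_locus_def invariant_form_def by blast
  obtain c' where c': "v = form c'" "c' \<noteq> 0" using v(2) unfolding nonzero_forms_eq by blast
  then obtain a where "c' = a *s c" using v(1) form_point_eq_iff by blast
  then have "f (form c) \<noteq> 0" using f(3) invariant_form_scale [OF f(2) assms, of a] c' by auto
  with f show "\<exists>d f. d > 0 \<and> invariant_form d f \<and> f (form c) \<noteq> 0" by blast
next
  assume "\<exists>d f. d > 0 \<and> invariant_form d f \<and> f (form c) \<noteq> 0"
  moreover have "form c \<in> nonzero_forms" using assms by (auto simp: nonzero_forms_eq)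
  ultimately show "c \<in> semistable"
    using assms unfolding semistable_def semistable_locus_def invariant_form_def by blast
qed

lemma locus_eq: "locus = form_point ` semistable"
proof
  show "locus \<subseteq> form_point ` semistable"
  proof
    fix P assume P: "P \<in> locus"
    then obtain v where v: "P = proj_point scale_function v" "v \<in> nonzero_forms"
      unfolding semistable_locus_def by blast
    then obtain c where "v = form c" "c \<noteq> 0" unfolding nonzero_forms_eq by blast
    then show "P \<in> form_point ` semistable" using P v by (auto simp: semistable_def)
  qed
qed (auto simp: semistable_def)

lemma invariant_form_poly:
  assumes "invariant_form d f"
  shows "(\<lambda>c. f (form c)) \<in> poly_functions coordinates"
proof -
  have "f \<in> poly_functions evaluations" using assms by (simp add: invariant_form_def)
  then show ?thesis by (rule poly_functions_compose) (rule form_poly_evaluations)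
qed

lemma openin_coefficient_spaceI:
  assumes "U \<subseteq> UNIV - {0}"
    "\<And>x. x \<in> U \<Longrightarrow> \<exists>f\<in>poly_functions coordinates. f x \<noteq> 0 \<and> (\<forall>y. y \<noteq> 0 \<longrightarrow> f y \<noteq> 0 \<longrightarrow> y \<in> U)"
  shows "openin (zariski coefficient_space) U"
proof (rule openin_affine_fspace [THEN iffD2], intro conjI ballI assms(1))
  fix x assume "x \<in> U"
  then obtain f where "f \<in> poly_functions coordinates" "f x \<noteq> 0" "\<forall>y. y \<noteq> 0 \<longrightarrow> f y \<noteq> 0 \<longrightarrow> y \<in> U"
    using assms(2) by blast
  then show "\<exists>f\<in>poly_functions coordinates. f x \<noteq> 0 \<and> (\<forall>y\<in>UNIV - {0}. f y \<noteq> 0 \<longrightarrow> y \<in> U)"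
    by (intro bexI [of _ f]) auto
qed

lemma openin_semistable: "openin (zariski coefficient_space) semistable"
proof (rule openin_coefficient_spaceI)
  show "semistable \<subseteq> UNIV - {0}" by (auto simp: semistable_def)
  fix c assume c: "c \<in> semistable"
  then have "c \<noteq> 0" by (simp add: semistable_def)
  with c obtain d f where df: "d > 0" "invariant_form d f" "f (form c) \<noteq> 0" using semistable_iff by blast
  then show "\<exists>f\<in>poly_functions coordinates. f c \<noteq> 0 \<and> (\<forall>y. y \<noteq> 0 \<longrightarrow> f y \<noteq> 0 \<longrightarrow> y \<in> semistable)"
    using semistable_iff invariant_form_poly [OF df(2)] by (intro bexI [of _ "\<lambda>c. f (form c)"]) blast+
qed

lemma locus_subset: "locus \<subseteq> form_point ` (UNIV - {0})"
  unfolding locus_eq by (rule image_mono) (auto simp: semistable_def)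

abbreviation form_proj_space where
  "form_proj_space \<equiv> proj_fspace evaluations scale_function nonzero_forms"

lemma openin_form_proj_space:
  "openin (zariski form_proj_space) U \<longleftrightarrow>
     U \<subseteq> form_point ` (UNIV - {0}) \<and> openin (zariski coefficient_space) {c \<in> UNIV - {0}. form_point c \<in> U}"
proof -
  have "{c \<in> UNIV - {0}. form c \<in> {F \<in> nonzero_forms. proj_point scale_function F \<in> U}}
      = {c \<in> UNIV - {0}. form_point c \<in> U}"
    by (auto simp: nonzero_forms_eq)
  moreover have "proj_point scale_function ` nonzero_forms = form_point ` (UNIV - {0})"
    unfolding nonzero_forms_eq image_image ..
  ultimately show ?thesis
    unfolding proj_fspace_def openin_quotient_fspace points_affine_fspace openin_form_space by auto
qed

lemma points_form_proj_space: "points form_proj_space = form_point ` (UNIV - {0})"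
  unfolding proj_fspace_def points_quotient_fspace points_affine_fspace nonzero_forms_eq image_image ..

lemma openin_locus: "openin (zariski form_proj_space) locus"
proof -
  have "{c \<in> UNIV - {0}. form_point c \<in> locus} = semistable" by (auto simp: semistable_def)
  then show ?thesis
    unfolding openin_form_proj_space using openin_semistable locus_subset by simp
qed

abbreviation semistable_space where
  "semistable_space \<equiv> semistable_fspace evaluations scale_function nonzero_forms normalizer_maps"

lemma openin_semistable_space:
  "openin (zariski semistable_space) U \<longleftrightarrow>
     U \<subseteq> locus \<and> openin (zariski coefficient_space) {c \<in> semistable. form_point c \<in> U}"
proof -
  have "U \<subseteq> locus \<Longrightarrow> {c \<in> UNIV - {0}. form_point c \<in> U} = {c \<in> semistable. form_point c \<in> U}"
    by (auto simp: semistable_def)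
  moreover have "U \<subseteq> locus \<Longrightarrow> U \<subseteq> form_point ` (UNIV - {0})"
    using locus_subset by blast
  ultimately show ?thesis
    unfolding semistable_fspace_def openin_open_subspace [OF openin_locus] openin_form_proj_space by auto
qed

lemma points_semistable_space: "points semistable_space = locus"
  unfolding semistable_fspace_def points_open_subspace points_form_proj_space
  using locus_subset by blast

lemma F21_moduli_eq: "F21_moduli = quotient_fspace form_class semistable_space"
  by (simp add: F21_moduli_def git_quotient_def)

lemma points_F21_moduli: "points F21_moduli = moduli_point ` semistable"
  unfolding F21_moduli_eq points_quotient_fspace points_semistable_space
  unfolding locus_eq image_image moduli_point_eq ..

text \<open>The quotients by scalars and by S-equivalence both carry the quotient topology, so
  openness can be tested in one step on the cone of semistable coefficient vectors.\<close>

lemma openin_F21_moduli: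
  "openin (zariski F21_moduli) U \<longleftrightarrow> U \<subseteq> moduli_point ` semistable \<and>
     openin (zariski coefficient_space) {c \<in> semistable. moduli_point c \<in> U}"
proof -
  have "{c \<in> semistable. form_point c \<in> {P \<in> locus. form_class P \<in> U}} = {c \<in> semistable. moduli_point c \<in> U}"
    by (auto simp: moduli_point_eq semistable_def)
  moreover have "form_class ` locus = moduli_point ` semistable"
    unfolding locus_eq image_image moduli_point_eq ..
  moreover have "{P \<in> locus. form_class P \<in> U} \<subseteq> locus" by auto
  ultimately show ?thesis
    unfolding F21_moduli_eq openin_quotient_fspace points_semistable_space openin_semistable_space by simp
qed

lemma regular_F21_moduli:
  "\<phi> \<in> regular F21_moduli U \<longleftrightarrow>
     \<phi> \<circ> moduli_point \<in> regular coefficient_space {c \<in> semistable. moduli_point c \<in> U}"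
proof -
  have Z: "{F \<in> nonzero_forms. proj_point scale_function F \<in> {P \<in> locus. form_class P \<in> U}} \<subseteq> nonzero_forms"
    by blast
  have "{c \<in> UNIV - {0}. form c \<in> {F \<in> nonzero_forms. proj_point scale_function F \<in> {P \<in> locus. form_class P \<in> U}}}
      = {c \<in> semistable. moduli_point c \<in> U}"
    by (auto simp: moduli_point_eq nonzero_forms_eq semistable_def)
  moreover have "\<phi> \<circ> form_class \<circ> proj_point scale_function \<circ> form = \<phi> \<circ> moduli_point"
    by (simp add: fun_eq_iff moduli_point_eq)
  moreover have "\<phi> \<in> regular F21_moduli U \<longleftrightarrow> \<phi> \<circ> form_class \<circ> proj_point scale_function \<in> regular form_space
      {F \<in> nonzero_forms. proj_point scale_function F \<in> {P \<in> locus. form_class P \<in> U}}"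
    unfolding F21_moduli_eq regular_quotient_fspace points_semistable_space
    unfolding semistable_fspace_def regular_open_subspace proj_fspace_def regular_quotient_fspace
      points_affine_fspace ..
  ultimately show ?thesis
    unfolding regular_form_space [OF Z] by simp
qed

subsection \<open>Invariants and orbits\<close>

lemma form_action_scale: "form_action A (scale_function a F) = scale_function a (form_action A F)"
  by (simp add: form_action_def scale_function_def)

lemma image_form_action: "form_action A ` proj_point scale_function F = proj_point scale_function (form_action A F)"
proof -
  have "proj_point scale_function F = (\<lambda>a. scale_function a F) ` {a. a \<noteq> 0}" for F :: "complex^6 \<Rightarrow> complex"
    by (auto simp: proj_point_def)
  then show ?thesis by (simp add: image_image form_action_scale)
qed

lemma form_action_mult:
  assumes "A \<in> SL6_normalizer" "B \<in> SL6_normalizer"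
  shows "form_action A (form_action B F) = form_action (A ** B) F"
proof -
  have inv: "invertible A" "invertible B"
    using assms by (auto simp: SL6_normalizer_def invertible_det_nz)
  have "matrix_inv (A ** B) = matrix_inv B ** matrix_inv A"
  proof (rule matrix_inv_unique)
    have "A ** B ** (matrix_inv B ** matrix_inv A) = A ** (B ** matrix_inv B) ** matrix_inv A"
      by (simp add: matrix_mul_assoc)
    then show "A ** B ** (matrix_inv B ** matrix_inv A) = mat 1"
      by (simp add: matrix_inv_works inv)
    have "matrix_inv B ** matrix_inv A ** (A ** B) = matrix_inv B ** (matrix_inv A ** A) ** B"
      by (simp add: matrix_mul_assoc)
    then show "matrix_inv B ** matrix_inv A ** (A ** B) = mat 1"
      by (simp add: matrix_inv_works inv)
  qed
  then show ?thesis by (simp add: form_action_def matrix_vector_mul_assoc)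
qed

lemma form_action_inverse:
  assumes "A \<in> SL6_normalizer"
  shows "form_action (matrix_inv A) (form_action A F) = F"
proof -
  have "invertible A" using assms by (auto simp: SL6_normalizer_def invertible_det_nz)
  note inv = matrix_inv_works(2) [OF this]
  have "matrix_inv (mat 1 :: complex^6^6) = mat 1" by (rule matrix_inv_unique) simp_all
  then show ?thesis
    unfolding form_action_mult [OF SL6_normalizer_inv [OF assms] assms] inv by (simp add: form_action_def)
qed

abbreviation maps_orbit where
  "maps_orbit P \<equiv> {t ` P | t. t \<in> normalizer_maps}"

lemma maps_orbit_image:
  assumes A: "A \<in> SL6_normalizer"
  shows "maps_orbit (form_action A ` proj_point scale_function F) = maps_orbit (proj_point scale_function F)"
proof -
  have sub: "maps_orbit (proj_point scale_function (form_action A F)) \<subseteq> maps_orbit (proj_point scale_function F)"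
    if A: "A \<in> SL6_normalizer" for A F
  proof
    fix Q assume "Q \<in> maps_orbit (proj_point scale_function (form_action A F))"
    then obtain B where B: "B \<in> SL6_normalizer" "Q = proj_point scale_function (form_action (B ** A) F)"
      using A by (auto simp: image_form_action form_action_mult)
    then show "Q \<in> maps_orbit (proj_point scale_function F)"
      using SL6_normalizer_mult [OF B(1) A] by (auto simp: image_form_action simp flip: image_form_action)
  qed
  show ?thesis
    unfolding image_form_action
    using sub [OF A, of F] sub [OF SL6_normalizer_inv [OF A], of "form_action A F"]
    by (simp add: form_action_inverse [OF A])
qed

lemma form_class_eq:
  "form_class P = {Q \<in> locus. (zariski semistable_space closure_of maps_orbit P) \<inter>
      (zariski semistable_space closure_of maps_orbit Q) \<noteq> {}}"
  unfolding s_class_def Let_def ..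

lemma moduli_point_action:
  assumes "A \<in> SL6_normalizer" "form_action A (form c) = form c'"
  shows "moduli_point c' = moduli_point c"
proof -
  have "form_point c' = form_action A ` form_point c"
    by (simp add: image_form_action assms(2))
  then show ?thesis
    unfolding moduli_point_eq form_class_eq using maps_orbit_image [OF assms(1), of "form c"] by simp
qed

lemma moduli_point_scale: "a \<noteq> 0 \<Longrightarrow> moduli_point (a *s c) = moduli_point c"
  using form_point_eq_iff [of c "a *s c"] unfolding moduli_point_eq by metis

lemma moduli_point_torus:
  assumes "s \<noteq> 0"
  shows "moduli_point (vec4 (s * c$1) (c$2 / s) (s^3 * c$3) (c$4 / s^3)) = moduli_point c"
proof -
  obtain A where "A \<in> SL6_normalizer"
    "\<And>c. form_action A (form c) = form (vec4 (s * c$1) (c$2 / s) (s^3 * c$3) (c$4 / s^3))"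
    by (rule normalizer_torus [OF assms]) blast
  then show ?thesis using moduli_point_action by blast
qed

lemma moduli_point_diagonal: "moduli_point (vec4 (c$1) (omega3 * c$2) (c$3) (c$4)) = moduli_point c"
proof -
  obtain A where "A \<in> SL6_normalizer"
    "\<And>c. form_action A (form c) = form (vec4 (c$1) (omega3 * c$2) (c$3) (c$4))"
    by (rule normalizer_diagonal) blast
  then show ?thesis using moduli_point_action by blast
qed

lemma moduli_point_swap: "moduli_point (vec4 (c$2) (c$1) (c$4) (c$3)) = moduli_point c"
proof -
  obtain A e where A: "A \<in> SL6_normalizer" "e \<noteq> 0"
    "\<And>c. form_action A (form c) = form (e *s vec4 (c$2) (c$1) (c$4) (c$3))"
    by (rule normalizer_swap) blast
  then have "moduli_point (e *s vec4 (c$2) (c$1) (c$4) (c$3)) = moduli_point c"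
    using moduli_point_action by blast
  then show ?thesis using moduli_point_scale [OF A(2)] by simp
qed

lemma form_point_in_own_orbit: "form_point c \<in> maps_orbit (form_point c)"
proof -
  obtain A where A: "A \<in> SL6_normalizer"
    "\<And>c. form_action A (form c) = form (vec4 (1 * c$1) (c$2 / 1) (1^3 * c$3) (c$4 / 1^3))"
    by (rule normalizer_torus [of 1]) auto
  then have "form_action A (form c) = form c" by (simp add: vec4_eta)
  then have "form_point c = form_action A ` form_point c" by (simp add: image_form_action)
  then show ?thesis using A(1) by blast
qed

abbreviation orbit_closure where
  "orbit_closure P \<equiv> zariski semistable_space closure_of maps_orbit P"

text \<open>The class of \<open>c\<close> contains the point of \<open>c\<close> itself, as this
  point lies in its own orbit closure; under equality of classes it then also belongs to the class
  of \<open>c'\<close>.\<close>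

lemma moduli_point_eqD:
  assumes "c \<in> semistable" "moduli_point c = moduli_point c'"
  shows "orbit_closure (form_point c) \<inter> orbit_closure (form_point c') \<noteq> {}"
proof -
  have locus: "form_point c \<in> locus" using assms(1) by (simp add: semistable_def)
  then have "form_point c \<in> points semistable_space \<inter> maps_orbit (form_point c)"
    using form_point_in_own_orbit unfolding points_semistable_space by (rule IntI)
  then have "form_point c \<in> orbit_closure (form_point c)"
    by (rule subsetD [OF closure_of_subset_Int])
  then have "orbit_closure (form_point c) \<inter> orbit_closure (form_point c) \<noteq> {}"
    unfolding Int_absorb by (rule ex_in_conv [THEN iffD1, OF exI])
  then have "form_point c \<in> form_class (form_point c)"
    unfolding form_class_eq using locus by (intro CollectI conjI)
  then have "form_point c \<in> form_class (form_point c')"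
    using assms(2) unfolding moduli_point_eq by simp
  then have "orbit_closure (form_point c') \<inter> orbit_closure (form_point c) \<noteq> {}"
    unfolding form_class_eq by (elim CollectE conjE)
  then show ?thesis by (subst Int_commute)
qed

text \<open>The zero set of an invariant form is closed and stable under the group, so with an orbit
  it contains the closure.\<close>

lemma closure_vanish:
  assumes f: "invariant_form d f" and c: "c \<noteq> 0" "f (form c) = 0"
    and R: "R \<in> orbit_closure (form_point c)" "R = form_point r" "r \<noteq> 0"
  shows "f (form r) = 0"
proof (rule ccontr)
  assume nz: "f (form r) \<noteq> 0"
  \<comment> \<open>The condition is phrased through representatives because \<open>f\<close> lives
    on the cone; homogeneity makes it independent of the choice.\<close>
  define U where "U = {Q \<in> locus. \<exists>w. w \<noteq> 0 \<and> Q = form_point w \<and> f (form w) \<noteq> 0}"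
  have mem: "form_point w \<in> U \<longleftrightarrow> f (form w) \<noteq> 0" if w: "w \<in> semistable" for w
  proof
    assume "form_point w \<in> U"
    then obtain v where v: "v \<noteq> 0" "form_point w = form_point v" "f (form v) \<noteq> 0" unfolding U_def by blast
    then obtain a where "v = a *s w" using form_point_eq_iff by blast
    then show "f (form w) \<noteq> 0" using v(3) invariant_form_scale [OF f, of w a] w by (auto simp: semistable_def)
  qed (use w in \<open>auto simp: U_def semistable_def\<close>)
  have "openin (zariski semistable_space) U"
    unfolding openin_semistable_space
  proof
    show "openin (zariski coefficient_space) {w \<in> semistable. form_point w \<in> U}"
    proof -
      have "{w \<in> semistable. form_point w \<in> U} = semistable \<inter> {w \<in> UNIV - {0}. f (form w) \<noteq> 0}"
        using mem by (auto simp: semistable_def)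
      then show ?thesis
        using openin_Int [OF openin_semistable openin_affine_fspace_basis [OF invariant_form_poly [OF f]]] by simp
    qed
  qed (auto simp: U_def)
  have "R \<in> locus"
    using subsetD [OF closure_of_subset_topspace R(1)] unfolding points_semistable_space .
  then have "r \<in> semistable" using R(2,3) by (simp add: semistable_def)
  then have "R \<in> U" using mem nz R(2) by blast
  moreover note \<open>openin (zariski semistable_space) U\<close>
  moreover have "\<forall>T. R \<in> T \<and> openin (zariski semistable_space) T \<longrightarrow> (\<exists>y. y \<in> maps_orbit (form_point c) \<and> y \<in> T)"
    using R(1) unfolding in_closure_of by (rule conjunct2)
  ultimately obtain Q where Q: "Q \<in> maps_orbit (form_point c)" "Q \<in> U"
    by meson
  then obtain A where A: "A \<in> SL6_normalizer" "Q = proj_point scale_function (form_action A (form c))"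
    by (auto simp: image_form_action)
  obtain c' where c': "form_action A (form c) = form c'"
    using form_action_normalizer [OF A(1)] by metis
  have "f (form c') = 0"
    using f A(1) c unfolding invariant_form_def nonzero_forms_eq by (metis c' DiffI UNIV_I image_eqI singletonD)
  obtain w where w: "w \<noteq> 0" "form_point c' = form_point w" "f (form w) \<noteq> 0"
    using Q(2) A(2) c' unfolding U_def by auto
  then obtain a where a: "a \<noteq> 0" "w = a *s c'" using form_point_eq_iff by blast
  then have "c' \<noteq> 0" using w(1) by auto
  then show False using w(3) a invariant_form_scale [OF f, of c' a] \<open>f (form c') = 0\<close> by simp
qed

definition coeff_invariant :: "nat \<Rightarrow> (complex^4 \<Rightarrow> complex) \<Rightarrow> bool" where
  "coeff_invariant d g \<longleftrightarrow> g \<in> poly_functions coordinates \<and> (\<forall>a c. g (a *s c) = a ^ d * g c) \<and>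
     (\<forall>\<alpha> \<beta> \<gamma> \<delta> c. torus_relations \<alpha> \<beta> \<gamma> \<delta> \<longrightarrow>
        g (vec4 (\<alpha> * c$1) (\<beta> * c$2) (\<gamma> * c$3) (\<delta> * c$4)) = g c) \<and>
     (\<forall>c. g (vec4 (c$2) (c$1) (c$4) (c$3)) = g c)"

lemma coeff_invariant_imp:
  assumes g: "coeff_invariant d g"
  shows "invariant_form d (\<lambda>F. g (form_coeffs F))"
  unfolding invariant_form_def
proof (intro conjI ballI)
  show "(\<lambda>F. g (form_coeffs F)) \<in> poly_functions evaluations"
    using g unfolding coeff_invariant_def by (intro poly_functions_compose [OF _ form_coeffs_poly]) auto
  show "homogeneous_on scale_function nonzero_forms d (\<lambda>F. g (form_coeffs F))"
    using g unfolding coeff_invariant_def homogeneous_on_def nonzero_forms_eq by (auto simp: scale_form)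
  fix t w assume "t \<in> normalizer_maps" "w \<in> nonzero_forms"
  then obtain A c where A: "A \<in> SL6_normalizer" "t = form_action A" "w = form c"
    unfolding nonzero_forms_eq by blast
  obtain \<alpha> \<beta> \<gamma> \<delta> where rel: "torus_relations \<alpha> \<beta> \<gamma> \<delta>"
    "(\<forall>c. form_action A (form c) = form (vec4 (\<alpha> * c$1) (\<beta> * c$2) (\<gamma> * c$3) (\<delta> * c$4))) \<or>
     (\<forall>c. form_action A (form c) = form (vec4 (\<beta> * c$2) (\<alpha> * c$1) (\<delta> * c$4) (\<gamma> * c$3)))"
    by (rule form_action_normalizer [OF A(1)])
  have 1: "g (vec4 (\<alpha> * c$1) (\<beta> * c$2) (\<gamma> * c$3) (\<delta> * c$4)) = g c"
    using g rel(1) unfolding coeff_invariant_def by blast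
  have "g (vec4 (\<beta> * c$2) (\<alpha> * c$1) (\<delta> * c$4) (\<gamma> * c$3)) = g (vec4 (\<alpha> * c$1) (\<beta> * c$2) (\<gamma> * c$3) (\<delta> * c$4))"
    using g unfolding coeff_invariant_def by (metis vec4_nth)
  with 1 rel(2) show "g (form_coeffs (t w)) = g (form_coeffs w)"
    unfolding A(2,3) by auto
qed

text \<open>The torus has weights 1, -1, 3, -3, with basic invariant monomials c1 c2, c3 c4, c1^3 c4
  and c2^3 c3. The relations give (\<alpha> \<beta>)^3 = \<gamma> \<delta>, which is 1 or -1; this
  explains the powers and the mixed product \<open>inv_K\<close>. The exchange of the coefficients
  explains the sum \<open>inv_J\<close>.\<close>

definition inv_I :: "complex^4 \<Rightarrow> complex" where "inv_I c = (c$1 * c$2)^6"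
definition inv_J :: "complex^4 \<Rightarrow> complex" where "inv_J c = (c$1)^3 * c$4 + (c$2)^3 * c$3"
definition inv_K :: "complex^4 \<Rightarrow> complex" where "inv_K c = (c$1 * c$2)^3 * (c$3 * c$4)"
definition inv_L :: "complex^4 \<Rightarrow> complex" where "inv_L c = (c$3 * c$4)^2"

lemma coeff_invariant_generators:
  "coeff_invariant 12 inv_I" "coeff_invariant 4 inv_J" "coeff_invariant 8 inv_K" "coeff_invariant 4 inv_L"
proof -
  have poly: "inv_I \<in> poly_functions coordinates" "inv_J \<in> poly_functions coordinates"
    "inv_K \<in> poly_functions coordinates" "inv_L \<in> poly_functions coordinates"
    unfolding inv_I_def inv_J_def inv_K_def inv_L_def by (intro poly_function_intros)+
  have hom: "inv_I (a *s c) = a^12 * inv_I c" "inv_J (a *s c) = a^4 * inv_J c"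
    "inv_K (a *s c) = a^8 * inv_K c" "inv_L (a *s c) = a^4 * inv_L c" for a c
    unfolding inv_I_def inv_J_def inv_K_def inv_L_def by (simp_all add: vector_smult_component) algebra+
  have swap: "inv_I (vec4 (c$2) (c$1) (c$4) (c$3)) = inv_I c" "inv_J (vec4 (c$2) (c$1) (c$4) (c$3)) = inv_J c"
    "inv_K (vec4 (c$2) (c$1) (c$4) (c$3)) = inv_K c" "inv_L (vec4 (c$2) (c$1) (c$4) (c$3)) = inv_L c" for c
    unfolding inv_I_def inv_J_def inv_K_def inv_L_def by (simp_all add: mult_ac add_ac)
  have tor: "inv_I (vec4 (\<alpha> * c$1) (\<beta> * c$2) (\<gamma> * c$3) (\<delta> * c$4)) = inv_I c"
    "inv_J (vec4 (\<alpha> * c$1) (\<beta> * c$2) (\<gamma> * c$3) (\<delta> * c$4)) = inv_J c"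
    "inv_K (vec4 (\<alpha> * c$1) (\<beta> * c$2) (\<gamma> * c$3) (\<delta> * c$4)) = inv_K c"
    "inv_L (vec4 (\<alpha> * c$1) (\<beta> * c$2) (\<gamma> * c$3) (\<delta> * c$4)) = inv_L c"
    if "torus_relations \<alpha> \<beta> \<gamma> \<delta>" for \<alpha> \<beta> \<gamma> \<delta> c
  proof -
    have r: "\<alpha>^3 * \<delta> = 1" "\<beta>^3 * \<gamma> = 1" "(\<gamma> * \<delta>)^2 = 1" "(\<alpha> * \<beta>)^3 = \<gamma> * \<delta>"
      using that by (auto simp: torus_relations_def)
    have e: "(\<alpha> * c$1 * (\<beta> * c$2))^6 = ((\<alpha> * \<beta>)^3)^2 * (c$1 * c$2)^6"
      "(\<alpha> * c$1)^3 * (\<delta> * c$4) + (\<beta> * c$2)^3 * (\<gamma> * c$3) = (\<alpha>^3 * \<delta>) * ((c$1)^3 * c$4) + (\<beta>^3 * \<gamma>) * ((c$2)^3 * c$3)"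
      "(\<alpha> * c$1 * (\<beta> * c$2))^3 * (\<gamma> * c$3 * (\<delta> * c$4)) = ((\<alpha> * \<beta>)^3 * (\<gamma> * \<delta>)) * ((c$1 * c$2)^3 * (c$3 * c$4))"
      "(\<gamma> * c$3 * (\<delta> * c$4))^2 = (\<gamma> * \<delta>)^2 * (c$3 * c$4)^2"
      by algebra+
    have q: "((\<alpha> * \<beta>)^3)^2 = 1" "(\<alpha> * \<beta>)^3 * (\<gamma> * \<delta>) = 1"
      using r(3) unfolding r(4) by (simp_all add: power2_eq_square)
    show "inv_I (vec4 (\<alpha> * c$1) (\<beta> * c$2) (\<gamma> * c$3) (\<delta> * c$4)) = inv_I c"
      "inv_J (vec4 (\<alpha> * c$1) (\<beta> * c$2) (\<gamma> * c$3) (\<delta> * c$4)) = inv_J c"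
      "inv_K (vec4 (\<alpha> * c$1) (\<beta> * c$2) (\<gamma> * c$3) (\<delta> * c$4)) = inv_K c"
      "inv_L (vec4 (\<alpha> * c$1) (\<beta> * c$2) (\<gamma> * c$3) (\<delta> * c$4)) = inv_L c"
      unfolding inv_I_def inv_J_def inv_K_def inv_L_def vec4_nth e q r(1-3) by simp_all
  qed
  show "coeff_invariant 12 inv_I" "coeff_invariant 4 inv_J" "coeff_invariant 8 inv_K" "coeff_invariant 4 inv_L"
    unfolding coeff_invariant_def using poly hom swap tor by blast+
qed

lemma coeff_invariant_mult:
  "coeff_invariant d f \<Longrightarrow> coeff_invariant e g \<Longrightarrow> coeff_invariant (d + e) (\<lambda>c. f c * g c)"
  unfolding coeff_invariant_def by (simp add: poly_functions.mult power_add mult_ac)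

lemma coeff_invariant_power3:
  "coeff_invariant d f \<Longrightarrow> coeff_invariant (d + d + d) (\<lambda>c. f c ^ 3)"
  using coeff_invariant_mult [OF coeff_invariant_mult, of d f d f d f] by (simp add: power3_eq_cube)

text \<open>Invariants of equal degree are compared through the zeros of such a combination, since
  it is vanishing that passes to orbit closures.\<close>

lemma coeff_invariant_combination:
  "coeff_invariant d f \<Longrightarrow> coeff_invariant d g \<Longrightarrow> coeff_invariant d (\<lambda>c. f c - x * g c)"
  unfolding coeff_invariant_def
  by (simp add: poly_functions_diff poly_functions.mult poly_functions.const algebra_simps)

lemma poly_function_continuous: "f \<in> poly_functions coordinates \<Longrightarrow> continuous_on UNIV f"
proof (induction rule: poly_functions.induct)
  case (generator e)
  then show ?case unfolding coordinates_def by (auto intro!: continuous_intros)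
qed (auto intro!: continuous_intros)

text \<open>An unstable form degenerates to \<open>0\<close> under the torus, so every invariant vanishes on it.\<close>

lemma semistable_nonvanishing:
  assumes c: "c \<in> semistable"
  shows "c$1 \<noteq> 0 \<or> c$3 \<noteq> 0" "c$2 \<noteq> 0 \<or> c$4 \<noteq> 0"
proof -
  have c0: "c \<noteq> 0" using c by (simp add: semistable_def)
  then obtain d f where d: "d > 0" and f: "invariant_form d f" "f (form c) \<noteq> 0"
    using c semistable_iff by blast
  have torus: "f (form (vec4 (s * c$1) (c$2 / s) (s^3 * c$3) (c$4 / s^3))) = f (form c)" if s: "s \<noteq> 0" for s
  proof -
    obtain A where A: "A \<in> SL6_normalizer"
      "\<And>c. form_action A (form c) = form (vec4 (s * c$1) (c$2 / s) (s^3 * c$3) (c$4 / s^3))"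
      by (rule normalizer_torus [OF s]) blast
    have "form c \<in> nonzero_forms" using c0 by (simp add: nonzero_forms_eq)
    then have "f (form_action A (form c)) = f (form c)"
      using f(1) A(1) unfolding invariant_form_def by blast
    then show ?thesis unfolding A(2) .
  qed
  have zero: "f (form 0) = 0" using invariant_form_scale [OF f(1) c0, of 0] d by simp
  \<comment> \<open>A path that ends in the zero form while \<open>f\<close> keeps its nonzero value
    along it: at the end \<open>f\<close> is 0, because its degree is positive, against
    continuity.\<close>
  have lim: False if g: "\<And>r. r \<noteq> 0 \<Longrightarrow> f (form (g r)) = f (form c)" "g 0 = 0" "\<And>i. continuous_on UNIV (\<lambda>r. g r $ i)" for g :: "complex \<Rightarrow> complex^4"
  proof -
    have "continuous_on UNIV (\<lambda>r. \<chi> i. g r $ i)" by (rule continuous_on_vec_lambda) (rule g(3))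
    then have "continuous_on UNIV g" by simp
    then have "continuous_on UNIV (\<lambda>r. f (form (g r)))"
      by (rule continuous_on_compose2 [OF poly_function_continuous [OF invariant_form_poly [OF f(1)]]]) simp
    then have "isCont (\<lambda>r. f (form (g r))) 0" by (simp add: continuous_on_eq_continuous_at)
    then have "(\<lambda>r. f (form (g r))) \<midarrow>0\<rightarrow> f (form (g 0))" by (simp add: isCont_def)
    moreover have "(\<lambda>r. f (form (g r))) \<midarrow>0\<rightarrow> f (form c)"
      by (rule tendsto_eventually) (auto simp: eventually_at_filter g(1))
    ultimately have "f (form (g 0)) = f (form c)" by (rule LIM_unique)
    then show False using g(2) zero f(2) by simp
  qed
  show "c$1 \<noteq> 0 \<or> c$3 \<noteq> 0"
  proof (rule ccontr)
    assume "\<not> (c$1 \<noteq> 0 \<or> c$3 \<noteq> 0)"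
    then have 0: "c$1 = 0" "c$3 = 0" by auto
    show False
    proof (rule lim [of "\<lambda>r. vec4 0 (c$2 * r) 0 (c$4 * r^3)"])
      show "f (form (vec4 0 (c$2 * r) 0 (c$4 * r^3))) = f (form c)" if "r \<noteq> 0" for r
        using torus [of "1 / r"] that by (simp add: 0 power_one_over)
      show "vec4 0 (c$2 * 0) 0 (c$4 * 0^3) = 0" by (simp add: vec_eq_iff forall_4)
      have "\<forall>i. continuous_on UNIV (\<lambda>r. vec4 0 (c$2 * r) 0 (c$4 * r^3) $ i)"
        unfolding forall_4 by (auto intro!: continuous_intros)
      then show "continuous_on UNIV (\<lambda>r. vec4 0 (c$2 * r) 0 (c$4 * r^3) $ i)" for i by blast
    qed
  qed
  show "c$2 \<noteq> 0 \<or> c$4 \<noteq> 0"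
  proof (rule ccontr)
    assume "\<not> (c$2 \<noteq> 0 \<or> c$4 \<noteq> 0)"
    then have 0: "c$2 = 0" "c$4 = 0" by auto
    show False
    proof (rule lim [of "\<lambda>r. vec4 (r * c$1) 0 (r^3 * c$3) 0"])
      show "f (form (vec4 (r * c$1) 0 (r^3 * c$3) 0)) = f (form c)" if "r \<noteq> 0" for r
        using torus [of r] that by (simp add: 0)
      show "vec4 (0 * c$1) 0 (0^3 * c$3) 0 = 0" by (simp add: vec_eq_iff forall_4)
      have "\<forall>i. continuous_on UNIV (\<lambda>r. vec4 (r * c$1) 0 (r^3 * c$3) 0 $ i)"
        unfolding forall_4 by (auto intro!: continuous_intros)
      then show "continuous_on UNIV (\<lambda>r. vec4 (r * c$1) 0 (r^3 * c$3) 0 $ i)" for i by blast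
    qed
  qed
qed

section \<open>The slice of normalised forms\<close>

definition plane_coeffs :: "complex^2 \<Rightarrow> complex^4" where
  "plane_coeffs p = vec4 1 1 (p$1) (p$2)"

definition vec2 :: "complex \<Rightarrow> complex \<Rightarrow> complex^2" where
  "vec2 a b = (\<chi> i. if i = 1 then a else b)"

lemma vec2_nth [simp]: "vec2 a b $ 1 = a" "vec2 a b $ 2 = b"
  by (simp_all add: vec2_def)

lemma vec2_eq_iff: "p = q \<longleftrightarrow> p$1 = q$1 \<and> p$2 = (q :: complex^2)$2"
  by (simp add: vec_eq_iff forall_2)

text \<open>The torus-invariant coordinates on the locus \<open>c\<^sub>1 c\<^sub>2 \<noteq> 0\<close>, where the form can be normalised to
  \<open>c\<^sub>1 = c\<^sub>2 = 1\<close>.\<close>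

definition normal_params :: "complex^4 \<Rightarrow> complex^2" where
  "normal_params c = vec2 (c$3 * c$2 / (c$1)^2) (c$4 * c$1 / (c$2)^2)"

lemma normal_params_plane_coeffs [simp]: "normal_params (plane_coeffs p) = p"
  by (simp add: normal_params_def plane_coeffs_def vec2_eq_iff)

lemma cubic_family_eq_form: "cubic_family (p$1) (p$2) = form (plane_coeffs p)"
  by (simp add: fun_eq_iff cubic_family_def form_def plane_coeffs_def algebra_simps)

text \<open>The torus parameter with s^2 = c2 / c1 makes the first two coefficients equal, and
  dividing by their common value makes them 1.\<close>

lemma moduli_point_normal_params:
  assumes "c$1 \<noteq> 0" "c$2 \<noteq> 0"
  shows "moduli_point (plane_coeffs (normal_params c)) = moduli_point c"
proof -
  define s where "s = csqrt (c$2 / c$1)"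
  have s2: "s^2 = c$2 / c$1" by (simp add: s_def)
  then have s0: "s \<noteq> 0" using assms by auto
  define w where "w = s * c$1"
  have w0: "w \<noteq> 0" using s0 assms by (simp add: w_def)
  have c2: "c$2 = s^2 * c$1" using s2 assms by simp
  have "vec4 (s * c$1) (c$2 / s) (s^3 * c$3) (c$4 / s^3) = w *s plane_coeffs (normal_params c)"
  proof -
    have "c$2 / s = w" unfolding c2 w_def using s0 by (simp add: power2_eq_square)
    moreover have "s^3 * c$3 = w * (c$3 * c$2 / (c$1)^2)"
      unfolding c2 w_def using assms by (simp add: power2_eq_square power3_eq_cube)
    moreover have "c$4 / s^3 = w * (c$4 * c$1 / (c$2)^2)"
      unfolding c2 w_def using assms s0 by (simp add: power2_eq_square power3_eq_cube field_simps)
    ultimately show ?thesis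
      by (simp add: vec_eq_iff forall_4 plane_coeffs_def normal_params_def w_def)
  qed
  then have "moduli_point c = moduli_point (w *s plane_coeffs (normal_params c))"
    using moduli_point_torus [OF s0, of c] by simp
  then show ?thesis using moduli_point_scale [OF w0] by simp
qed

lemma invariant_nonvanishing_semistable:
  assumes g: "coeff_invariant d g" "d > 0" "c \<noteq> 0" "g c \<noteq> 0"
  shows "c \<in> semistable"
  using semistable_iff [OF g(3)] coeff_invariant_imp [OF g(1)] g(2,4) by (metis form_coeffs_form)

lemma semistable_of_nonzero:
  assumes "c$1 \<noteq> 0" "c$2 \<noteq> 0"
  shows "c \<in> semistable"
proof (rule invariant_nonvanishing_semistable [OF coeff_invariant_generators(1)])
  show "c \<noteq> 0" using assms by auto
  show "inv_I c \<noteq> 0" using assms by (simp add: inv_I_def)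
qed simp

lemma plane_coeffs_semistable: "plane_coeffs p \<in> semistable"
  by (rule semistable_of_nonzero) (simp_all add: plane_coeffs_def)

lemma coeff_closure_vanish:
  assumes "coeff_invariant d g" "c \<noteq> 0" "g c = 0" "form_point r \<in> orbit_closure (form_point c)" "r \<noteq> 0"
  shows "g r = 0"
  using closure_vanish [OF coeff_invariant_imp [OF assms(1)] assms(2) _ assms(4) refl assms(5)] assms(3) by simp

text \<open>A point \<open>r\<close> common to both closures carries the comparison: an invariant of
  degree 12 is the same multiple of \<open>inv_I\<close> at the slice point, at \<open>r\<close> and
  at \<open>c\<close>. On the slice \<open>inv_I\<close> is 1, which gives the multiples.\<close>

lemma moduli_point_eq_plane:
  assumes c: "c \<in> semistable" and eq: "moduli_point c = moduli_point (plane_coeffs p)"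
  shows "inv_I c \<noteq> 0" "inv_J c ^ 3 = (p$1 + p$2)^3 * inv_I c"
    "inv_K c * inv_J c = (p$1 + p$2) * (p$1 * p$2) * inv_I c"
    "inv_K c * inv_L c = (p$1 * p$2)^3 * inv_I c"
proof -
  obtain R where R: "R \<in> orbit_closure (form_point c)" "R \<in> orbit_closure (form_point (plane_coeffs p))"
    using moduli_point_eqD [OF c eq] by blast
  have "R \<in> locus" using subsetD [OF closure_of_subset_topspace R(1)] unfolding points_semistable_space .
  then obtain r where r: "r \<in> semistable" "R = form_point r" unfolding locus_eq by blast
  have nz: "r \<noteq> 0" "c \<noteq> 0" "plane_coeffs p \<noteq> 0"
    using r c plane_coeffs_semistable by (auto simp: semistable_def)
  note inv = coeff_invariant_generators
  have J: "coeff_invariant 12 (\<lambda>c. inv_J c ^ 3)" using coeff_invariant_power3 [OF inv(2)] by simp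
  have KJ: "coeff_invariant 12 (\<lambda>c. inv_K c * inv_J c)" using coeff_invariant_mult [OF inv(3,2)] by simp
  have KL: "coeff_invariant 12 (\<lambda>c. inv_K c * inv_L c)" using coeff_invariant_mult [OF inv(3,4)] by simp
  have LL: "coeff_invariant 12 (\<lambda>c. inv_L c ^ 3)" using coeff_invariant_power3 [OF inv(4)] by simp
  have p: "inv_I (plane_coeffs p) = 1" "inv_J (plane_coeffs p) = p$1 + p$2"
    "inv_K (plane_coeffs p) = p$1 * p$2" "inv_L (plane_coeffs p) = (p$1 * p$2)^2"
    by (simp_all add: inv_I_def inv_J_def inv_K_def inv_L_def plane_coeffs_def)
  have P: "g r = g (plane_coeffs p) * inv_I r" if g: "coeff_invariant 12 g" for g
    using coeff_closure_vanish [OF coeff_invariant_combination [OF g inv(1), of "g (plane_coeffs p)"] nz(3) _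
      R(2) [unfolded r(2)] nz(1)] by (simp add: p)
  \<comment> \<open>\<open>inv_J\<close> and \<open>inv_L\<close> enter through their cubes, which
    have degree 12. Vanishing of all three invariants would kill the first and third coefficients
    together or the second and fourth together, against semistability.\<close>
  have Ir: "inv_I r \<noteq> 0"
  proof
    assume 0: "inv_I r = 0"
    have "inv_J r = 0" "inv_L r = 0" using P [OF J] P [OF LL] 0 by simp_all
    with 0 have "(r$1)^3 * r$4 + (r$2)^3 * r$3 = 0" "r$1 = 0 \<or> r$2 = 0" "r$3 = 0 \<or> r$4 = 0"
      by (auto simp: inv_I_def inv_J_def inv_L_def)
    then show False using semistable_nonvanishing [OF r(1)] by auto
  qed
  show Ic: "inv_I c \<noteq> 0"
    using coeff_closure_vanish [OF inv(1) nz(2) _ R(1) [unfolded r(2)] nz(1)] Ir by blast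
  have C: "g c = g (plane_coeffs p) * inv_I c" if g: "coeff_invariant 12 g" for g
  proof -
    have "g r - (g c / inv_I c) * inv_I r = 0"
      using coeff_closure_vanish [OF coeff_invariant_combination [OF g inv(1), of "g c / inv_I c"] nz(2) _
        R(1) [unfolded r(2)] nz(1)] Ic by simp
    then have "g (plane_coeffs p) * inv_I r = (g c / inv_I c) * inv_I r" using P [OF g] by simp
    then show ?thesis using Ir Ic by (simp add: field_simps)
  qed
  show "inv_J c ^ 3 = (p$1 + p$2)^3 * inv_I c" using C [OF J] by (simp add: p)
  show "inv_K c * inv_J c = (p$1 + p$2) * (p$1 * p$2) * inv_I c" using C [OF KJ] by (simp add: p mult_ac)
  show "inv_K c * inv_L c = (p$1 * p$2)^3 * inv_I c" using C [OF KL] by (simp add: p power2_eq_square power3_eq_cube mult_ac)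
qed

subsection \<open>The action of the cyclic group\<close>

definition cyc :: "complex^2 \<Rightarrow> complex^2" where
  "cyc p = vec2 (omega3 * p$2) (omega3 * p$1)"

definition cyc_action :: "int \<Rightarrow> complex^2 \<Rightarrow> complex^2" where
  "cyc_action g = cyc ^^ nat g"

lemma cyc_power:
  "(cyc ^^ n) p = (if even n then omega3 ^ n *s p else omega3 ^ n *s vec2 (p$2) (p$1))"
  by (induction n) (auto simp: cyc_def vec2_eq_iff)

lemma omega3_power_6: "omega3 ^ 6 = 1"
proof -
  have "omega3 ^ 6 = (omega3 ^ 3)^2" by (simp flip: power_mult)
  then show ?thesis by (simp add: omega3_cube)
qed

lemma cyc_power_mod: "cyc ^^ (n mod 6) = cyc ^^ n"
proof
  fix p
  have "omega3 ^ n = omega3 ^ (6 * (n div 6) + n mod 6)" by simp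
  also have "\<dots> = omega3 ^ (n mod 6)" unfolding power_add power_mult omega3_power_6 by simp
  finally have "omega3 ^ (n mod 6) = omega3 ^ n" ..
  moreover have "even (n mod 6) \<longleftrightarrow> even n" by presburger
  ultimately show "(cyc ^^ (n mod 6)) p = (cyc ^^ n) p" by (simp add: cyc_power)
qed

lemma bij_cyc_power: "bij (cyc ^^ n)"
proof (rule o_bij)
  have 6: "cyc ^^ (6 * n) = id" using cyc_power_mod [of "6 * n"] by simp
  have "cyc ^^ (5 * n) \<circ> cyc ^^ n = cyc ^^ (6 * n)" "cyc ^^ n \<circ> cyc ^^ (5 * n) = cyc ^^ (6 * n)"
    by (simp_all flip: funpow_add)
  with 6 show "cyc ^^ (5 * n) \<circ> cyc ^^ n = id" "cyc ^^ n \<circ> cyc ^^ (5 * n) = id" by simp_all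
qed

lemma cyc_group_action: "group_action (integer_mod_group 6) (UNIV :: (complex^2) set) cyc_action"
proof -
  have "cyc_action \<in> hom (integer_mod_group 6) (BijGroup UNIV)"
  proof (rule homI)
    show "cyc_action x \<in> carrier (BijGroup UNIV)" for x
      using bij_cyc_power by (simp add: BijGroup_def Bij_def cyc_action_def)
    fix x y assume "x \<in> carrier (integer_mod_group 6)" "y \<in> carrier (integer_mod_group 6)"
    then have "0 \<le> x" "0 \<le> y" by (simp_all add: carrier_integer_mod_group)
    then have "nat ((x + y) mod 6) = (nat x + nat y) mod 6"
      by (simp add: nat_mod_distrib nat_add_distrib)
    then have "cyc_action ((x + y) mod 6) = cyc_action x \<circ> cyc_action y"
      unfolding cyc_action_def by (simp add: cyc_power_mod funpow_add)
    moreover have "x \<otimes>\<^bsub>integer_mod_group 6\<^esub> y = (x + y) mod 6" by (simp add: integer_mod_group_def)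
    moreover have "cyc_action x \<otimes>\<^bsub>BijGroup UNIV\<^esub> cyc_action y = cyc_action x \<circ> cyc_action y"
      using bij_cyc_power by (simp add: BijGroup_def Bij_def cyc_action_def compose_def fun_eq_iff)
    ultimately show "cyc_action (x \<otimes>\<^bsub>integer_mod_group 6\<^esub> y) = cyc_action x \<otimes>\<^bsub>BijGroup UNIV\<^esub> cyc_action y"
      by simp
  qed
  then show ?thesis
    unfolding group_action_def group_hom_def group_hom_axioms_def
    using group_integer_mod_group group_BijGroup by blast
qed

abbreviation cyc_orbit :: "complex^2 \<Rightarrow> (complex^2) set" where
  "cyc_orbit \<equiv> orbit (integer_mod_group 6) cyc_action"

lemma cyc_orbit_eq: "cyc_orbit p = {(cyc ^^ n) p | n. True}"
proof
  show "cyc_orbit p \<subseteq> {(cyc ^^ n) p | n. True}" by (auto simp: orbit_def cyc_action_def)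
  show "{(cyc ^^ n) p | n. True} \<subseteq> cyc_orbit p"
  proof
    fix q assume "q \<in> {(cyc ^^ n) p | n. True}"
    then obtain n where "q = (cyc ^^ n) p" by blast
    then have "q = cyc_action (int (n mod 6)) p" by (simp add: cyc_action_def cyc_power_mod)
    moreover have "int (n mod 6) \<in> carrier (integer_mod_group 6)" by (simp add: carrier_integer_mod_group)
    ultimately show "q \<in> cyc_orbit p" unfolding orbit_def by blast
  qed
qed

lemma cyc_orbit_eq_iff: "cyc_orbit p = cyc_orbit q \<longleftrightarrow> (\<exists>n. q = (cyc ^^ n) p)"
proof
  have "q \<in> cyc_orbit q" unfolding cyc_orbit_eq by (intro CollectI exI [of _ 0]) simp
  then show "cyc_orbit p = cyc_orbit q \<Longrightarrow> \<exists>n. q = (cyc ^^ n) p" unfolding cyc_orbit_eq by auto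
  assume "\<exists>n. q = (cyc ^^ n) p"
  then obtain n where q: "q = (cyc ^^ n) p" by blast
  have "cyc ^^ (5 * n) \<circ> cyc ^^ n = id"
    using cyc_power_mod [of "6 * n"] by (simp flip: funpow_add)
  then have p: "p = (cyc ^^ (5 * n)) q" unfolding q by (metis comp_apply id_apply)
  have "(cyc ^^ m) q = (cyc ^^ (m + n)) p" "(cyc ^^ m) p = (cyc ^^ (m + 5 * n)) q" for m
    using q p by (simp_all add: funpow_add)
  then show "cyc_orbit p = cyc_orbit q" unfolding cyc_orbit_eq by blast
qed

text \<open>Exchanging the coefficients and applying the diagonal element leads to (1, w, b, a) with
  w = \<open>omega3\<close>. Returning to the slice by \<open>normal_params\<close> multiplies both
  parameters by w, the second one through 1 / w^2 = w.\<close>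

lemma moduli_point_cyc: "moduli_point (plane_coeffs ((cyc ^^ n) p)) = moduli_point (plane_coeffs p)"
proof (induction n)
  case (Suc n)
  let ?q = "(cyc ^^ n) p"
  have 1: "moduli_point (vec4 1 omega3 (?q$2) (?q$1)) = moduli_point (plane_coeffs ?q)"
    using moduli_point_swap [of "plane_coeffs ?q"] moduli_point_diagonal [of "vec4 1 1 (?q$2) (?q$1)"]
    by (simp add: plane_coeffs_def)
  have w0: "omega3 \<noteq> 0" using omega3_cube by auto
  have inv: "1 / omega3^2 = omega3"
    using omega3_cube w0 by (simp add: field_simps power2_eq_square power3_eq_cube)
  have "x / omega3^2 = omega3 * x" for x
  proof -
    have "x / omega3^2 = (1 / omega3^2) * x" by simp
    then show ?thesis unfolding inv .
  qed
  then have "normal_params (vec4 1 omega3 (?q$2) (?q$1)) = cyc ?q"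
    by (simp add: normal_params_def cyc_def vec2_eq_iff mult.commute)
  then show ?case
    using moduli_point_normal_params [of "vec4 1 omega3 (?q$2) (?q$1)"] w0 1 Suc.IH by simp
qed simp

text \<open>A cube root of unity \<open>\<kappa>\<close> is produced that scales the sum by
  \<open>\<kappa>\<close> and the product by its square; then a' and b' are the roots of the same
  quadratic as \<kappa> a and \<kappa> b.\<close>

lemma cyc_orbit_of_invariants:
  fixes a b a' b' :: complex
  assumes "(a' + b')^3 = (a + b)^3" "(a' + b') * (a' * b') = (a + b) * (a * b)" "(a' * b')^3 = (a * b)^3"
  shows "\<exists>n. vec2 a' b' = (cyc ^^ n) (vec2 a b)"
proof -
  have "\<exists>\<kappa>. \<kappa>^3 = 1 \<and> a' + b' = \<kappa> * (a + b) \<and> a' * b' = \<kappa>^2 * (a * b)"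
  proof (cases "a + b = 0")
    case False
    define \<kappa> where "\<kappa> = (a' + b') / (a + b)"
    have \<kappa>3: "\<kappa>^3 = 1" using assms(1) False by (simp add: \<kappa>_def power_divide)
    have s: "a' + b' = \<kappa> * (a + b)" using False by (simp add: \<kappa>_def)
    have "(a + b) * (\<kappa> * (a' * b')) = (a + b) * (a * b)" using assms(2) unfolding s by (simp add: mult_ac)
    then have "\<kappa> * (a' * b') = a * b" using False by (simp only: mult_cancel_left) simp
    then have "\<kappa>^2 * (a * b) = \<kappa>^3 * (a' * b')" by (metis mult.assoc power2_eq_square power3_eq_cube)
    then show ?thesis using \<kappa>3 s by auto
  next
    case True
    then have True': "a' + b' = 0" using assms(1) by simp
    show ?thesis
    proof (cases "a * b = 0")
      case ab: True
      then have "(a' * b')^3 = 0" unfolding assms(3) by simp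
      then have "a' * b' = 0" unfolding power_eq_0_iff by (rule conjunct1)
      show ?thesis
        unfolding True True' ab \<open>a' * b' = 0\<close> by (rule exI [of _ 1]) simp
    next
      case False
      \<comment> \<open>With vanishing sums the ratio \<open>\<mu>\<close> of the products must be
        the square of the wanted root; since \<mu>^4 = \<mu>, that root can be taken to be
        \<mu>^2.\<close>
      define \<mu> where "\<mu> = a' * b' / (a * b)"
      have \<mu>3: "\<mu>^3 = 1" using assms(3) False by (simp add: \<mu>_def power_divide)
      have "(\<mu>^2)^2 = \<mu>^3 * \<mu>" by algebra
      then have 2: "(\<mu>^2)^2 = \<mu>" unfolding \<mu>3 by simp
      have "(\<mu>^2)^3 = (\<mu>^3)^2" by algebra
      then have 3: "(\<mu>^2)^3 = 1" unfolding \<mu>3 by simp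
      have "a' * b' = (\<mu>^2)^2 * (a * b)" unfolding 2 using False by (simp add: \<mu>_def)
      moreover have "a' + b' = \<mu>^2 * (a + b)" unfolding True True' by simp
      ultimately show ?thesis using 3 by blast
    qed
  qed
  then obtain \<kappa> where \<kappa>: "\<kappa>^3 = 1" "a' + b' = \<kappa> * (a + b)" "a' * b' = \<kappa>^2 * (a * b)" by blast
  have roots: "(a' - \<kappa> * a) * (a' - \<kappa> * b) = 0" using \<kappa>(2,3) by algebra
  have "(\<kappa> - 1) * (\<kappa> - omega3) * (\<kappa> - omega3^2) = 0"
    using \<kappa>(1) omega3_sum omega3_cube by algebra
  then consider "\<kappa> = omega3^0" | "\<kappa> = omega3^1" | "\<kappa> = omega3^2" by auto
  then obtain m where m: "\<kappa> = omega3^m" by metis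
  \<comment> \<open>Both exponents are \<open>m\<close> modulo 3; their parity decides whether the
    two parameters are exchanged.\<close>
  have w: "omega3^(4 * m) = \<kappa>" "omega3^(4 * m + 3) = \<kappa>"
  proof -
    have "omega3^(4 * m) = (omega3^3)^m * omega3^m" by (simp flip: power_mult power_add)
    then show "omega3^(4 * m) = \<kappa>" unfolding omega3_cube m by simp
    then show "omega3^(4 * m + 3) = \<kappa>" unfolding power_add omega3_cube by simp
  qed
  show ?thesis
  proof (cases "a' = \<kappa> * a")
    case True
    then have "b' = \<kappa> * b" using \<kappa>(2) by (simp add: distrib_left)
    then have "vec2 a' b' = (cyc ^^ (4 * m)) (vec2 a b)" using True by (simp add: cyc_power w vec2_eq_iff)
    then show ?thesis by blast
  next
    case False
    then have "a' = \<kappa> * b" using roots by simp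
    moreover from this have "b' = \<kappa> * a" using \<kappa>(2) by (simp add: distrib_left)
    ultimately have "vec2 a' b' = (cyc ^^ (4 * m + 3)) (vec2 a b)"
      unfolding cyc_power w by (simp add: vec2_eq_iff)
    then show ?thesis by blast
  qed
qed

lemma moduli_point_plane_eq_iff:
  "moduli_point (plane_coeffs p) = moduli_point (plane_coeffs q) \<longleftrightarrow> cyc_orbit p = cyc_orbit q"
proof
  assume eq: "moduli_point (plane_coeffs p) = moduli_point (plane_coeffs q)"
  note e = moduli_point_eq_plane(2-4) [OF plane_coeffs_semistable eq]
  have "vec2 (p$1) (p$2) = p" "vec2 (q$1) (q$2) = q" by (simp_all add: vec2_eq_iff)
  moreover have "\<exists>n. vec2 (p$1) (p$2) = (cyc ^^ n) (vec2 (q$1) (q$2))"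
  proof (rule cyc_orbit_of_invariants)
    show "(p$1 + p$2)^3 = (q$1 + q$2)^3" "(p$1 + p$2) * (p$1 * p$2) = (q$1 + q$2) * (q$1 * q$2)"
      "(p$1 * p$2)^3 = (q$1 * q$2)^3"
      using e by (simp_all add: inv_I_def inv_J_def inv_K_def inv_L_def plane_coeffs_def
          mult_ac add_ac power2_eq_square power3_eq_cube)
  qed
  ultimately have "cyc_orbit q = cyc_orbit p" unfolding cyc_orbit_eq_iff by simp
  then show "cyc_orbit p = cyc_orbit q" ..
next
  assume "cyc_orbit p = cyc_orbit q"
  then obtain n where "q = (cyc ^^ n) p" unfolding cyc_orbit_eq_iff by blast
  then show "moduli_point (plane_coeffs p) = moduli_point (plane_coeffs q)"
    using moduli_point_cyc by simp
qed

subsection \<open>The open immersion\<close>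

lemma poly_function_restrict_line:
  assumes "f \<in> poly_functions coordinates"
  shows "\<exists>q. \<forall>t. f (x + t *s v) = poly q t"
  using assms
proof induction
  case (const c)
  show ?case by (intro exI [of _ "[:c:]"]) simp
next
  case (generator e)
  then obtain i where "e = (\<lambda>v. v $ i)" unfolding coordinates_def by blast
  then show ?case by (intro exI [of _ "[:x $ i, v $ i:]"]) simp
next
  case (add f g)
  then obtain p q where "\<forall>t. f (x + t *s v) = poly p t" "\<forall>t. g (x + t *s v) = poly q t" by blast
  then show ?case by (intro exI [of _ "p + q"]) simp
next
  case (mult f g)
  then obtain p q where "\<forall>t. f (x + t *s v) = poly p t" "\<forall>t. g (x + t *s v) = poly q t" by blast
  then show ?case by (intro exI [of _ "p * q"]) simp
qed

text \<open>Irreducibility of affine space, read off on the line joining the two points: there both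
  functions are nonzero polynomials in one variable, with finitely many zeros altogether.\<close>

lemma poly_functions_common_nonzero:
  assumes "f \<in> poly_functions coordinates" "g \<in> poly_functions coordinates" "f x \<noteq> 0" "g y \<noteq> 0"
  shows "\<exists>z. f z \<noteq> 0 \<and> g z \<noteq> 0"
proof -
  obtain p where p: "\<And>t. f (x + t *s (y - x)) = poly p t" using poly_function_restrict_line [OF assms(1)] by blast
  obtain q where q: "\<And>t. g (x + t *s (y - x)) = poly q t" using poly_function_restrict_line [OF assms(2)] by blast
  have "poly p 0 \<noteq> 0" "poly q 1 \<noteq> 0" using p [of 0] q [of 1] assms(3,4) by simp_all
  then have "p * q \<noteq> 0" by auto
  then have "finite {t. poly (p * q) t = 0}" by (rule poly_roots_finite)
  then obtain t where "poly (p * q) t \<noteq> 0"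
    by (metis (mono_tags, lifting) ex_new_if_finite infinite_UNIV_char_0 mem_Collect_eq)
  then have "poly p t \<noteq> 0" "poly q t \<noteq> 0" by auto
  then show ?thesis using p [of t] q [of t] by metis
qed

lemma coefficient_space_opens_meet:
  assumes "openin (zariski coefficient_space) U" "openin (zariski coefficient_space) V" "U \<noteq> {}" "V \<noteq> {}"
  shows "U \<inter> V \<noteq> {}"
proof -
  obtain x y where xy: "x \<in> U" "y \<in> V" using assms by blast
  obtain f where f: "f \<in> poly_functions coordinates" "f x \<noteq> 0" "\<forall>z\<in>UNIV - {0}. f z \<noteq> 0 \<longrightarrow> z \<in> U"
    by (rule openin_affine_fspaceE [OF assms(1) xy(1)])
  obtain g where g: "g \<in> poly_functions coordinates" "g y \<noteq> 0" "\<forall>z\<in>UNIV - {0}. g z \<noteq> 0 \<longrightarrow> z \<in> V"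
    by (rule openin_affine_fspaceE [OF assms(2) xy(2)])
  have "x \<noteq> 0" using openin_affine_fspace_subset [OF assms(1)] xy by blast
  then obtain i where i: "x $ i \<noteq> 0" by (metis vec_eq_iff zero_index)
  \<comment> \<open>The additional coordinate factor keeps the common point away from the origin,
    which does not belong to the space.\<close>
  have "(\<lambda>z. f z * z $ i) \<in> poly_functions coordinates"
    using f(1) by (intro poly_function_intros)
  then obtain z where "f z * z $ i \<noteq> 0" "g z \<noteq> 0"
    using poly_functions_common_nonzero [of "\<lambda>z. f z * z $ i" g x y] g f i by auto
  then have "z \<noteq> 0" "f z \<noteq> 0" by auto
  then have "z \<in> U" "z \<in> V" using f(3) g(3) \<open>g z \<noteq> 0\<close> by auto
  then show ?thesis by blast
qed

lemma irreducible_F21_moduli: "irreducible_fspace F21_moduli"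
  unfolding irreducible_fspace_def
proof (intro conjI allI impI)
  show "points F21_moduli \<noteq> {}"
    unfolding points_F21_moduli using plane_coeffs_semistable by blast
  fix U V assume UV: "openin (zariski F21_moduli) U \<and> openin (zariski F21_moduli) V \<and> U \<noteq> {} \<and> V \<noteq> {}"
  then have "U \<subseteq> moduli_point ` semistable" "V \<subseteq> moduli_point ` semistable"
    and o: "openin (zariski coefficient_space) {c \<in> semistable. moduli_point c \<in> U}"
    "openin (zariski coefficient_space) {c \<in> semistable. moduli_point c \<in> V}"
    unfolding openin_F21_moduli by simp_all
  then have "{c \<in> semistable. moduli_point c \<in> U} \<noteq> {}" "{c \<in> semistable. moduli_point c \<in> V} \<noteq> {}"
    using UV by blast+
  from coefficient_space_opens_meet [OF o this] show "U \<inter> V \<noteq> {}" by blast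
qed

lemma rational_map_on_plane_coeffs: "rational_map_on coordinates coordinates D plane_coeffs"
proof (rule rational_map_on_polyI)
  have "\<forall>i. (\<lambda>p. plane_coeffs p $ i) \<in> poly_functions coordinates"
    unfolding forall_4 by (simp add: plane_coeffs_def poly_functions.const coordinate_poly_function)
  then show "e \<in> coordinates \<Longrightarrow> (\<lambda>x. e (plane_coeffs x)) \<in> poly_functions coordinates" for e
    unfolding coordinates_def by auto
qed

definition normal_locus :: "(complex^4) set" where
  "normal_locus = {c. c$1 \<noteq> 0 \<and> c$2 \<noteq> 0}"

lemma rational_map_on_normal_params:
  assumes "D \<subseteq> normal_locus"
  shows "rational_map_on coordinates coordinates D normal_params"
  unfolding rational_map_on_def
proof (intro bexI [of _ "\<lambda>c. c$1 * c$2"] conjI ballI)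
  show "c$1 * c$2 \<noteq> 0" if "c \<in> D" for c using that assms by (auto simp: normal_locus_def)
  fix e :: "complex^2 \<Rightarrow> complex" assume "e \<in> coordinates"
  then obtain i where e: "e = (\<lambda>v. v $ i)" unfolding coordinates_def by blast
  have 1: "normal_params c $ 1 * (c$1 * c$2)^2 = c$3 * (c$2)^3" "normal_params c $ 2 * (c$1 * c$2)^2 = c$4 * (c$1)^3"
    if "c \<in> D" for c
  proof -
    have "c$1 \<noteq> 0" "c$2 \<noteq> 0" using that assms by (auto simp: normal_locus_def)
    then show "normal_params c $ 1 * (c$1 * c$2)^2 = c$3 * (c$2)^3" "normal_params c $ 2 * (c$1 * c$2)^2 = c$4 * (c$1)^3"
      by (simp_all add: normal_params_def power_mult_distrib power2_eq_square power3_eq_cube)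
  qed
  have "(\<lambda>c :: complex^4. c$3 * (c$2)^3) \<in> poly_functions coordinates"
    "(\<lambda>c :: complex^4. c$4 * (c$1)^3) \<in> poly_functions coordinates"
    by (intro poly_function_intros)+
  note p = this
  have "i = 1 \<or> i = 2" by (rule exhaust_2)
  then show "\<exists>k. \<exists>g\<in>poly_functions coordinates. \<forall>c\<in>D. e (normal_params c) * (c$1 * c$2)^k = g c"
  proof
    assume "i = 1"
    then show ?thesis unfolding e using 1(1) by (intro exI [of _ 2] bexI [OF _ p(1)] ballI) simp
  next
    assume "i = 2"
    then show ?thesis unfolding e using 1(2) by (intro exI [of _ 2] bexI [OF _ p(2)] ballI) simp
  qed
qed (intro poly_function_intros)

lemma openin_normal_locus: "openin (zariski coefficient_space) normal_locus"
proof -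
  have "(\<lambda>c :: complex^4. c$1 * c$2) \<in> poly_functions coordinates" by (intro poly_function_intros)
  from openin_affine_fspace_basis [OF this, of "UNIV - {0}"]
  have "openin (zariski coefficient_space) {c \<in> UNIV - {0}. c$1 * c$2 \<noteq> 0}" .
  also have "{c :: complex^4 \<in> UNIV - {0}. c$1 * c$2 \<noteq> 0} = normal_locus"
    by (auto simp: normal_locus_def)
  finally show ?thesis .
qed

abbreviation plane_quotient where
  "plane_quotient \<equiv> quotient_fspace cyc_orbit affine_plane"

lemma plane_quotient_simps:
  "points plane_quotient = range cyc_orbit"
  "openin (zariski plane_quotient) U \<longleftrightarrow> U \<subseteq> range cyc_orbit \<and> openin (zariski affine_plane) {p. cyc_orbit p \<in> U}"
  "\<phi> \<in> regular plane_quotient U \<longleftrightarrow> \<phi> \<circ> cyc_orbit \<in> regular affine_plane {p. cyc_orbit p \<in> U}"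
  unfolding openin_quotient_fspace by simp_all

definition embed :: "(complex^2) set \<Rightarrow> (complex^6 \<Rightarrow> complex) set set" where
  "embed Q = moduli_point (plane_coeffs (SOME p. cyc_orbit p = Q))"

lemma embed_orbit: "embed (cyc_orbit p) = moduli_point (plane_coeffs p)"
proof -
  have "cyc_orbit (SOME q. cyc_orbit q = cyc_orbit p) = cyc_orbit p" by (rule someI [of _ p]) simp
  then show ?thesis unfolding embed_def moduli_point_plane_eq_iff .
qed

text \<open>Nonvanishing of \<open>inv_I\<close> is shared by all semistable forms in the class of a
  slice point, so such a form lies where \<open>normal_params\<close> is defined, and its class is
  that of its normalised form.\<close>

lemma embed_preimage:
  assumes U: "U \<subseteq> range cyc_orbit"
  shows "{c \<in> semistable. moduli_point c \<in> embed ` U} = {c \<in> normal_locus. normal_params c \<in> {p. cyc_orbit p \<in> U}}"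
proof (intro equalityI subsetI CollectI conjI)
  fix c assume "c \<in> {c \<in> semistable. moduli_point c \<in> embed ` U}"
  then obtain Q where c: "c \<in> semistable" "Q \<in> U" "moduli_point c = embed Q" by blast
  then obtain p where p: "Q = cyc_orbit p" using U by blast
  have eq: "moduli_point c = moduli_point (plane_coeffs p)" using c(3) unfolding p embed_orbit .
  have "inv_I c \<noteq> 0" by (rule moduli_point_eq_plane(1) [OF c(1) eq])
  then have nz: "c$1 \<noteq> 0" "c$2 \<noteq> 0" by (auto simp: inv_I_def)
  then show "c \<in> normal_locus" by (simp add: normal_locus_def)
  have "cyc_orbit (normal_params c) = cyc_orbit p"
    using moduli_point_normal_params [OF nz] eq unfolding moduli_point_plane_eq_iff [symmetric] by simp
  then show "cyc_orbit (normal_params c) \<in> U" using c(2) p by simp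
next
  fix c assume c: "c \<in> {c \<in> normal_locus. normal_params c \<in> {p. cyc_orbit p \<in> U}}"
  then have nz: "c$1 \<noteq> 0" "c$2 \<noteq> 0" by (auto simp: normal_locus_def)
  show "c \<in> semistable" by (rule semistable_of_nonzero [OF nz])
  have "moduli_point c = embed (cyc_orbit (normal_params c))"
    unfolding embed_orbit moduli_point_normal_params [OF nz] ..
  then show "moduli_point c \<in> embed ` U" using c by blast
qed

lemma openin_plane_preimage:
  assumes "openin (zariski coefficient_space) C"
  shows "openin (zariski affine_plane) {p. plane_coeffs p \<in> C}"
proof -
  have "openin (zariski affine_plane) {p \<in> UNIV. plane_coeffs p \<in> C}"
    by (rule openin_rational_preimage [OF rational_map_on_plane_coeffs _ openin_whole assms])
      (use plane_coeffs_semistable in \<open>auto simp: semistable_def\<close>)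
  then show ?thesis by simp
qed

lemma regular_plane_pullback:
  assumes "\<psi> \<in> regular coefficient_space C"
  shows "\<psi> \<circ> plane_coeffs \<in> regular affine_plane {p. plane_coeffs p \<in> C}"
  by (rule regular_rational_pullback [OF rational_map_on_plane_coeffs _ openin_whole _ assms])
    (use plane_coeffs_semistable in \<open>auto simp: semistable_def\<close>)

text \<open>\<open>plane_coeffs\<close> and \<open>normal_params\<close> are morphisms, inverse to
  each other up to classes. Pulling back along one or the other transfers open sets and regular
  functions in both directions.\<close>

lemma open_immersion_embed: "open_immersion plane_quotient F21_moduli embed"
  unfolding open_immersion_def
proof (intro conjI allI impI)
  show "inj_on embed (points plane_quotient)"
    unfolding plane_quotient_simps(1) using moduli_point_plane_eq_iff by (auto simp: inj_on_def embed_orbit)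
  show "continuous_map (zariski plane_quotient) (zariski F21_moduli) embed"
    unfolding continuous_map_def
  proof (intro conjI allI impI)
    show "embed \<in> points plane_quotient \<rightarrow> points F21_moduli"
      unfolding plane_quotient_simps(1) points_F21_moduli
      using plane_coeffs_semistable by (auto simp: embed_orbit)
    fix U assume "openin (zariski F21_moduli) U"
    then have "openin (zariski coefficient_space) {c \<in> semistable. moduli_point c \<in> U}"
      unfolding openin_F21_moduli by simp
    from openin_plane_preimage [OF this]
    have "openin (zariski affine_plane) {p. moduli_point (plane_coeffs p) \<in> U}"
      using plane_coeffs_semistable by simp
    moreover have "{p. cyc_orbit p \<in> {Q \<in> points plane_quotient. embed Q \<in> U}} = {p. moduli_point (plane_coeffs p) \<in> U}"
      unfolding plane_quotient_simps(1) by (auto simp: embed_orbit)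
    ultimately show "openin (zariski plane_quotient) {Q \<in> points plane_quotient. embed Q \<in> U}"
      unfolding plane_quotient_simps(2) by (simp add: plane_quotient_simps(1))
  qed
  show "open_map (zariski plane_quotient) (zariski F21_moduli) embed"
    unfolding open_map_def
  proof (intro allI impI)
    fix U assume "openin (zariski plane_quotient) U"
    then have U: "U \<subseteq> range cyc_orbit" "openin (zariski affine_plane) {p. cyc_orbit p \<in> U}"
      unfolding plane_quotient_simps(2) by simp_all
    show "openin (zariski F21_moduli) (embed ` U)"
      unfolding openin_F21_moduli embed_preimage [OF U(1)]
    proof
      show "embed ` U \<subseteq> moduli_point ` semistable"
        using U(1) plane_coeffs_semistable by (auto simp: embed_orbit)
      show "openin (zariski coefficient_space) {c \<in> normal_locus. normal_params c \<in> {p. cyc_orbit p \<in> U}}"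
        by (rule openin_rational_preimage [OF rational_map_on_normal_params [OF subset_refl] _ openin_normal_locus U(2)]) simp
    qed
  qed
  fix U \<phi> assume "openin (zariski plane_quotient) U"
  then have U: "U \<subseteq> range cyc_orbit" "openin (zariski affine_plane) {p. cyc_orbit p \<in> U}"
    unfolding plane_quotient_simps(2) by simp_all
  show "\<phi> \<in> regular F21_moduli (embed ` U) \<longleftrightarrow> \<phi> \<circ> embed \<in> regular plane_quotient U"
    unfolding regular_F21_moduli plane_quotient_simps(3)
  proof
    assume "\<phi> \<circ> moduli_point \<in> regular coefficient_space {c \<in> semistable. moduli_point c \<in> embed ` U}"
    from regular_plane_pullback [OF this]
    have "\<phi> \<circ> moduli_point \<circ> plane_coeffs \<in> regular affine_plane
        {p. plane_coeffs p \<in> {c \<in> normal_locus. normal_params c \<in> {p. cyc_orbit p \<in> U}}}"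
      unfolding embed_preimage [OF U(1)] .
    moreover have "{p. plane_coeffs p \<in> {c \<in> normal_locus. normal_params c \<in> {p. cyc_orbit p \<in> U}}} = {p. cyc_orbit p \<in> U}"
      by (auto simp: normal_locus_def) (simp_all add: plane_coeffs_def)
    moreover have "\<phi> \<circ> moduli_point \<circ> plane_coeffs = \<phi> \<circ> embed \<circ> cyc_orbit"
      by (simp add: fun_eq_iff embed_orbit)
    ultimately show "\<phi> \<circ> embed \<circ> cyc_orbit \<in> regular affine_plane {p. cyc_orbit p \<in> U}" by simp
  next
    assume "\<phi> \<circ> embed \<circ> cyc_orbit \<in> regular affine_plane {p. cyc_orbit p \<in> U}"
    from regular_rational_pullback [OF rational_map_on_normal_params [OF subset_refl] _ openin_normal_locus refl this]
    have "\<phi> \<circ> embed \<circ> cyc_orbit \<circ> normal_params \<in> regular coefficient_space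
        {c \<in> normal_locus. normal_params c \<in> {p. cyc_orbit p \<in> U}}" by simp
    moreover have "(\<phi> \<circ> embed \<circ> cyc_orbit \<circ> normal_params) c = (\<phi> \<circ> moduli_point) c"
      if "c \<in> {c \<in> normal_locus. normal_params c \<in> {p. cyc_orbit p \<in> U}}" for c
      using that moduli_point_normal_params [of c] by (simp add: normal_locus_def embed_orbit)
    ultimately show "\<phi> \<circ> moduli_point \<in> regular coefficient_space {c \<in> semistable. moduli_point c \<in> embed ` U}"
      unfolding embed_preimage [OF U(1)]
      using regular_affine_fspace_cong by blast
  qed
qed

subsection \<open>Averaging over the cyclic group\<close>

definition root_sum :: "complex^2 \<Rightarrow> complex" where "root_sum p = p$1 + p$2"

text \<open>The factor \<open>(root_sum p)^2\<close> makes the cube roots of unity cancel, so that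
  only the sign of the exchange remains.\<close>

definition root_diff :: "complex^2 \<Rightarrow> complex" where "root_diff p = (p$1 - p$2) * (root_sum p)^2"

definition cyc_invariants :: "complex^2 \<Rightarrow> complex^2" where
  "cyc_invariants p = vec2 ((root_sum p)^3) (root_sum p * (p$1 * p$2))"

lemma root_sum_cyc: "root_sum ((cyc ^^ n) p) = omega3^n * root_sum p"
  by (simp add: cyc_power root_sum_def algebra_simps)

lemma omega3_power_3: "(omega3^n)^3 = 1"
  by (metis mult.commute omega3_cube power_mult power_one)

lemma root_diff_cyc: "root_diff ((cyc ^^ n) p) = (-1)^n * root_diff p"
proof -
  let ?w = "omega3 ^ n"
  have d: "((cyc ^^ n) p) $ 1 - ((cyc ^^ n) p) $ 2 = (-1)^n * (?w * (p$1 - p$2))"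
    by (simp add: cyc_power algebra_simps)
  have "root_diff ((cyc ^^ n) p) = ?w^3 * ((-1)^n * root_diff p)"
    unfolding root_diff_def root_sum_cyc d by (simp add: power2_eq_square power3_eq_cube)
  then show ?thesis unfolding omega3_power_3 by simp
qed

lemma cyc_invariants_cyc: "cyc_invariants ((cyc ^^ n) p) = cyc_invariants p"
proof -
  let ?w = "omega3 ^ n"
  have m: "((cyc ^^ n) p) $ 1 * ((cyc ^^ n) p) $ 2 = ?w^2 * (p$1 * p$2)"
    by (simp add: cyc_power power2_eq_square)
  have "(root_sum ((cyc ^^ n) p))^3 = ?w^3 * (root_sum p)^3"
    "root_sum ((cyc ^^ n) p) * (((cyc ^^ n) p) $ 1 * ((cyc ^^ n) p) $ 2) = ?w^3 * (root_sum p * (p$1 * p$2))"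
    unfolding root_sum_cyc m by (simp_all add: power2_eq_square power3_eq_cube)
  then show ?thesis unfolding cyc_invariants_def omega3_power_3 by simp
qed

lemma root_diff_square:
  "(root_diff p)^2 = cyc_invariants p $ 1 * (cyc_invariants p $ 1 - 4 * cyc_invariants p $ 2)"
  unfolding root_diff_def cyc_invariants_def root_sum_def vec2_nth by algebra

text \<open>The module generated over the invariants by the powers of \<open>root_sum\<close> and \<open>root_diff\<close>, on which
  the cyclic group acts by characters.\<close>

inductive_set character_sums :: "(complex^2 \<Rightarrow> complex) set" where
  base: "g \<in> poly_functions coordinates \<Longrightarrow>
    (\<lambda>p. g (cyc_invariants p) * root_sum p ^ k * root_diff p ^ l) \<in> character_sums"
| add: "F \<in> character_sums \<Longrightarrow> G \<in> character_sums \<Longrightarrow> (\<lambda>p. F p + G p) \<in> character_sums"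

lemma character_sums_mult_base:
  assumes "F \<in> character_sums" "g \<in> poly_functions coordinates"
  shows "(\<lambda>p. F p * (g (cyc_invariants p) * root_sum p ^ k * root_diff p ^ l)) \<in> character_sums"
  using assms(1)
proof induction
  case (base h i j)
  have "(\<lambda>x. h x * g x) \<in> poly_functions coordinates" using base assms(2) by (rule poly_functions.mult)
  from character_sums.base [OF this, of "i + k" "j + l"] show ?case
    by (simp add: power_add mult_ac)
next
  case (add F G)
  from character_sums.add [OF add.IH] show ?case by (simp add: distrib_right)
qed

lemma character_sums_mult:
  assumes "F \<in> character_sums" "G \<in> character_sums"
  shows "(\<lambda>p. F p * G p) \<in> character_sums"
  using assms(2)
proof induction
  case (base g k l)
  then show ?case by (rule character_sums_mult_base [OF assms(1)])
next
  case (add G H)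
  from character_sums.add [OF add.IH] show ?case by (simp add: distrib_left)
qed

lemma character_sums_invariant:
  "g \<in> poly_functions coordinates \<Longrightarrow> (\<lambda>p. g (cyc_invariants p)) \<in> character_sums"
  using character_sums.base [of g 0 0] by simp

text \<open>With s = \<open>root_sum p\<close> and d = \<open>root_diff p\<close>, twice the first
  coordinate times s^3 is s s^3 + s d, and for the second coordinate the sign of s d changes. So the
  coordinates lie in the module once s^3, the first invariant, is inverted.\<close>

lemma poly_function_character_sum:
  assumes "f \<in> poly_functions coordinates"
  shows "\<exists>N. (\<lambda>p. f p * (cyc_invariants p $ 1)^N) \<in> character_sums"
  using assms
proof induction
  case (const c)
  show ?case
    using character_sums_invariant [OF poly_functions.const [of c]] by (intro exI [of _ 0]) simp
next
  case (generator e)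
  then obtain i where e: "e = (\<lambda>v. v $ i)" unfolding coordinates_def by blast
  have g: "(\<lambda>v :: complex^2. (inverse 2) * v$1) \<in> poly_functions coordinates"
    "(\<lambda>v :: complex^2. inverse 2) \<in> poly_functions coordinates"
    "(\<lambda>v :: complex^2. - inverse 2) \<in> poly_functions coordinates" by (intro poly_function_intros)+
  have "(\<lambda>p. (inverse 2) * cyc_invariants p $ 1 * root_sum p ^ 1 * root_diff p ^ 0
      + (inverse 2) * root_sum p ^ 1 * root_diff p ^ 1) \<in> character_sums"
    "(\<lambda>p. (inverse 2) * cyc_invariants p $ 1 * root_sum p ^ 1 * root_diff p ^ 0
      + (- inverse 2) * root_sum p ^ 1 * root_diff p ^ 1) \<in> character_sums"
    using character_sums.add [OF character_sums.base [OF g(1), of 1 0] character_sums.base [OF g(2), of 1 1]]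
      character_sums.add [OF character_sums.base [OF g(1), of 1 0] character_sums.base [OF g(3), of 1 1]] by simp_all
  moreover have "(inverse 2) * cyc_invariants p $ 1 * root_sum p ^ 1 * root_diff p ^ 0
      + (inverse 2) * root_sum p ^ 1 * root_diff p ^ 1 = p $ 1 * (cyc_invariants p $ 1)^1"
    "(inverse 2) * cyc_invariants p $ 1 * root_sum p ^ 1 * root_diff p ^ 0
      + (- inverse 2) * root_sum p ^ 1 * root_diff p ^ 1 = p $ 2 * (cyc_invariants p $ 1)^1" for p
    by (simp_all add: cyc_invariants_def root_diff_def root_sum_def power2_eq_square power3_eq_cube field_simps)
  ultimately have "(\<lambda>p. p $ 1 * (cyc_invariants p $ 1)^1) \<in> character_sums"
    "(\<lambda>p. p $ 2 * (cyc_invariants p $ 1)^1) \<in> character_sums" by (simp_all only:)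
  then show ?case unfolding e using exhaust_2 [of i] by blast
next
  case (add f g)
  then obtain M N where M: "(\<lambda>p. f p * (cyc_invariants p $ 1)^M) \<in> character_sums"
    and N: "(\<lambda>p. g p * (cyc_invariants p $ 1)^N) \<in> character_sums" by blast
  have pow: "(\<lambda>p. (cyc_invariants p $ 1)^n) \<in> character_sums" for n
    by (rule character_sums_invariant [of "\<lambda>v. (v $ 1)^n"]) (intro poly_function_intros)
  from character_sums.add [OF character_sums_mult [OF M pow [of N]] character_sums_mult [OF N pow [of M]]]
  show ?case by (intro exI [of _ "M + N"]) (simp add: power_add algebra_simps)
next
  case (mult f g)
  then obtain M N where M: "(\<lambda>p. f p * (cyc_invariants p $ 1)^M) \<in> character_sums"
    and N: "(\<lambda>p. g p * (cyc_invariants p $ 1)^N) \<in> character_sums" by blast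
  from character_sums_mult [OF this]
  show ?case by (intro exI [of _ "M + N"]) (simp add: power_add mult_ac)
qed

text \<open>The sum is not divided by 6, a factor that cancels in fractions.\<close>

definition average :: "(complex^2 \<Rightarrow> complex) \<Rightarrow> complex^2 \<Rightarrow> complex" where
  "average f p = (\<Sum>n<6. f ((cyc ^^ n) p))"

text \<open>On a product of powers the generator acts by a sixth root of unity
  \<open>\<theta>\<close>, and the sum of its powers is 0 unless it is 1. In that case 3 divides
  \<open>k\<close> and 2 divides \<open>l\<close>, and the product is a polynomial in the
  invariants.\<close>

lemma average_character_sum:
  assumes "F \<in> character_sums"
  shows "\<exists>g\<in>poly_functions coordinates. \<forall>p. average F p = g (cyc_invariants p)"
  using assms
proof induction
  case (base g k l)
  define \<theta> where "\<theta> = omega3^k * (-1)^l"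
  have "average (\<lambda>p. g (cyc_invariants p) * root_sum p ^ k * root_diff p ^ l) p
      = (\<Sum>n<6. \<theta>^n) * (g (cyc_invariants p) * root_sum p ^ k * root_diff p ^ l)" for p
    unfolding average_def cyc_invariants_cyc root_sum_cyc root_diff_cyc sum_distrib_right
    by (intro sum.cong refl)
      (simp add: \<theta>_def power_mult_distrib mult_ac flip: power_mult)
  note av = this
  have "\<theta>^6 = (omega3^6)^k * ((-1)^2)^(3 * l)"
    unfolding \<theta>_def power_mult_distrib power_mult [symmetric] by (simp add: mult_ac)
  then have \<theta>6: "\<theta>^6 = 1" unfolding omega3_power_6 by simp
  show ?case
  proof (cases "\<theta> = 1")
    case False
    then have "(\<Sum>n<6. \<theta>^n) = 0" using geometric_sum [of \<theta> 6] \<theta>6 by simp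
    then show ?thesis unfolding av by (intro bexI [of _ "\<lambda>_. 0"] poly_functions.const) simp
  next
    case True
    \<comment> \<open>Cubing removes the contribution of \<open>omega3\<close> and isolates the
      sign.\<close>
    have "\<theta>^3 = (omega3^k)^3 * ((-1)^l)^3" by (simp add: \<theta>_def power_mult_distrib)
    then have "(-1)^l = (1 :: complex)"
      unfolding omega3_power_3 True by (cases "even l") auto
    then have "even l" by (cases "even l") auto
    then obtain j where j: "l = 2 * j" by (elim evenE)
    have wk: "omega3^k = 1" using True \<open>(-1)^l = (1 :: complex)\<close> by (simp add: \<theta>_def)
    have "omega3^k = omega3^(3 * (k div 3) + k mod 3)" by simp
    also have "\<dots> = omega3^(k mod 3)" unfolding power_add power_mult omega3_cube by simp
    finally have wm: "omega3^(k mod 3) = 1" using wk by simp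
    have "omega3^2 \<noteq> 1" using omega3_sum omega3_cube omega3_neq_1
      by (metis mult.right_neutral mult_1 power2_eq_square power3_eq_cube)
    then have "k mod 3 \<noteq> 1" "k mod 3 \<noteq> 2" using wm omega3_neq_1 by auto
    then have "3 dvd k" by presburger
    then obtain i where i: "k = 3 * i" by (elim dvdE)
    have "g (cyc_invariants p) * root_sum p ^ k * root_diff p ^ l =
       g (cyc_invariants p) * (cyc_invariants p $ 1)^i *
         (cyc_invariants p $ 1 * (cyc_invariants p $ 1 - 4 * cyc_invariants p $ 2))^j" for p
      unfolding i j power_mult root_diff_square by (simp add: cyc_invariants_def)
    then have "average (\<lambda>p. g (cyc_invariants p) * root_sum p ^ k * root_diff p ^ l) p =
       6 * (g (cyc_invariants p) * (cyc_invariants p $ 1)^i *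
         (cyc_invariants p $ 1 * (cyc_invariants p $ 1 - 4 * cyc_invariants p $ 2))^j)" for p
      unfolding av True by simp
    moreover have "(\<lambda>v. 6 * (g v * (v$1)^i * (v$1 * (v$1 - 4 * v$2))^j)) \<in> poly_functions coordinates"
      using base by (intro poly_function_intros)
    ultimately show ?thesis
      by (intro bexI [of _ "\<lambda>v. 6 * (g v * (v$1)^i * (v$1 * (v$1 - 4 * v$2))^j)"]) auto
  qed
next
  case (add F G)
  then obtain f g where "f \<in> poly_functions coordinates" "\<forall>p. average F p = f (cyc_invariants p)"
    "g \<in> poly_functions coordinates" "\<forall>p. average G p = g (cyc_invariants p)" by blast
  moreover have "average (\<lambda>p. F p + G p) p = average F p + average G p" for p
    by (simp add: average_def sum.distrib)
  ultimately show ?case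
    by (intro bexI [of _ "\<lambda>v. f v + g v"] poly_functions.add) auto
qed

lemma average_poly_function:
  assumes "f \<in> poly_functions coordinates"
  shows "\<exists>N. \<exists>g\<in>poly_functions coordinates. \<forall>p. average f p * (cyc_invariants p $ 1)^N = g (cyc_invariants p)"
proof -
  obtain N where N: "(\<lambda>p. f p * (cyc_invariants p $ 1)^N) \<in> character_sums"
    using poly_function_character_sum [OF assms] by blast
  from average_character_sum [OF this] obtain g where g: "g \<in> poly_functions coordinates"
    "\<forall>p. average (\<lambda>p. f p * (cyc_invariants p $ 1)^N) p = g (cyc_invariants p)" by blast
  have "average (\<lambda>p. f p * (cyc_invariants p $ 1)^N) p = average f p * (cyc_invariants p $ 1)^N" for p
    by (simp add: average_def cyc_invariants_cyc sum_distrib_right)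
  with g show ?thesis by (intro exI [of _ N] bexI [of _ g]) auto
qed

text \<open>Interpolation, one point at a time: a coordinate in which \<open>p\<close> differs from
  the new point gives a linear factor with value 1 at \<open>p\<close> and 0 there.\<close>

lemma poly_function_separating:
  fixes p :: "complex^'n"
  assumes "finite S" "p \<notin> S"
  shows "\<exists>k\<in>poly_functions coordinates. k p = 1 \<and> (\<forall>q\<in>S. k q = 0)"
  using assms
proof (induction S)
  case empty
  show ?case by (intro bexI [of _ "\<lambda>_. 1"] poly_functions.const) simp
next
  case (insert q S)
  then obtain k where k: "k \<in> poly_functions coordinates" "k p = 1" "\<forall>q\<in>S. k q = 0" by auto
  obtain i where i: "p $ i \<noteq> q $ i" using insert.prems by (auto simp: vec_eq_iff)
  have "(\<lambda>z. k z * ((z $ i - q $ i) * (1 / (p $ i - q $ i)))) \<in> poly_functions coordinates"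
    using k(1) by (intro poly_function_intros)
  then show ?case using k i
    by (intro bexI [of _ "\<lambda>z. k z * ((z $ i - q $ i) * (1 / (p $ i - q $ i)))"]) auto
qed

text \<open>Averaging could cancel the value at \<open>p\<close>. The factor \<open>k\<close> is 1
  at \<open>p\<close> and 0 elsewhere on its orbit, so the sum is \<open>f p\<close> times the order
  of the stabiliser. As \<open>k\<close> does not depend on \<open>f\<close>, the same one serves
  for a numerator and a denominator.\<close>

lemma average_separating:
  obtains k where "k \<in> poly_functions coordinates"
    "\<And>f. f p \<noteq> 0 \<Longrightarrow> average (\<lambda>x. f x * k x) p \<noteq> 0"
proof -
  have "finite ((\<lambda>n. (cyc ^^ n) p) ` {..<6} - {p})" "p \<notin> (\<lambda>n. (cyc ^^ n) p) ` {..<6} - {p}" by auto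
  from poly_function_separating [OF this] obtain k where k: "k \<in> poly_functions coordinates" "k p = 1"
    "\<forall>q\<in>(\<lambda>n. (cyc ^^ n) p) ` {..<6} - {p}. k q = 0" by blast
  have "average (\<lambda>x. f x * k x) p \<noteq> 0" if f: "f p \<noteq> 0" for f
  proof -
    define T where "T = {n \<in> {..<6::nat}. (cyc ^^ n) p = p}"
    have "average (\<lambda>x. f x * k x) p = (\<Sum>n<6. if (cyc ^^ n) p = p then f p else 0)"
      unfolding average_def using k by (intro sum.cong refl) auto
    also have "\<dots> = of_nat (card T) * f p"
      unfolding T_def by (simp add: sum.If_cases Int_def)
    finally have "average (\<lambda>x. f x * k x) p = of_nat (card T) * f p" .
    moreover have "0 \<in> T" "finite T" by (simp_all add: T_def)
    then have "card T \<noteq> 0" by auto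
    ultimately show ?thesis using f by simp
  qed
  with k(1) show thesis by (rule that)
qed

text \<open>The cross-multiplied difference of two local fractions vanishes on a nonempty open set,
  hence everywhere, so one fraction satisfies its equation on all of \<open>\<Omega>\<close>. This
  reaches the whole orbit of a point, although \<open>h\<close> may vanish at some of its
  members.\<close>

lemma regular_on_plane_fraction:
  assumes \<Omega>: "openin (zariski affine_plane) \<Omega>" and \<psi>: "\<psi> \<in> regular affine_plane \<Omega>" and p: "p \<in> \<Omega>"
  obtains g h where "g \<in> poly_functions coordinates" "h \<in> poly_functions coordinates" "h p \<noteq> 0"
    "\<forall>y\<in>\<Omega>. \<psi> y * h y = g y"
proof -
  obtain f g h where f: "f \<in> poly_functions coordinates" "f p \<noteq> 0"
    and gh: "g \<in> poly_functions coordinates" "h \<in> poly_functions coordinates"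
    and frac: "\<And>y. y \<in> UNIV \<Longrightarrow> f y \<noteq> 0 \<Longrightarrow> y \<in> \<Omega> \<and> h y \<noteq> 0 \<and> \<psi> y = g y / h y"
    by (rule regular_affine_fspaceD [OF \<psi> p]) blast
  have "\<psi> y * h y = g y" if y: "y \<in> \<Omega>" for y
  proof -
    obtain f' g' h' where f': "f' \<in> poly_functions coordinates" "f' y \<noteq> 0"
      and gh': "g' \<in> poly_functions coordinates" "h' \<in> poly_functions coordinates"
      and frac': "\<And>z. z \<in> UNIV \<Longrightarrow> f' z \<noteq> 0 \<Longrightarrow> z \<in> \<Omega> \<and> h' z \<noteq> 0 \<and> \<psi> z = g' z / h' z"
      by (rule regular_affine_fspaceD [OF \<psi> y]) blast
    define D where "D = (\<lambda>z. g' z * h z - g z * h' z)"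
    have D: "D \<in> poly_functions coordinates"
      unfolding D_def using gh gh' by (intro poly_function_intros)
    have ff: "(\<lambda>z. f z * f' z) \<in> poly_functions coordinates" using f f' by (intro poly_function_intros)
    have "D z = 0" if "f z * f' z \<noteq> 0" for z
      using frac [of z] frac' [of z] that by (auto simp: D_def field_simps)
    moreover obtain z0 where "f z0 * f' z0 \<noteq> 0"
      using poly_functions_common_nonzero [OF f(1) f'(1) f(2) f'(2)] by auto
    ultimately have "D y = 0"
      using poly_functions_common_nonzero [OF D ff, of y z0] by metis
    then have D0: "g' y * h y = g y * h' y" by (simp add: D_def)
    have h': "h' y \<noteq> 0" "\<psi> y * h' y = g' y" using frac' [of y] f'(2) by auto
    have "h' y * (\<psi> y * h y) = h' y * g y" using D0 h'(2) by algebra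
    then show ?thesis using h'(1) by simp
  qed
  moreover have "h p \<noteq> 0" using frac [of p] f(2) by simp
  ultimately show thesis using that gh by blast
qed

lemma regular_affine_fspace_local:
  assumes "\<And>x. x \<in> U \<Longrightarrow> \<exists>V. x \<in> V \<and> V \<subseteq> U \<and> \<phi> \<in> regular (affine_fspace E S) V"
  shows "\<phi> \<in> regular (affine_fspace E S) U"
  unfolding regular_affine_fspace
proof
  fix x assume "x \<in> U"
  then obtain W where W: "x \<in> W" "W \<subseteq> U" "\<phi> \<in> regular (affine_fspace E S) W" using assms by blast
  from bspec [OF W(3) [unfolded regular_affine_fspace] W(1)]
  obtain V g h where "openin (zariski (affine_fspace E S)) V" "x \<in> V" "V \<subseteq> W"
       "g \<in> poly_functions E" "h \<in> poly_functions E" "\<forall>y\<in>V. h y \<noteq> 0 \<and> \<phi> y = g y / h y"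
    by blast
  with W(2) show "\<exists>V g h. openin (zariski (affine_fspace E S)) V \<and> x \<in> V \<and> V \<subseteq> U \<and>
       g \<in> poly_functions E \<and> h \<in> poly_functions E \<and> (\<forall>y\<in>V. h y \<noteq> 0 \<and> \<phi> y = g y / h y)"
    by (intro exI [of _ V] exI [of _ g] exI [of _ h]) auto
qed

subsection \<open>Rationality\<close>

definition vec3 :: "complex \<Rightarrow> complex \<Rightarrow> complex \<Rightarrow> complex^3" where
  "vec3 a b c = (\<chi> i. if i = 1 then a else if i = 2 then b else c)"

lemma vec3_nth [simp]: "vec3 a b c $ 1 = a" "vec3 a b c $ 2 = b" "vec3 a b c $ 3 = c"
  by (simp_all add: vec3_def)

abbreviation line_through :: "complex^3 \<Rightarrow> (complex^3) set" where
  "line_through \<equiv> proj_point (*s)"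

abbreviation cone3 :: "(complex^3) fspace" where
  "cone3 \<equiv> affine_fspace coordinates (UNIV - {0})"

definition plane_line :: "complex^2 \<Rightarrow> (complex^3) set" where
  "plane_line p = line_through (vec3 1 (cyc_invariants p $ 1) (cyc_invariants p $ 2))"

text \<open>All three entries have degree 12, so the line they span depends only on the point of
  projective space. On the slice they are 1, s^3 and s m, with s the sum and m the product of the
  parameters.\<close>

definition invariant_vector :: "complex^4 \<Rightarrow> complex^3" where
  "invariant_vector c = vec3 (inv_I c) (inv_J c ^ 3) (inv_K c * inv_J c)"

definition to_plane :: "(complex^6 \<Rightarrow> complex) set set \<Rightarrow> (complex^3) set" where
  "to_plane m = plane_line (SOME p. moduli_point (plane_coeffs p) = m)"

definition generic_coeffs :: "(complex^4) set" where
  "generic_coeffs = {c \<in> normal_locus. inv_J c \<noteq> 0}"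

definition generic_moduli :: "(complex^6 \<Rightarrow> complex) set set set" where
  "generic_moduli = {moduli_point (plane_coeffs p) | p. root_sum p \<noteq> 0}"

definition generic_cone :: "(complex^3) set" where
  "generic_cone = {z. z$1 \<noteq> 0 \<and> z$2 \<noteq> 0}"

definition cone_params :: "complex^3 \<Rightarrow> complex^2" where
  "cone_params z = vec2 (z$2 / z$1) (z$3 / z$1)"

lemma generic_coeffs_semistable: "generic_coeffs \<subseteq> semistable"
  using semistable_of_nonzero by (auto simp: generic_coeffs_def normal_locus_def)

lemma generic_moduli_preimage: "{c \<in> semistable. moduli_point c \<in> generic_moduli} = generic_coeffs"
proof (intro equalityI subsetI)
  fix c assume "c \<in> {c \<in> semistable. moduli_point c \<in> generic_moduli}"
  then obtain p where c: "c \<in> semistable" "moduli_point c = moduli_point (plane_coeffs p)" "root_sum p \<noteq> 0"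
    unfolding generic_moduli_def by blast
  note e = moduli_point_eq_plane [OF c(1,2)]
  have "c$1 \<noteq> 0" "c$2 \<noteq> 0" using e(1) by (auto simp: inv_I_def)
  moreover have "inv_J c ^ 3 \<noteq> 0" unfolding e(2) using e(1) c(3) by (simp add: root_sum_def)
  ultimately show "c \<in> generic_coeffs" by (auto simp: generic_coeffs_def normal_locus_def)
next
  fix c assume c: "c \<in> generic_coeffs"
  then have nz: "c$1 \<noteq> 0" "c$2 \<noteq> 0" "inv_J c \<noteq> 0" by (auto simp: generic_coeffs_def normal_locus_def)
  have s: "c \<in> semistable" using c generic_coeffs_semistable by blast
  have eq: "moduli_point c = moduli_point (plane_coeffs (normal_params c))"
    using moduli_point_normal_params nz by simp
  have "root_sum (normal_params c) \<noteq> 0"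
  proof
    assume "root_sum (normal_params c) = 0"
    then have "inv_J c ^ 3 = 0"
      using moduli_point_eq_plane(2) [OF s eq] by (simp add: root_sum_def)
    then show False using nz by simp
  qed
  then show "c \<in> {c \<in> semistable. moduli_point c \<in> generic_moduli}"
    using s eq unfolding generic_moduli_def by blast
qed

lemma openin_generic_coeffs: "openin (zariski coefficient_space) generic_coeffs"
proof -
  have "inv_J \<in> poly_functions coordinates"
    unfolding inv_J_def by (intro poly_function_intros)
  from openin_Int [OF openin_normal_locus openin_affine_fspace_basis [OF this, of "UNIV - {0}"]]
  have "openin (zariski coefficient_space) (normal_locus \<inter> {v \<in> UNIV - {0}. inv_J v \<noteq> 0})" .
  also have "normal_locus \<inter> {v \<in> UNIV - {0}. inv_J v \<noteq> 0} = generic_coeffs"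
    by (auto simp: generic_coeffs_def normal_locus_def)
  finally show ?thesis .
qed

lemma generic_moduli_subset: "generic_moduli \<subseteq> moduli_point ` semistable"
  using plane_coeffs_semistable by (auto simp: generic_moduli_def)

lemma openin_generic_moduli: "openin (zariski F21_moduli) generic_moduli"
  unfolding openin_F21_moduli generic_moduli_preimage
  using openin_generic_coeffs generic_moduli_subset by simp

text \<open>The representative chosen in \<open>to_plane\<close> does not matter, because the
  entries of \<open>invariant_vector c\<close> are \<open>inv_I c\<close> times those of any slice
  point with the same class.\<close>

lemma to_plane_moduli_point:
  assumes "c \<in> semistable" "moduli_point c \<in> moduli_point ` range plane_coeffs"
  shows "to_plane (moduli_point c) = line_through (invariant_vector c)" "invariant_vector c \<noteq> 0"
proof -
  define p where "p = (SOME p. moduli_point (plane_coeffs p) = moduli_point c)"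
  have "moduli_point (plane_coeffs p) = moduli_point c"
    unfolding p_def by (rule someI_ex) (use assms(2) in auto)
  note e = moduli_point_eq_plane [OF assms(1) this [symmetric]]
  have "invariant_vector c = inv_I c *s vec3 1 (cyc_invariants p $ 1) (cyc_invariants p $ 2)"
    unfolding invariant_vector_def e(2) e(3) cyc_invariants_def root_sum_def
    by (simp add: vec_eq_iff forall_3 mult_ac)
  with e(1) show "to_plane (moduli_point c) = line_through (invariant_vector c)"
    unfolding to_plane_def plane_line_def p_def [symmetric] using proj_point_eq_iff_vec by blast
  show "invariant_vector c \<noteq> 0"
    using e(1) by (auto simp: invariant_vector_def vec_eq_iff forall_3)
qed

lemma to_plane_plane: "to_plane (moduli_point (plane_coeffs p)) = plane_line p"
proof -
  have "invariant_vector (plane_coeffs p) = vec3 1 (cyc_invariants p $ 1) (cyc_invariants p $ 2)"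
    by (simp add: invariant_vector_def inv_I_def inv_J_def inv_K_def plane_coeffs_def cyc_invariants_def
        root_sum_def mult_ac add_ac)
  then show ?thesis
    using to_plane_moduli_point(1) [OF plane_coeffs_semistable, of p] by (simp add: plane_line_def)
qed

text \<open>A cube root of \<open>A\<close> is the wanted sum and \<open>B\<close> divided by it the
  wanted product; the parameters are the roots of the resulting quadratic.\<close>

lemma cyc_invariants_surj:
  assumes "A \<noteq> 0"
  shows "\<exists>p. root_sum p \<noteq> 0 \<and> cyc_invariants p = vec2 A B"
proof -
  obtain X where X: "A = X^3" by (rule exists_complex_root [of 3 A]) simp
  then have X0: "X \<noteq> 0" using assms by auto
  define s where "s = csqrt (X^2 - 4 * (B / X))"
  have s: "s^2 = X^2 - 4 * (B / X)" by (simp add: s_def)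
  define p where "p = vec2 ((X + s) / 2) ((X - s) / 2)"
  have sum: "root_sum p = X" by (simp add: root_sum_def p_def field_simps)
  have "2 * p$1 = X + s" "2 * p$2 = X - s" by (simp_all add: p_def)
  then have "4 * (p$1 * p$2) = X^2 - s^2" by algebra
  then have "4 * (p$1 * p$2) = 4 * (B / X)" unfolding s by (simp only: diff_diff_eq2 add_diff_cancel_left')
  then have "p$1 * p$2 = B / X" by (simp only: mult_cancel_left) simp
  then have "cyc_invariants p = vec2 A B" using X0 by (simp add: cyc_invariants_def sum X)
  with sum X0 show ?thesis by blast
qed

lemma line_through_plane_line:
  assumes z: "z \<in> generic_cone" and p: "cyc_invariants p = cone_params z"
  shows "line_through z = plane_line p"
proof -
  have "z = z$1 *s vec3 1 (cyc_invariants p $ 1) (cyc_invariants p $ 2)" "z$1 \<noteq> 0"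
    using z unfolding p by (simp_all add: vec_eq_iff forall_3 generic_cone_def cone_params_def)
  then show ?thesis unfolding plane_line_def using proj_point_eq_iff_vec by metis
qed

lemma plane_line_eq_line_through:
  assumes "line_through z = plane_line p"
  shows "z$1 \<noteq> 0" "cyc_invariants p = cone_params z"
proof -
  obtain a where "a \<noteq> 0" "z = a *s vec3 1 (cyc_invariants p $ 1) (cyc_invariants p $ 2)"
    using assms unfolding plane_line_def using proj_point_eq_iff_vec by metis
  then show "z$1 \<noteq> 0" "cyc_invariants p = cone_params z"
    by (simp_all add: cone_params_def vec2_eq_iff)
qed

text \<open>Where the sum is nonzero the third invariant (a b)^3 is the quotient of ((a + b) a b)^3
  by (a + b)^3, so two invariants separate the orbits.\<close>

lemma cyc_orbit_of_cyc_invariants: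
  assumes "cyc_invariants p = cyc_invariants q" "root_sum p \<noteq> 0"
  shows "cyc_orbit q = cyc_orbit p"
proof -
  have 1: "(root_sum p)^3 = (root_sum q)^3" "root_sum p * (p$1 * p$2) = root_sum q * (q$1 * q$2)"
    using assms(1) by (simp_all add: cyc_invariants_def vec2_eq_iff)
  have "(root_sum p)^3 * (p$1 * p$2)^3 = (root_sum p)^3 * (q$1 * q$2)^3"
  proof -
    have "(root_sum p)^3 * (p$1 * p$2)^3 = (root_sum p * (p$1 * p$2))^3" by algebra
    also have "\<dots> = (root_sum q)^3 * (q$1 * q$2)^3" unfolding 1(2) by algebra
    finally show ?thesis unfolding 1(1) .
  qed
  then have 2: "(p$1 * p$2)^3 = (q$1 * q$2)^3" using assms(2) by simp
  have "\<exists>n. vec2 (p$1) (p$2) = (cyc ^^ n) (vec2 (q$1) (q$2))"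
    using 1 2 by (intro cyc_orbit_of_invariants) (simp_all add: root_sum_def)
  moreover have "vec2 (p$1) (p$2) = p" "vec2 (q$1) (q$2) = q" by (simp_all add: vec2_eq_iff)
  ultimately show ?thesis unfolding cyc_orbit_eq_iff by simp
qed

lemma rational_map_on_invariant_vector: "rational_map_on coordinates coordinates D invariant_vector"
proof (rule rational_map_on_polyI)
  have "\<forall>i. (\<lambda>c. invariant_vector c $ i) \<in> poly_functions coordinates"
    unfolding forall_3 invariant_vector_def vec3_nth inv_I_def inv_J_def inv_K_def
    by (intro conjI poly_function_intros)
  then show "e \<in> coordinates \<Longrightarrow> (\<lambda>x. e (invariant_vector x)) \<in> poly_functions coordinates" for e
    unfolding coordinates_def by auto
qed

lemma rational_map_on_cone_params:
  assumes "D \<subseteq> generic_cone"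
  shows "rational_map_on coordinates coordinates D cone_params"
  unfolding rational_map_on_def
proof (intro bexI [of _ "\<lambda>z. z$1"] conjI ballI)
  show "z$1 \<noteq> 0" if "z \<in> D" for z using that assms by (auto simp: generic_cone_def)
  fix e :: "complex^2 \<Rightarrow> complex" assume "e \<in> coordinates"
  then obtain i where e: "e = (\<lambda>v. v $ i)" unfolding coordinates_def by blast
  have c: "cone_params z $ 1 * (z$1)^1 = z$2" "cone_params z $ 2 * (z$1)^1 = z$3" if "z \<in> D" for z
    using that assms by (auto simp: cone_params_def generic_cone_def)
  have "i = 1 \<or> i = 2" by (rule exhaust_2)
  then show "\<exists>k. \<exists>g\<in>poly_functions coordinates. \<forall>z\<in>D. e (cone_params z) * (z$1)^k = g z"
  proof
    assume "i = 1"
    then show ?thesis unfolding e using c(1)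
      by (intro exI [of _ 1] bexI [OF _ coordinate_poly_function [of 2]] ballI) simp
  next
    assume "i = 2"
    then show ?thesis unfolding e using c(2)
      by (intro exI [of _ 1] bexI [OF _ coordinate_poly_function [of 3]] ballI) simp
  qed
qed (rule coordinate_poly_function)

lemma openin_generic_cone: "openin (zariski cone3) generic_cone"
proof -
  have "(\<lambda>z :: complex^3. z$1 * z$2) \<in> poly_functions coordinates" by (intro poly_function_intros)
  from openin_affine_fspace_basis [OF this, of "UNIV - {0}"]
  have "openin (zariski cone3) {z \<in> UNIV - {0}. z$1 * z$2 \<noteq> 0}" .
  also have "{z :: complex^3 \<in> UNIV - {0}. z$1 * z$2 \<noteq> 0} = generic_cone"
    by (auto simp: generic_cone_def)
  finally show ?thesis .
qed

lemma line_through_generic_cone_iff: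
  "line_through z \<in> line_through ` generic_cone \<longleftrightarrow> z \<in> generic_cone"
proof
  assume "line_through z \<in> line_through ` generic_cone"
  then obtain w where w: "w \<in> generic_cone" "line_through z = line_through w" by blast
  then obtain a where "a \<noteq> 0" "w = a *s z" using proj_point_eq_iff_vec by blast
  with w(1) show "z \<in> generic_cone" by (simp add: generic_cone_def)
qed blast

lemma generic_cone_nonzero: "z \<in> generic_cone \<Longrightarrow> z \<noteq> 0"
  by (auto simp: generic_cone_def)

lemma openin_generic_lines: "openin (zariski projective_space) (line_through ` generic_cone)"
proof -
  have "{z \<in> UNIV - {0}. line_through z \<in> line_through ` generic_cone} = generic_cone"
    using line_through_generic_cone_iff generic_cone_nonzero by auto
  then show ?thesis
    unfolding openin_projective_space using openin_generic_cone generic_cone_nonzero by auto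
qed

lemma plane_line_generic: "root_sum p \<noteq> 0 \<Longrightarrow> plane_line p \<in> line_through ` generic_cone"
  unfolding plane_line_def by (rule imageI) (simp add: generic_cone_def cyc_invariants_def)

lemma to_plane_image: "to_plane ` generic_moduli = line_through ` generic_cone"
proof
  show "to_plane ` generic_moduli \<subseteq> line_through ` generic_cone"
    using plane_line_generic by (auto simp: generic_moduli_def to_plane_plane)
  show "line_through ` generic_cone \<subseteq> to_plane ` generic_moduli"
  proof (rule image_subsetI)
    fix z assume z: "z \<in> generic_cone"
    then have "z$2 / z$1 \<noteq> 0" by (simp add: generic_cone_def)
    then obtain p where "root_sum p \<noteq> 0" "cyc_invariants p = cone_params z"
      using cyc_invariants_surj unfolding cone_params_def by blast
    then have "line_through z = to_plane (moduli_point (plane_coeffs p))" "root_sum p \<noteq> 0"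
      using line_through_plane_line [OF z] by (simp_all add: to_plane_plane)
    then show "line_through z \<in> to_plane ` generic_moduli"
      unfolding generic_moduli_def by blast
  qed
qed

lemma to_plane_image_iff:
  assumes U: "U \<subseteq> generic_moduli" and z: "z \<in> generic_cone" and p: "cyc_invariants p = cone_params z"
  shows "line_through z \<in> to_plane ` U \<longleftrightarrow> moduli_point (plane_coeffs p) \<in> U"
proof
  assume "moduli_point (plane_coeffs p) \<in> U"
  moreover have "line_through z = to_plane (moduli_point (plane_coeffs p))"
    unfolding to_plane_plane by (rule line_through_plane_line [OF z p])
  ultimately show "line_through z \<in> to_plane ` U" by blast
next
  assume "line_through z \<in> to_plane ` U"
  then obtain m where m: "m \<in> U" "line_through z = to_plane m" by blast
  then obtain q where q: "m = moduli_point (plane_coeffs q)" "root_sum q \<noteq> 0"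
    using U unfolding generic_moduli_def by blast
  have "line_through z = plane_line q" using m(2) unfolding q(1) to_plane_plane .
  then have "cyc_invariants q = cyc_invariants p" unfolding p by (rule plane_line_eq_line_through(2))
  then have "cyc_orbit p = cyc_orbit q" using q(2) by (rule cyc_orbit_of_cyc_invariants)
  then show "moduli_point (plane_coeffs p) \<in> U"
    using m(1) unfolding q(1) moduli_point_plane_eq_iff [symmetric] by simp
qed

lemma to_plane_image_generic:
  "U \<subseteq> generic_moduli \<Longrightarrow> line_through z \<in> to_plane ` U \<Longrightarrow> z \<in> generic_cone"
  using to_plane_image line_through_generic_cone_iff by blast

lemma generic_cone_params:
  assumes "z \<in> generic_cone"
  obtains p where "cyc_invariants p = cone_params z" "root_sum p \<noteq> 0"
  using assms cyc_invariants_surj [of "z$2 / z$1"] unfolding cone_params_def generic_cone_def by auto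

lemma generic_open_in_plane:
  assumes "openin (zariski F21_moduli) U"
  shows "openin (zariski affine_plane) {p. moduli_point (plane_coeffs p) \<in> U}"
proof -
  have "openin (zariski coefficient_space) {c \<in> semistable. moduli_point c \<in> U}"
    using assms unfolding openin_F21_moduli by simp
  from openin_plane_preimage [OF this] show ?thesis using plane_coeffs_semistable by simp
qed

text \<open>The average of a function descends to the invariants. Where it is nonzero, some point of
  the orbit lies in the open set, and the open set is stable under the group; so its nonvanishing
  defines a neighbourhood inside the image.\<close>

lemma openin_to_plane_image:
  assumes U: "openin (zariski F21_moduli) U" "U \<subseteq> generic_moduli"
  shows "openin (zariski projective_space) (to_plane ` U)"
  unfolding openin_projective_space
proof
  show "to_plane ` U \<subseteq> line_through ` (UNIV - {0})"
  proof (rule order_trans [OF image_mono [OF U(2)]])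
    show "to_plane ` generic_moduli \<subseteq> line_through ` (UNIV - {0})"
      unfolding to_plane_image using generic_cone_nonzero by (intro image_mono) auto
  qed
  let ?\<Omega> = "{p. moduli_point (plane_coeffs p) \<in> U}"
  show "openin (zariski cone3) {z \<in> UNIV - {0}. line_through z \<in> to_plane ` U}"
    unfolding openin_subopen [of _ "{z \<in> UNIV - {0}. line_through z \<in> to_plane ` U}"]
  proof
    fix z assume "z \<in> {z \<in> UNIV - {0}. line_through z \<in> to_plane ` U}"
    then have zU: "line_through z \<in> to_plane ` U" by simp
    have z: "z \<in> generic_cone" by (rule to_plane_image_generic [OF U(2) zU])
    obtain p where p: "cyc_invariants p = cone_params z" "root_sum p \<noteq> 0"
      by (rule generic_cone_params [OF z])
    have "p \<in> ?\<Omega>" using zU to_plane_image_iff [OF U(2) z p(1)] by simp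
    then obtain f where f: "f \<in> poly_functions coordinates" "f p \<noteq> 0"
      and fU: "\<forall>y\<in>UNIV. f y \<noteq> 0 \<longrightarrow> y \<in> ?\<Omega>"
      using openin_affine_fspaceE [OF generic_open_in_plane [OF U(1)]] by blast
    obtain k where k: "k \<in> poly_functions coordinates"
      "\<And>f. f p \<noteq> 0 \<Longrightarrow> average (\<lambda>x. f x * k x) p \<noteq> 0" by (rule average_separating [of p]) blast
    obtain N g where g: "g \<in> poly_functions coordinates"
      "\<And>p. average (\<lambda>x. f x * k x) p * (cyc_invariants p $ 1)^N = g (cyc_invariants p)"
      using average_poly_function [OF poly_functions.mult [OF f(1) k(1)]] by blast
    have nonzero: "cyc_invariants q $ 1 \<noteq> 0" if "root_sum q \<noteq> 0" for q
      using that by (simp add: cyc_invariants_def)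
    have \<Omega>: "q \<in> ?\<Omega>" if q: "average (\<lambda>x. f x * k x) q \<noteq> 0" for q
    proof -
      obtain n where "f ((cyc ^^ n) q) \<noteq> 0"
        using q unfolding average_def by (metis (mono_tags, lifting) mult_zero_left sum.neutral)
      then have "moduli_point (plane_coeffs ((cyc ^^ n) q)) \<in> U" using fU by blast
      then show ?thesis by (simp add: moduli_point_cyc)
    qed
    define T where "T = {w \<in> generic_cone. cone_params w \<in> {v \<in> UNIV. g v \<noteq> 0}}"
    have "openin (zariski cone3) T"
      unfolding T_def
      by (rule openin_rational_preimage [OF rational_map_on_cone_params [OF order_refl] subset_UNIV openin_generic_cone
            openin_affine_fspace_basis [OF g(1)]])
    moreover have "z \<in> T"
    proof -
      have "g (cyc_invariants p) \<noteq> 0"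
        unfolding g(2) [symmetric] using k(2) [of f, OF f(2)] nonzero [OF p(2)] by simp
      then show ?thesis unfolding T_def p(1) using z by simp
    qed
    moreover have "T \<subseteq> {z \<in> UNIV - {0}. line_through z \<in> to_plane ` U}"
    proof
      fix w assume "w \<in> T"
      then have w: "w \<in> generic_cone" "g (cone_params w) \<noteq> 0" by (simp_all add: T_def)
      obtain q where q: "cyc_invariants q = cone_params w" "root_sum q \<noteq> 0"
        by (rule generic_cone_params [OF w(1)])
      have "average (\<lambda>x. f x * k x) q \<noteq> 0"
        using w(2) unfolding q(1) [symmetric] g(2) [symmetric] by auto
      then have "line_through w \<in> to_plane ` U"
        using \<Omega> to_plane_image_iff [OF U(2) w(1) q(1)] by simp
      then show "w \<in> {z \<in> UNIV - {0}. line_through z \<in> to_plane ` U}"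
        using generic_cone_nonzero [OF w(1)] by simp
    qed
    ultimately show "\<exists>T. openin (zariski cone3) T \<and> z \<in> T \<and> T \<subseteq> {z \<in> UNIV - {0}. line_through z \<in> to_plane ` U}"
      by blast
  qed
qed

lemma regular_projective_space:
  "\<phi> \<in> regular (projective_space :: (complex^'n) set fspace) U \<longleftrightarrow>
    \<phi> \<circ> proj_point (*s) \<in> regular (affine_fspace coordinates (UNIV - {0})) {z \<in> UNIV - {0}. proj_point (*s) z \<in> U}"
  unfolding projective_space_def proj_fspace_def regular_quotient_fspace points_affine_fspace ..

lemma to_plane_preimage:
  assumes V: "V \<subseteq> line_through ` generic_cone"
  shows "{c \<in> semistable. moduli_point c \<in> {m \<in> generic_moduli. to_plane m \<in> V}} =
    {c \<in> generic_coeffs. invariant_vector c \<in> {z \<in> UNIV - {0}. line_through z \<in> V}}"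
proof -
  have "moduli_point c \<in> generic_moduli \<longleftrightarrow> c \<in> generic_coeffs" if "c \<in> semistable" for c
    using that generic_moduli_preimage by blast
  moreover have "to_plane (moduli_point c) = line_through (invariant_vector c)" "invariant_vector c \<noteq> 0"
    if c: "c \<in> generic_coeffs" for c
  proof -
    have m: "c \<in> semistable" "moduli_point c \<in> generic_moduli"
      using c unfolding generic_moduli_preimage [symmetric] by blast+
    have "moduli_point c \<in> moduli_point ` range plane_coeffs"
      using m(2) unfolding generic_moduli_def by blast
    from to_plane_moduli_point [OF m(1) this] show "to_plane (moduli_point c) = line_through (invariant_vector c)"
      "invariant_vector c \<noteq> 0" .
  qed
  ultimately show ?thesis using generic_coeffs_semistable by auto
qed

lemma generic_coeffs_image: "invariant_vector ` generic_coeffs \<subseteq> UNIV - {0}"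
proof
  fix z assume "z \<in> invariant_vector ` generic_coeffs"
  then obtain c where c: "c \<in> generic_coeffs" "z = invariant_vector c" by blast
  then have "inv_I c \<noteq> 0" by (simp add: generic_coeffs_def normal_locus_def inv_I_def)
  then show "z \<in> UNIV - {0}" unfolding c(2) by (auto simp: invariant_vector_def vec_eq_iff forall_3)
qed

text \<open>In one direction \<open>invariant_vector\<close> pulls functions back. In the other, an
  invariant fraction g / h is replaced by the fraction of the averages of g k and h k, which are
  polynomials in the invariants up to powers of the first one.\<close>

lemma regular_to_plane:
  assumes U: "openin (zariski F21_moduli) U" "U \<subseteq> generic_moduli"
  shows "\<phi> \<in> regular projective_space (to_plane ` U) \<longleftrightarrow> \<phi> \<circ> to_plane \<in> regular F21_moduli U"
proof
  have inj: "{m \<in> generic_moduli. to_plane m \<in> to_plane ` U} = U"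
  proof (intro equalityI subsetI)
    fix m assume m: "m \<in> {m \<in> generic_moduli. to_plane m \<in> to_plane ` U}"
    then obtain p where p: "m = moduli_point (plane_coeffs p)" "root_sum p \<noteq> 0"
      unfolding generic_moduli_def by blast
    let ?z = "vec3 1 (cyc_invariants p $ 1) (cyc_invariants p $ 2)"
    have z: "?z \<in> generic_cone" "cyc_invariants p = cone_params ?z"
      using p(2) by (simp_all add: generic_cone_def cone_params_def vec2_eq_iff) (simp add: cyc_invariants_def)
    have "line_through ?z \<in> to_plane ` U" using m unfolding p(1) by (simp add: to_plane_plane plane_line_def)
    then show "m \<in> U" unfolding p(1) using to_plane_image_iff [OF U(2) z] by simp
  qed (use U(2) in auto)
  have V: "to_plane ` U \<subseteq> line_through ` generic_cone" using to_plane_image U(2) by blast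
  note pre = to_plane_preimage [OF V, unfolded inj]
  show "\<phi> \<circ> to_plane \<in> regular F21_moduli U" if \<phi>: "\<phi> \<in> regular projective_space (to_plane ` U)"
  proof -
    from regular_rational_pullback [OF rational_map_on_invariant_vector generic_coeffs_image openin_generic_coeffs
        refl \<phi> [unfolded regular_projective_space]]
    have "\<phi> \<circ> line_through \<circ> invariant_vector \<in> regular coefficient_space {c \<in> semistable. moduli_point c \<in> U}"
      unfolding pre .
    moreover have "(\<phi> \<circ> line_through \<circ> invariant_vector) c = (\<phi> \<circ> to_plane \<circ> moduli_point) c"
      if c: "c \<in> {c \<in> semistable. moduli_point c \<in> U}" for c
    proof -
      have "c \<in> semistable" "moduli_point c \<in> moduli_point ` range plane_coeffs"
        using c U(2) by (auto simp: generic_moduli_def)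
      from to_plane_moduli_point(1) [OF this] show ?thesis by simp
    qed
    ultimately show ?thesis
      unfolding regular_F21_moduli using regular_affine_fspace_cong by blast
  qed
  assume \<phi>: "\<phi> \<circ> to_plane \<in> regular F21_moduli U"
  let ?\<Omega> = "{p. moduli_point (plane_coeffs p) \<in> U}"
  define \<psi> where "\<psi> = \<phi> \<circ> to_plane \<circ> moduli_point \<circ> plane_coeffs"
  have \<psi>: "\<psi> \<in> regular affine_plane ?\<Omega>"
    using regular_plane_pullback [OF \<phi> [unfolded regular_F21_moduli]] plane_coeffs_semistable
    unfolding \<psi>_def by simp
  have \<psi>_eq: "\<psi> p = \<phi> (plane_line p)" for p by (simp add: \<psi>_def to_plane_plane)
  show "\<phi> \<in> regular projective_space (to_plane ` U)"
    unfolding regular_projective_space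
  proof (rule regular_affine_fspace_local)
    fix z assume "z \<in> {z \<in> UNIV - {0}. line_through z \<in> to_plane ` U}"
    then have zU: "line_through z \<in> to_plane ` U" by simp
    have z: "z \<in> generic_cone" by (rule to_plane_image_generic [OF U(2) zU])
    obtain p where p: "cyc_invariants p = cone_params z" "root_sum p \<noteq> 0"
      by (rule generic_cone_params [OF z])
    have "p \<in> ?\<Omega>" using zU to_plane_image_iff [OF U(2) z p(1)] by simp
    from regular_on_plane_fraction [OF generic_open_in_plane [OF U(1)] \<psi> this]
    obtain g h where gh: "g \<in> poly_functions coordinates" "h \<in> poly_functions coordinates" "h p \<noteq> 0"
      "\<forall>y\<in>?\<Omega>. \<psi> y * h y = g y" .
    obtain k where k: "k \<in> poly_functions coordinates"
      "\<And>f. f p \<noteq> 0 \<Longrightarrow> average (\<lambda>x. f x * k x) p \<noteq> 0" by (rule average_separating [of p]) blast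
    obtain M G where G: "G \<in> poly_functions coordinates"
      "\<And>p. average (\<lambda>x. g x * k x) p * (cyc_invariants p $ 1)^M = G (cyc_invariants p)"
      using average_poly_function [OF poly_functions.mult [OF gh(1) k(1)]] by blast
    obtain N H where H: "H \<in> poly_functions coordinates"
      "\<And>p. average (\<lambda>x. h x * k x) p * (cyc_invariants p $ 1)^N = H (cyc_invariants p)"
      using average_poly_function [OF poly_functions.mult [OF gh(2) k(1)]] by blast
    have avg: "\<psi> y * average (\<lambda>x. h x * k x) y = average (\<lambda>x. g x * k x) y" if y: "y \<in> ?\<Omega>" for y
    proof -
      have "\<psi> y * (h ((cyc ^^ n) y) * k ((cyc ^^ n) y)) = g ((cyc ^^ n) y) * k ((cyc ^^ n) y)" for n
      proof -
        have "(cyc ^^ n) y \<in> ?\<Omega>" using y by (simp add: moduli_point_cyc)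
        then have "\<psi> ((cyc ^^ n) y) * h ((cyc ^^ n) y) = g ((cyc ^^ n) y)" using gh(4) by blast
        moreover have "\<psi> ((cyc ^^ n) y) = \<psi> y" by (simp add: \<psi>_def moduli_point_cyc)
        ultimately show ?thesis by (metis mult.assoc)
      qed
      then show ?thesis unfolding average_def sum_distrib_left by (intro sum.cong refl)
    qed
    \<comment> \<open>The averages are G / v1^M and H / v1^N in the invariants v, so each exponent
      moves to the other side of the fraction.\<close>
    define \<Phi> where "\<Phi> = (\<lambda>v. G v * (v$1)^N / (H v * (v$1)^M))"
    have num: "(\<lambda>v. G v * (v$1)^N) \<in> poly_functions coordinates"
      using G(1) by (intro poly_function_intros)
    have den: "(\<lambda>v. H v * (v$1)^M) \<in> poly_functions coordinates"
      using H(1) by (intro poly_function_intros)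
    define V where "V = {v. H v * (v$1)^M \<noteq> 0}"
    have \<Phi>: "\<Phi> \<in> regular affine_plane V"
    proof (rule regular_affine_fspaceI [OF subset_UNIV])
      fix v assume "v \<in> V"
      then show "\<exists>f g h. f \<in> poly_functions coordinates \<and> g \<in> poly_functions coordinates \<and>
          h \<in> poly_functions coordinates \<and>
          f v \<noteq> 0 \<and> (\<forall>y\<in>UNIV. f y \<noteq> 0 \<longrightarrow> y \<in> V \<and> h y \<noteq> 0 \<and> \<Phi> y = g y / h y)"
        unfolding V_def \<Phi>_def
        by (intro exI [of _ "\<lambda>v. H v * (v$1)^M"] exI [of _ "\<lambda>v. G v * (v$1)^N"] conjI ballI impI num den)
          simp_all
    qed
    define T where "T = {w \<in> generic_cone. cone_params w \<in> V} \<inter> {z \<in> UNIV - {0}. line_through z \<in> to_plane ` U}"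
    have "openin (zariski affine_plane) V"
      using openin_affine_fspace_basis [OF den, of UNIV] by (simp add: V_def)
    from openin_rational_preimage [OF rational_map_on_cone_params [OF order_refl] subset_UNIV openin_generic_cone this]
    have oV: "openin (zariski cone3) {w \<in> generic_cone. cone_params w \<in> V}" .
    have oT: "openin (zariski cone3) T"
      unfolding T_def
      by (rule openin_Int [OF oV]) (use openin_to_plane_image [OF U] in \<open>simp add: openin_projective_space\<close>)
    have "\<Phi> \<circ> cone_params \<in> regular cone3 T"
    proof (rule regular_rational_pullback [OF _ subset_UNIV oT _ \<Phi>])
      show "rational_map_on coordinates coordinates T cone_params"
        by (rule rational_map_on_cone_params) (auto simp: T_def)
      show "T = {x \<in> T. cone_params x \<in> V}" by (auto simp: T_def)
    qed
    moreover have "(\<Phi> \<circ> cone_params) w = (\<phi> \<circ> line_through) w" if w: "w \<in> T" for w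
    proof -
      have w': "w \<in> generic_cone" "cone_params w \<in> V" "line_through w \<in> to_plane ` U"
        using w by (simp_all add: T_def)
      obtain q where q: "cyc_invariants q = cone_params w" "root_sum q \<noteq> 0"
        by (rule generic_cone_params [OF w'(1)])
      have "q \<in> ?\<Omega>" using w'(3) to_plane_image_iff [OF U(2) w'(1) q(1)] by simp
      from avg [OF this] have e: "\<psi> q * average (\<lambda>x. h x * k x) q = average (\<lambda>x. g x * k x) q" .
      let ?v = "cone_params w"
      have "\<psi> q * (H ?v * (?v$1)^M) = G ?v * (?v$1)^N"
        unfolding q(1) [symmetric] G(2) [symmetric] H(2) [symmetric] e [symmetric] by (simp only: mult_ac)
      moreover have "H ?v * (?v$1)^M \<noteq> 0" using w'(2) by (simp add: V_def)
      ultimately have "\<psi> q = \<Phi> ?v" by (simp add: \<Phi>_def eq_divide_eq)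
      moreover have "line_through w = plane_line q" by (rule line_through_plane_line [OF w'(1) q(1)])
      ultimately show ?thesis by (simp add: \<psi>_eq)
    qed
    ultimately have "\<phi> \<circ> line_through \<in> regular cone3 T"
      using regular_affine_fspace_cong by blast
    moreover have "z \<in> T"
    proof -
      have "H (cyc_invariants p) \<noteq> 0"
        unfolding H(2) [symmetric] using k(2) [of h, OF gh(3)] p(2) by (simp add: cyc_invariants_def)
      moreover have "cyc_invariants p $ 1 \<noteq> 0" using p(2) by (simp add: cyc_invariants_def)
      ultimately show ?thesis
        unfolding T_def V_def using z zU generic_cone_nonzero [OF z] by (simp add: p(1))
    qed
    moreover have "T \<subseteq> {z \<in> UNIV - {0}. line_through z \<in> to_plane ` U}" by (auto simp: T_def)
    ultimately show "\<exists>V. z \<in> V \<and> V \<subseteq> {z \<in> UNIV - {0}. line_through z \<in> to_plane ` U} \<and>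
        \<phi> \<circ> line_through \<in> regular cone3 V" by blast
  qed
qed

lemma inj_on_to_plane: "inj_on to_plane generic_moduli"
proof (rule inj_onI)
  fix m n assume mn: "m \<in> generic_moduli" "n \<in> generic_moduli" "to_plane m = to_plane n"
  then obtain p q where pq: "m = moduli_point (plane_coeffs p)" "root_sum p \<noteq> 0"
    "n = moduli_point (plane_coeffs q)" unfolding generic_moduli_def by blast
  let ?z = "vec3 1 (cyc_invariants p $ 1) (cyc_invariants p $ 2)"
  have "line_through ?z = plane_line q"
    using mn(3) unfolding pq to_plane_plane by (simp add: plane_line_def)
  then have "cyc_invariants q = cone_params ?z" by (rule plane_line_eq_line_through(2))
  then have "cyc_invariants p = cyc_invariants q" by (simp add: cone_params_def vec2_eq_iff)
  then have "cyc_orbit q = cyc_orbit p" using pq(2) by (rule cyc_orbit_of_cyc_invariants)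
  then show "m = n" unfolding pq moduli_point_plane_eq_iff ..
qed

lemma birational_F21_moduli: "birational F21_moduli (projective_space :: (complex^3) set fspace)"
proof -
  let ?X = "open_subspace F21_moduli generic_moduli"
  let ?Y = "open_subspace (projective_space :: (complex^3) set fspace) (line_through ` generic_cone)"
  have ptX: "points ?X = generic_moduli"
    unfolding points_open_subspace points_F21_moduli using generic_moduli_subset by blast
  have ptY: "points ?Y = line_through ` generic_cone"
    unfolding points_open_subspace points_projective_space using generic_cone_nonzero by blast
  have "open_immersion ?X ?Y to_plane"
    unfolding open_immersion_def
  proof (intro conjI allI impI)
    show "inj_on to_plane (points ?X)" unfolding ptX by (rule inj_on_to_plane)
    show "continuous_map (zariski ?X) (zariski ?Y) to_plane"
      unfolding continuous_map_def ptX ptY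
    proof (intro conjI allI impI)
      show "to_plane \<in> generic_moduli \<rightarrow> line_through ` generic_cone" using to_plane_image by blast
      fix V assume "openin (zariski ?Y) V"
      then have V: "openin (zariski projective_space) V" "V \<subseteq> line_through ` generic_cone"
        unfolding openin_open_subspace [OF openin_generic_lines] by simp_all
      have "openin (zariski coefficient_space) {c \<in> generic_coeffs. invariant_vector c \<in> {z \<in> UNIV - {0}. line_through z \<in> V}}"
        by (rule openin_rational_preimage [OF rational_map_on_invariant_vector generic_coeffs_image openin_generic_coeffs])
          (use V(1) in \<open>simp add: openin_projective_space\<close>)
      then have "openin (zariski F21_moduli) {m \<in> generic_moduli. to_plane m \<in> V}"
        unfolding openin_F21_moduli to_plane_preimage [OF V(2)] using generic_moduli_subset by auto
      then show "openin (zariski ?X) {m \<in> generic_moduli. to_plane m \<in> V}"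
        unfolding openin_open_subspace [OF openin_generic_moduli] by simp
    qed
    show "open_map (zariski ?X) (zariski ?Y) to_plane"
      unfolding open_map_def openin_open_subspace [OF openin_generic_moduli]
        openin_open_subspace [OF openin_generic_lines]
      using openin_to_plane_image to_plane_image by blast
    fix U \<phi> assume "openin (zariski ?X) U"
    then have U: "openin (zariski F21_moduli) U" "U \<subseteq> generic_moduli"
      unfolding openin_open_subspace [OF openin_generic_moduli] by simp_all
    show "\<phi> \<in> regular ?Y (to_plane ` U) \<longleftrightarrow> \<phi> \<circ> to_plane \<in> regular ?X U"
      unfolding regular_open_subspace by (rule regular_to_plane [OF U])
  qed
  moreover have "to_plane ` points ?X = points ?Y" unfolding ptX ptY by (rule to_plane_image)
  ultimately have "isomorphic_fspaces ?X ?Y" unfolding isomorphic_fspaces_def by blast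
  moreover have "root_sum (vec2 1 0) \<noteq> 0" by (simp add: root_sum_def)
  then have "generic_moduli \<noteq> {}" unfolding generic_moduli_def by blast
  moreover from this have "line_through ` generic_cone \<noteq> {}" unfolding to_plane_image [symmetric] by simp
  ultimately show ?thesis
    unfolding birational_def using openin_generic_moduli openin_generic_lines by blast
qed

lemma cyc_action_poly: "(\<lambda>p. cyc_action g p $ i) \<in> poly_functions coordinates"
proof -
  have "\<forall>i. (\<lambda>p. (cyc ^^ n) p $ i) \<in> poly_functions coordinates" for n
    unfolding forall_2 cyc_power
    by (cases "even n") (auto intro!: poly_function_intros)
  then show ?thesis unfolding cyc_action_def by blast
qed

theorem proposition1p3:
  shows
    "(\<exists>\<C>. card \<C> = 3 \<and> (\<forall>C\<in>\<C>. irreducible_plane_curve C) \<and>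
        {p. singular_locus (cubic_family (p $ 1) (p $ 2)) \<noteq> {}} = \<Union>\<C>) \<and>
     (\<forall>a b. \<forall>P\<in>singular_locus (cubic_family a b).
        isolated_singularity (cubic_family a b) P \<and>
        (singularity_type_A 1 (cubic_family a b) P \<or>
         singularity_type_A 2 (cubic_family a b) P)) \<and>
     (\<exists>\<alpha> \<iota>.
        group_action (integer_mod_group 6) (UNIV :: (complex^2) set) \<alpha> \<and>
        (\<forall>g\<in>carrier (integer_mod_group 6). \<forall>i. (\<lambda>p. \<alpha> g p $ i) \<in> poly_functions coordinates) \<and>
        open_immersion (quotient_fspace (orbit (integer_mod_group 6) \<alpha>) affine_plane)
          F21_moduli \<iota> \<and>
        (\<forall>p. \<iota> (orbit (integer_mod_group 6) \<alpha> p) =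
               F21_moduli_class (cubic_family (p $ 1) (p $ 2)))) \<and>
     rational_surface F21_moduli"
proof (intro conjI)
  show "\<exists>\<C>. card \<C> = 3 \<and> (\<forall>C\<in>\<C>. irreducible_plane_curve C) \<and>
        {p. singular_locus (cubic_family (p $ 1) (p $ 2)) \<noteq> {}} = \<Union>\<C>"
    using card_singular_curves irreducible_singular_curve singular_parameters
    by (intro exI [of _ "singular_curve ` {\<kappa>. \<kappa>^3 = 1}"]) auto
  show "\<forall>a b. \<forall>P\<in>singular_locus (cubic_family a b).
        isolated_singularity (cubic_family a b) P \<and>
        (singularity_type_A 1 (cubic_family a b) P \<or> singularity_type_A 2 (cubic_family a b) P)"
    using singularities_cubic_family by blast
  show "\<exists>\<alpha> \<iota>.
        group_action (integer_mod_group 6) (UNIV :: (complex^2) set) \<alpha> \<and>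
        (\<forall>g\<in>carrier (integer_mod_group 6). \<forall>i. (\<lambda>p. \<alpha> g p $ i) \<in> poly_functions coordinates) \<and>
        open_immersion (quotient_fspace (orbit (integer_mod_group 6) \<alpha>) affine_plane) F21_moduli \<iota> \<and>
        (\<forall>p. \<iota> (orbit (integer_mod_group 6) \<alpha> p) = F21_moduli_class (cubic_family (p $ 1) (p $ 2)))"
    using cyc_group_action cyc_action_poly open_immersion_embed
    by (intro exI [of _ cyc_action] exI [of _ embed])
      (simp add: embed_orbit moduli_point_def cubic_family_eq_form)
  show "rational_surface F21_moduli"
    unfolding rational_surface_def using irreducible_F21_moduli birational_F21_moduli by blast
qed

end
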